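(* Let $p$ be a prime, let $(S,\mathcal F,\mathcal L)$ be a linking triple, and let $G$ be a finite group. (a) Let $U=(\widehat\Gamma,\tau)$ be an extension pair for $\mathcal L$ and $G$, and let $t_U\colon G\to\widehat\Gamma$ be a regular section. Then there is a unique twisting function $\phi=\phi_U\colon\mathcal N\mathcal B(G)\to\mathcal N\mathcal{A}ut_{\mathrm{typ}}(\mathcal L)$ such that (i) for all $g\in G$, $\tau(t_U(g))=\phi_1([g])$; and (ii) for all $g,h\in G$, $t_U(g)t_U(h)=\phi_2([g|h])\,t_U(gh)$. (b) Let $\phi=\{\phi_n\}$ be any twisting function from $\mathcal N\mathcal B(G)$ to $\mathcal N\mathcal{A}ut_{\mathrm{typ}}(\mathcal L)$. Then there is an extension pair $U=(\widehat\Gamma,\tau)$ for $\mathcal L$ and $G$, and a regular section $t_U\colon G\to\widehat\Gamma$, such that $\phi_U=\phi$ (where $\phi_U$ is the twisting function associated to $U$ and $t_U$ in (a)).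
   Context: Fix a prime $p$. A discrete $p$-toral group is a group $P$ with a normal subgroup $P_0\cong(\mathbb Z/p^\infty)^r$ (finite $r\ge0$) such that $P/P_0$ is a finite $p$-group; its order is $|P|=(r,|P/P_0|)$, compared lexicographically. $c_g(x)=gxg^{-1}$, $N_S(P,Q)=\{g\in S\mid gPg^{-1}\le Q\}$, $\mathrm{Hom}_S(P,Q)=\{c_g\mid g\in N_S(P,Q)\}$, $\mathrm{Aut}_S(P)=\mathrm{Hom}_S(P,P)$. A fusion system $\mathcal F$ over $S$ is a category whose objects are all subgroups of $S$, with $\mathrm{Hom}_S(P,Q)\subseteq\mathrm{Hom}_{\mathcal F}(P,Q)\subseteq\mathrm{Inj}(P,Q)$, in which every morphism is an $\mathcal F$-isomorphism followed by an inclusion. $P^{\mathcal F}$ is the set of subgroups isomorphic to $P$ in $\mathcal F$ ($\mathcal F$-conjugate to $P$). $\mathrm{Out}_{\mathcal F}(P)=\mathrm{Aut}_{\mathcal F}(P)/\mathrm{Inn}(P)$. $P$ is fully centralized (fully normalized) if $|C_S(P)|\ge|C_S(Q)|$ (resp. $|N_S(P)|\ge|N_S(Q)|$) for all $Q\in P^{\mathcal F}$. $\mathcal F$ is saturated if: (I) each fully normalized $P$ is fully centralized, $\mathrm{Out}_{\mathcal F}(P)$ is finite, and $\mathrm{Aut}_S(P)/\mathrm{Inn}(P)\in\mathrm{Syl}_p(\mathrm{Out}_{\mathcal F}(P))$; (II) if $\varphi\in\mathrm{Hom}_{\mathcal F}(P,S)$ has fully centralized image it extends to an element of $\mathrm{Hom}_{\mathcal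 F}(N_\varphi,S)$, $N_\varphi=\{g\in N_S(P)\mid\varphi c_g\varphi^{-1}\in\mathrm{Aut}_S(\varphi(P))\}$; (III) a homomorphism to $S$ from an increasing union $\bigcup P_n$ whose restriction to each $P_n$ is in $\mathcal F$ is itself in $\mathcal F$. $P$ is $\mathcal F$-centric if $C_S(Q)=Z(Q)$ for all $Q\in P^{\mathcal F}$, and $\mathcal F$-radical if $\mathrm{Out}_{\mathcal F}(P)$ has no nontrivial normal $p$-subgroup. For a set $\mathcal H$ of subgroups of $S$, $\mathcal T_{\mathcal H}(S)$ is the category with object set $\mathcal H$ and morphism sets $N_S(P,Q)$. Let $\mathcal H$ be closed under $\mathcal F$-conjugacy and overgroups and contain all $\mathcal F$-centric $\mathcal F$-radical subgroups. An $\mathcal H$-linking system associated to $\mathcal F$ is a category $\mathcal L$ with object set $\mathcal H$ and functors $\mathcal T_{\mathcal H}(S)\xrightarrow{\delta}\mathcal L\xrightarrow{\pi}\mathcal F$ such that each object is isomorphic in $\mathcal L$ to one fully centralized in $\mathcal F$, and: (A) $\delta$ is the identity and $\pi$ the inclusion on objects, and for $P,Q\in\mathcal H$ with $P$ fully centralized, $C_S(P)$ acts freely on $\mathrm{Mor}_{\mathcal L}(P,Q)$ via $\delta_P$ and right composition and $\pi$ induces a bijection $\mathrm{Mor}_{\mathcal L}(P,Q)/C_S(P)\cong\mathrm{Hom}_{\mathcal F}(P,Q)$; (B) $\pi(\delta_{P,Q}(g))=c_g$; (C) $\psi\circ\delta_P(g)=\delta_Q(\pi(\psi)(g))\circ\psi$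 for $\psi\in\mathrm{Mor}_{\mathcal L}(P,Q)$, $g\in P$. A linking triple $(S,\mathcal F,\mathcal L)$ consists of a discrete $p$-toral group $S$, a saturated fusion system $\mathcal F$ over $S$, and an $\mathcal H$-linking system $\mathcal L$ associated to $\mathcal F$ for some $\mathcal H$. Inclusions in $\mathcal L$ are the morphisms $\iota_{P,Q}=\delta_{P,Q}(1)$ for $P\le Q$. If $\psi\in\mathrm{Mor}_{\mathcal L}(P,Q)$ and $P_*\le P$, $Q_*\le Q$ are objects with $\pi(\psi)(P_* )\le Q_*$, then $\psi|_{P_*,Q_*}$ is the unique morphism with $\psi\circ\iota_{P_*,P}=\iota_{Q_*,Q}\circ\psi|_{P_*,Q_*}$. $\mathrm{Aut}^I_{\mathrm{typ}}(\mathcal L)$ is the group of automorphisms $\alpha$ of the category $\mathcal L$ which send inclusions to inclusions and satisfy $\alpha(\delta_P(P))=\delta_{\alpha(P)}(\alpha(P))$ for each object $P$. For $\gamma\in\mathrm{Aut}_{\mathcal L}(S)$, $c_\gamma\in\mathrm{Aut}^I_{\mathrm{typ}}(\mathcal L)$ sends an object $P$ to $\pi(\gamma)(P)$ and $\varphi\in\mathrm{Mor}_{\mathcal L}(P,Q)$ to $\gamma|_{Q,\pi(\gamma)(Q)}\circ\varphi\circ(\gamma|_{P,\pi(\gamma)(P)})^{-1}$. An extension pair for $\mathcal L$ and $G$ is a pair $U=(\widehat\Gamma,\tau)$ where $\widehat\Gamma$ is a group containing $\Gamma=\mathrm{Aut}_{\mathcal L}(S)$ as a normal subgroup, with a surjection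 $\rho\colon\widehat\Gamma\to G$ with kernel $\Gamma$, and $\tau\colon\widehat\Gamma\to\mathrm{Aut}^I_{\mathrm{typ}}(\mathcal L)$ is a homomorphism such that $\tau(\gamma)=c_\gamma$ for $\gamma\in\Gamma$, and such that for each $\gamma\in\widehat\Gamma$ the automorphism of $\Gamma=\mathrm{Aut}_{\mathcal L}(S)$ induced by $\tau(\gamma)$ is conjugation by $\gamma$. A regular section is a map of sets $t_U\colon G\to\widehat\Gamma$ with $\rho\circ t_U=\mathrm{Id}_G$ and $t_U(1)=1$. $\mathcal{A}ut_{\mathrm{typ}}(\mathcal L)$ is the groupoid with object set $\mathrm{Aut}^I_{\mathrm{typ}}(\mathcal L)$ and morphisms the natural transformations; a natural transformation is determined by its value on $S$, and so $\mathrm{Mor}(\alpha,\beta)=\{\chi\in\mathrm{Aut}_{\mathcal L}(S)\mid\beta=c_\chi\circ\alpha\}$, with composition that of $\mathrm{Aut}_{\mathcal L}(S)$. It is a strict monoidal category under $\alpha\cdot\beta=\alpha\circ\beta$ and $(\alpha\xrightarrow{\chi}\beta)\cdot(\alpha'\xrightarrow{\chi'}\beta')=(\alpha\alpha'\xrightarrow{\chi\circ\alpha(\chi')}\beta\beta')$ (and $\chi\circ\alpha(\chi')=\beta(\chi')\circ\chi$), which makes its nerve $\mathcal N\mathcal{A}ut_{\mathrm{typ}}(\mathcal L)$ a simplicial group. Nerve convention: an $n$-simplex of the nerve of a category is a sequence $c_0\xleftarrow{f_1}c_1\xleftarrow{f_2}\cdots\xleftarrow{f_n}c_n$; $d_i$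 omits $c_i$ (composing $f_i\circ f_{i+1}$ if $0<i<n$), and $s_i$ inserts an identity at $c_i$. $\mathcal B(G)$ is the category with one object and automorphism group $G$; its $n$-simplices are written $[g_1|\cdots|g_n]$. A twisting function $\phi\colon\mathcal N\mathcal B(G)\to\mathcal N\mathcal{A}ut_{\mathrm{typ}}(\mathcal L)$ is a collection of maps $\phi_n\colon\mathcal N_n\mathcal B(G)\to\mathcal N_{n-1}\mathcal{A}ut_{\mathrm{typ}}(\mathcal L)$, $n\ge1$, such that (whenever the terms are defined) $\phi_{n-1}(d_i\mathbf g)=d_{i-1}\phi_n(\mathbf g)$ for $2\le i\le n$; $\phi_{n-1}(d_1\mathbf g)=d_0\phi_n(\mathbf g)\cdot\phi_{n-1}(d_0\mathbf g)$; $\phi_{n+1}(s_i\mathbf g)=s_{i-1}\phi_n(\mathbf g)$ for $i\ge1$; and $\phi_{n+1}(s_0\mathbf g)=1$, the identity element. In (ii), the $1$-simplex (morphism) $\phi_2([g|h])$ is identified with its underlying element of $\mathrm{Aut}_{\mathcal L}(S)=\Gamma\le\widehat\Gamma$. *)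

theory Defs
  imports Complex_Main "HOL-Computational_Algebra.Primes"
    "HOL-Algebra.Group_Action" "HOL-Algebra.Product_Groups"
begin

section \<open>Categories, functors and nerves\<close>

text \<open>Morphism sets need not be disjoint (an element of \<open>N\<^sub>S(P,Q)\<close> does not know its source and
  target), so composition and the morphism part of a functor take the objects as arguments:
  \<open>cmp C X Y Z g f\<close> is \<open>g \<circ> f\<close> for \<open>f : X \<rightarrow> Y\<close> and \<open>g : Y \<rightarrow> Z\<close>.\<close>

record ('o, 'm) cat =
  Obj :: "'o set"
  Mor :: "'o \<Rightarrow> 'o \<Rightarrow> 'm set"
  cmp :: "'o \<Rightarrow> 'o \<Rightarrow> 'o \<Rightarrow> 'm \<Rightarrow> 'm \<Rightarrow> 'm"
  idm :: "'o \<Rightarrow> 'm"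

definition category :: "('o, 'm, 'z) cat_scheme \<Rightarrow> bool" where
  "category C \<longleftrightarrow>
     (\<forall>X Y. Mor C X Y \<noteq> {} \<longrightarrow> X \<in> Obj C \<and> Y \<in> Obj C) \<and>
     (\<forall>X\<in>Obj C. idm C X \<in> Mor C X X) \<and>
     (\<forall>X Y Z. \<forall>f\<in>Mor C X Y. \<forall>g\<in>Mor C Y Z. cmp C X Y Z g f \<in> Mor C X Z) \<and>
     (\<forall>X Y. \<forall>f\<in>Mor C X Y. cmp C X X Y f (idm C X) = f \<and> cmp C X Y Y (idm C Y) f = f) \<and>
     (\<forall>W X Y Z. \<forall>f\<in>Mor C W X. \<forall>g\<in>Mor C X Y. \<forall>h\<in>Mor C Y Z.
        cmp C W X Z (cmp C X Y Z h g) f = cmp C W Y Z h (cmp C W X Y g f))"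

definition inverse_mor :: "('o, 'm, 'z) cat_scheme \<Rightarrow> 'o \<Rightarrow> 'o \<Rightarrow> 'm \<Rightarrow> 'm \<Rightarrow> bool" where
  "inverse_mor C X Y f g \<longleftrightarrow>
     g \<in> Mor C Y X \<and> cmp C X Y X g f = idm C X \<and> cmp C Y X Y f g = idm C Y"

definition Iso :: "('o, 'm, 'z) cat_scheme \<Rightarrow> 'o \<Rightarrow> 'o \<Rightarrow> 'm set" where
  "Iso C X Y = {f \<in> Mor C X Y. \<exists>g. inverse_mor C X Y f g}"

definition inv_mor :: "('o, 'm, 'z) cat_scheme \<Rightarrow> 'o \<Rightarrow> 'o \<Rightarrow> 'm \<Rightarrow> 'm" where
  "inv_mor C X Y f = (THE g. inverse_mor C X Y f g)"

definition aut_group :: "('o, 'm, 'z) cat_scheme \<Rightarrow> 'o \<Rightarrow> 'm monoid" where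
  "aut_group C X = \<lparr>carrier = Iso C X X, mult = cmp C X X X, one = idm C X\<rparr>"

record ('o, 'm, 'o2, 'm2) fctor =
  fob :: "'o \<Rightarrow> 'o2"
  fmor :: "'o \<Rightarrow> 'o \<Rightarrow> 'm \<Rightarrow> 'm2"

definition is_functor ::
  "('o, 'm, 'y) cat_scheme \<Rightarrow> ('o2, 'm2, 'z) cat_scheme \<Rightarrow> ('o, 'm, 'o2, 'm2) fctor \<Rightarrow> bool" where
  "is_functor C D \<Phi> \<longleftrightarrow>
     (\<forall>X\<in>Obj C. fob \<Phi> X \<in> Obj D) \<and>
     (\<forall>X\<in>Obj C. \<forall>Y\<in>Obj C. \<forall>f\<in>Mor C X Y. fmor \<Phi> X Y f \<in> Mor D (fob \<Phi> X) (fob \<Phi> Y)) \<and>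
     (\<forall>X\<in>Obj C. fmor \<Phi> X X (idm C X) = idm D (fob \<Phi> X)) \<and>
     (\<forall>X\<in>Obj C. \<forall>Y\<in>Obj C. \<forall>Z\<in>Obj C. \<forall>f\<in>Mor C X Y. \<forall>g\<in>Mor C Y Z.
        fmor \<Phi> X Z (cmp C X Y Z g f) =
        cmp D (fob \<Phi> X) (fob \<Phi> Y) (fob \<Phi> Z) (fmor \<Phi> Y Z g) (fmor \<Phi> X Y f))"

text \<open>The monoid of endofunctors of \<open>C\<close>. Functors are taken to be \<open>undefined\<close> off \<open>C\<close>, so that
  equality of records is equality of functors.\<close>

definition end_functors :: "('o, 'm, 'z) cat_scheme \<Rightarrow> ('o, 'm, 'o, 'm) fctor monoid" where
  "end_functors C =
    \<lparr>carrier = {\<Phi>. is_functor C C \<Phi> \<and> fob \<Phi> \<in> extensional (Obj C) \<and>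
                  (\<forall>X Y. fmor \<Phi> X Y \<in> extensional (Mor C X Y))},
     mult = (\<lambda>\<Phi> \<Psi>. \<lparr>fob = compose (Obj C) (fob \<Phi>) (fob \<Psi>),
                    fmor = (\<lambda>X Y. compose (Mor C X Y) (fmor \<Phi> (fob \<Psi> X) (fob \<Psi> Y)) (fmor \<Psi> X Y))\<rparr>),
     one = \<lparr>fob = (\<lambda>X\<in>Obj C. X), fmor = (\<lambda>X Y. \<lambda>f\<in>Mor C X Y. f)\<rparr>\<rparr>"

text \<open>A simplex \<open>c\<^sub>0 \<leftarrow> c\<^sub>1 \<leftarrow> \<dots> \<leftarrow> c\<^sub>n\<close> of the nerve, with maps \<open>f\<^sub>1, \<dots>, f\<^sub>n\<close>, is the pair of lists
  \<open>([c\<^sub>0, \<dots>, c\<^sub>n], [f\<^sub>1, \<dots>, f\<^sub>n])\<close>; since lists count from \<open>0\<close>, \<open>f\<^sub>i\<close> is \<open>f ! (i - 1)\<close>.\<close>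

type_synonym ('o, 'm) simplex = "'o list \<times> 'm list"

definition nerve :: "('o, 'm, 'z) cat_scheme \<Rightarrow> nat \<Rightarrow> ('o, 'm) simplex set" where
  "nerve C n = {(c, f). length c = Suc n \<and> length f = n \<and> set c \<subseteq> Obj C \<and>
                        (\<forall>i<n. f ! i \<in> Mor C (c ! Suc i) (c ! i))}"

definition face ::
  "('o, 'm, 'z) cat_scheme \<Rightarrow> nat \<Rightarrow> ('o, 'm) simplex \<Rightarrow> ('o, 'm) simplex" where
  "face C i = (\<lambda>(c, f).
     (take i c @ drop (Suc i) c,
      if i = 0 then tl f
      else if i = length f then butlast f
      else take (i - 1) f
           @ [cmp C (c ! (i + 1)) (c ! i) (c ! (i - 1)) (f ! (i - 1)) (f ! i)]
           @ drop (i + 1) f))"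

definition degen ::
  "('o, 'm, 'z) cat_scheme \<Rightarrow> nat \<Rightarrow> ('o, 'm) simplex \<Rightarrow> ('o, 'm) simplex" where
  "degen C i = (\<lambda>(c, f).
     (take (Suc i) c @ [c ! i] @ drop (Suc i) c,
      take i f @ [idm C (c ! i)] @ drop i f))"

definition group_cat :: "('g, 'z) monoid_scheme \<Rightarrow> (unit, 'g) cat" where
  "group_cat G = \<lparr>Obj = {()}, Mor = (\<lambda>_ _. carrier G), cmp = (\<lambda>_ _ _. mult G), idm = (\<lambda>_. one G)\<rparr>"

text \<open>\<open>bar [g\<^sub>1, \<dots>, g\<^sub>n]\<close> is the simplex written \<open>[g\<^sub>1|\<dots>|g\<^sub>n]\<close>.\<close>

definition bar :: "'g list \<Rightarrow> (unit, 'g) simplex" where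
  "bar gs = (replicate (Suc (length gs)) (), gs)"

text \<open>Data of a strict monoidal category: \<open>mten M a b x a' b' x'\<close> is the product
  of \<open>x : a \<rightarrow> b\<close> and \<open>x' : a' \<rightarrow> b'\<close>.\<close>

record ('o, 'm) moncat = "('o, 'm) cat" +
  oten :: "'o \<Rightarrow> 'o \<Rightarrow> 'o"
  mten :: "'o \<Rightarrow> 'o \<Rightarrow> 'm \<Rightarrow> 'o \<Rightarrow> 'o \<Rightarrow> 'm \<Rightarrow> 'm"
  unit_ob :: "'o"

definition nerve_mult ::
  "('o, 'm, 'z) moncat_scheme \<Rightarrow> ('o, 'm) simplex \<Rightarrow> ('o, 'm) simplex \<Rightarrow> ('o, 'm) simplex" where
  "nerve_mult M = (\<lambda>(c, f) (c', f').
     (map2 (oten M) c c',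
      map (\<lambda>i. mten M (c ! Suc i) (c ! i) (f ! i) (c' ! Suc i) (c' ! i) (f' ! i)) [0..<length f]))"

definition nerve_one :: "('o, 'm, 'z) moncat_scheme \<Rightarrow> nat \<Rightarrow> ('o, 'm) simplex" where
  "nerve_one M n = (replicate (Suc n) (unit_ob M), replicate n (idm M (unit_ob M)))"

text \<open>A twisting function \<open>\<phi>\<close> consists of the \<open>\<phi> n\<close> for \<open>n \<ge> 1\<close>; it is normalised to
  be \<open>undefined\<close> at \<open>n = 0\<close> and off the nerve, so that uniqueness is equality of HOL functions.\<close>

definition twisting_function ::
  "('o, 'm, 'y) cat_scheme \<Rightarrow> ('o2, 'm2, 'z) moncat_scheme
    \<Rightarrow> (nat \<Rightarrow> ('o, 'm) simplex \<Rightarrow> ('o2, 'm2) simplex) \<Rightarrow> bool" where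
  "twisting_function C M \<phi> \<longleftrightarrow>
     \<phi> \<in> (\<Pi>\<^sub>E n\<in>{1..}. nerve C n \<rightarrow>\<^sub>E nerve M (n - 1)) \<and>
     (\<forall>n\<ge>2. \<forall>x\<in>nerve C n. \<forall>i\<in>{2..n}. \<phi> (n - 1) (face C i x) = face M (i - 1) (\<phi> n x)) \<and>
     (\<forall>n\<ge>2. \<forall>x\<in>nerve C n.
        \<phi> (n - 1) (face C 1 x) = nerve_mult M (face M 0 (\<phi> n x)) (\<phi> (n - 1) (face C 0 x))) \<and>
     (\<forall>n\<ge>1. \<forall>x\<in>nerve C n. \<forall>i\<in>{1..n}. \<phi> (n + 1) (degen C i x) = degen M (i - 1) (\<phi> n x)) \<and>
     (\<forall>n. \<forall>x\<in>nerve C n. \<phi> (n + 1) (degen C 0 x) = nerve_one M n)"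


section \<open>Discrete p-toral groups\<close>

text \<open>\<open>\<int>/p\<^sup>\<infinity> = \<int>[1/p]/\<int>\<close>\<close>

definition prufer_group :: "nat \<Rightarrow> rat set monoid" where
  "prufer_group p =
     \<lparr>carrier = {x. \<exists>(k::int) (n::nat). x = of_int k / of_nat p ^ n}, mult = (+), one = 0\<rparr> Mod \<int>"

definition p_group :: "nat \<Rightarrow> ('a, 'z) monoid_scheme \<Rightarrow> bool" where
  "p_group p P \<longleftrightarrow> group P \<and> (\<forall>x\<in>carrier P. \<exists>k::nat. x [^]\<^bsub>P\<^esub> (p ^ k) = \<one>\<^bsub>P\<^esub>)"

definition toral_of_order :: "nat \<Rightarrow> ('a, 'z) monoid_scheme \<Rightarrow> nat \<times> nat \<Rightarrow> bool" where
  "toral_of_order p P = (\<lambda>(r, n). \<exists>P0. P0 \<lhd> P \<and>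
     P\<lparr>carrier := P0\<rparr> \<cong> product_group {..<r} (\<lambda>_. prufer_group p) \<and>
     finite (carrier (P Mod P0)) \<and> p_group p (P Mod P0) \<and> n = order (P Mod P0))"

definition discrete_p_toral :: "nat \<Rightarrow> ('a, 'z) monoid_scheme \<Rightarrow> bool" where
  "discrete_p_toral p P \<longleftrightarrow> group P \<and> (\<exists>rn. toral_of_order p P rn)"

text \<open>Well defined, since \<open>P0\<close> is the largest divisible subgroup of \<open>P\<close>.\<close>

definition toral_order :: "nat \<Rightarrow> ('a, 'z) monoid_scheme \<Rightarrow> nat \<times> nat" where
  "toral_order p P = (THE rn. toral_of_order p P rn)"

definition lex_le :: "nat \<times> nat \<Rightarrow> nat \<times> nat \<Rightarrow> bool" where
  "lex_le = (\<lambda>(r, n) (r', n'). r < r' \<or> r = r' \<and> n \<le> n')"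


section \<open>Fusion systems\<close>

definition conj_on :: "('a, 'z) monoid_scheme \<Rightarrow> 'a set \<Rightarrow> 'a \<Rightarrow> 'a \<Rightarrow> 'a" where
  "conj_on S P g = (\<lambda>x\<in>P. g \<otimes>\<^bsub>S\<^esub> x \<otimes>\<^bsub>S\<^esub> inv\<^bsub>S\<^esub> g)"

definition transporter :: "('a, 'z) monoid_scheme \<Rightarrow> 'a set \<Rightarrow> 'a set \<Rightarrow> 'a set" where
  "transporter S P Q = {g \<in> carrier S. conj_on S P g ` P \<subseteq> Q}"

definition Hom_S :: "('a, 'z) monoid_scheme \<Rightarrow> 'a set \<Rightarrow> 'a set \<Rightarrow> ('a \<Rightarrow> 'a) set" where
  "Hom_S S P Q = conj_on S P ` transporter S P Q"

definition Inn :: "('a, 'z) monoid_scheme \<Rightarrow> 'a set \<Rightarrow> ('a \<Rightarrow> 'a) set" where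
  "Inn S P = conj_on S P ` P"

definition centralizer :: "('a, 'z) monoid_scheme \<Rightarrow> 'a set \<Rightarrow> 'a set" where
  "centralizer S P = {g \<in> carrier S. \<forall>x\<in>P. g \<otimes>\<^bsub>S\<^esub> x = x \<otimes>\<^bsub>S\<^esub> g}"

definition Inj :: "('a, 'z) monoid_scheme \<Rightarrow> 'a set \<Rightarrow> 'a set \<Rightarrow> ('a \<Rightarrow> 'a) set" where
  "Inj S P Q = mon (S\<lparr>carrier := P\<rparr>) (S\<lparr>carrier := Q\<rparr>) \<inter> extensional P"

definition fusion_system ::
  "('a, 'z) monoid_scheme \<Rightarrow> ('a set, 'a \<Rightarrow> 'a) cat \<Rightarrow> bool" where
  "fusion_system S F \<longleftrightarrow>
     category F \<and> Obj F = {P. subgroup P S} \<and>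
     (\<forall>P\<in>Obj F. \<forall>Q\<in>Obj F. Hom_S S P Q \<subseteq> Mor F P Q \<and> Mor F P Q \<subseteq> Inj S P Q) \<and>
     (\<forall>P\<in>Obj F. idm F P = (\<lambda>x\<in>P. x)) \<and>
     (\<forall>P Q R. \<forall>f\<in>Mor F P Q. \<forall>g\<in>Mor F Q R. cmp F P Q R g f = compose P g f) \<and>
     (\<forall>P Q. \<forall>f\<in>Mor F P Q. \<exists>R\<in>Obj F. R \<subseteq> Q \<and>
        (\<exists>f'\<in>Iso F P R. f = cmp F P R Q (\<lambda>x\<in>R. x) f'))"

definition conjugates :: "('a set, 'a \<Rightarrow> 'a) cat \<Rightarrow> 'a set \<Rightarrow> 'a set set" where
  "conjugates F P = {Q \<in> Obj F. Iso F P Q \<noteq> {}}"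

definition Out :: "('a, 'z) monoid_scheme \<Rightarrow> ('a set, 'a \<Rightarrow> 'a) cat \<Rightarrow> 'a set \<Rightarrow> ('a \<Rightarrow> 'a) set monoid" where
  "Out S F P = aut_group F P Mod Inn S P"

definition fully_centralized ::
  "nat \<Rightarrow> ('a, 'z) monoid_scheme \<Rightarrow> ('a set, 'a \<Rightarrow> 'a) cat \<Rightarrow> 'a set \<Rightarrow> bool" where
  "fully_centralized p S F P \<longleftrightarrow> P \<in> Obj F \<and>
     (\<forall>Q\<in>conjugates F P. lex_le (toral_order p (S\<lparr>carrier := centralizer S Q\<rparr>))
                                 (toral_order p (S\<lparr>carrier := centralizer S P\<rparr>)))"

definition fully_normalized ::
  "nat \<Rightarrow> ('a, 'z) monoid_scheme \<Rightarrow> ('a set, 'a \<Rightarrow> 'a) cat \<Rightarrow> 'a set \<Rightarrow> bool" where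
  "fully_normalized p S F P \<longleftrightarrow> P \<in> Obj F \<and>
     (\<forall>Q\<in>conjugates F P. lex_le (toral_order p (S\<lparr>carrier := normalizer S Q\<rparr>))
                                 (toral_order p (S\<lparr>carrier := normalizer S P\<rparr>)))"

definition sylow_subgroup :: "nat \<Rightarrow> ('a, 'z) monoid_scheme \<Rightarrow> 'a set \<Rightarrow> bool" where
  "sylow_subgroup p G H \<longleftrightarrow>
     subgroup H G \<and> finite (carrier G) \<and> card H = p ^ multiplicity p (order G)"

text \<open>\<open>N\<^sub>\<phi>\<close> for \<open>\<phi> : P \<rightarrow> S\<close>\<close>

definition extender :: "('a, 'z) monoid_scheme \<Rightarrow> 'a set \<Rightarrow> ('a \<Rightarrow> 'a) \<Rightarrow> 'a set" where
  "extender S P \<phi> = {g \<in> normalizer S P.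
     (\<lambda>y\<in>\<phi> ` P. \<phi> (conj_on S P g (inv_into P \<phi> y))) \<in> Hom_S S (\<phi> ` P) (\<phi> ` P)}"

definition saturated ::
  "nat \<Rightarrow> ('a, 'z) monoid_scheme \<Rightarrow> ('a set, 'a \<Rightarrow> 'a) cat \<Rightarrow> bool" where
  "saturated p S F \<longleftrightarrow>
     (\<forall>P. fully_normalized p S F P \<longrightarrow>
        fully_centralized p S F P \<and> finite (carrier (Out S F P)) \<and>
        sylow_subgroup p (Out S F P)
          (rcosets\<^bsub>(aut_group F P)\<lparr>carrier := Hom_S S P P\<rparr>\<^esub> (Inn S P))) \<and>
     (\<forall>P. \<forall>\<phi>\<in>Mor F P (carrier S). fully_centralized p S F (\<phi> ` P) \<longrightarrow>
        (\<exists>\<psi>\<in>Mor F (extender S P \<phi>) (carrier S). \<forall>x\<in>P. \<psi> x = \<phi> x)) \<and>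
     (\<forall>(P :: nat \<Rightarrow> 'a set) \<phi>.
        (\<forall>n. subgroup (P n) S) \<and> (\<forall>n. P n \<subseteq> P (Suc n)) \<and>
        \<phi> \<in> hom (S\<lparr>carrier := (\<Union>n. P n)\<rparr>) S \<inter> extensional (\<Union>n. P n) \<and>
        (\<forall>n. restrict \<phi> (P n) \<in> Mor F (P n) (carrier S))
        \<longrightarrow> \<phi> \<in> Mor F (\<Union>n. P n) (carrier S))"

definition centric :: "('a, 'z) monoid_scheme \<Rightarrow> ('a set, 'a \<Rightarrow> 'a) cat \<Rightarrow> 'a set \<Rightarrow> bool" where
  "centric S F P \<longleftrightarrow> P \<in> Obj F \<and>
     (\<forall>Q\<in>conjugates F P. centralizer S Q = centralizer (S\<lparr>carrier := Q\<rparr>) Q)"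

definition radical ::
  "nat \<Rightarrow> ('a, 'z) monoid_scheme \<Rightarrow> ('a set, 'a \<Rightarrow> 'a) cat \<Rightarrow> 'a set \<Rightarrow> bool" where
  "radical p S F P \<longleftrightarrow> P \<in> Obj F \<and>
     (\<forall>N. N \<lhd> Out S F P \<and> p_group p ((Out S F P)\<lparr>carrier := N\<rparr>) \<longrightarrow> N = {\<one>\<^bsub>Out S F P\<^esub>})"


section \<open>Linking systems\<close>

definition transporter_cat ::
  "('a, 'z) monoid_scheme \<Rightarrow> 'a set set \<Rightarrow> ('a set, 'a) cat" where
  "transporter_cat S H =
     \<lparr>Obj = H, Mor = (\<lambda>P Q. if P \<in> H \<and> Q \<in> H then transporter S P Q else {}),
      cmp = (\<lambda>_ _ _. mult S), idm = (\<lambda>_. \<one>\<^bsub>S\<^esub>)\<rparr>"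

text \<open>A linking system is a category whose objects are subgroups, with the morphism parts of the
  functors \<open>\<delta>\<close> and \<open>\<pi>\<close>, which are the identity on objects.\<close>

record ('a, 'm) linking = "('a set, 'm) cat" +
  dlt :: "'a set \<Rightarrow> 'a set \<Rightarrow> 'a \<Rightarrow> 'm"
  prj :: "'a set \<Rightarrow> 'a set \<Rightarrow> 'm \<Rightarrow> 'a \<Rightarrow> 'a"

text \<open>In axiom (A), that \<open>\<pi>\<close> induces a bijection \<open>Mor(P,Q)/C\<^sub>S(P) \<rightarrow> Hom(P,Q)\<close> is spelled out as: \<open>\<pi>\<close> is
  onto and its fibres are exactly the orbits.\<close>

definition linking_system ::
  "nat \<Rightarrow> ('a, 'z) monoid_scheme \<Rightarrow> ('a set, 'a \<Rightarrow> 'a) cat \<Rightarrow> 'a set set \<Rightarrow> ('a, 'm) linking \<Rightarrow> bool" where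
  "linking_system p S F H L \<longleftrightarrow>
     category L \<and> Obj L = H \<and>
     is_functor (transporter_cat S H) L \<lparr>fob = (\<lambda>P. P), fmor = dlt L\<rparr> \<and>
     is_functor L F \<lparr>fob = (\<lambda>P. P), fmor = prj L\<rparr> \<and>
     (\<forall>P\<in>H. \<exists>Q\<in>H. Iso L P Q \<noteq> {} \<and> fully_centralized p S F Q) \<and>
     (\<forall>P\<in>H. \<forall>Q\<in>H. fully_centralized p S F P \<longrightarrow>
        (\<forall>\<psi>\<in>Mor L P Q. \<forall>g\<in>centralizer S P. cmp L P P Q \<psi> (dlt L P P g) = \<psi> \<longrightarrow> g = \<one>\<^bsub>S\<^esub>) \<and>
        prj L P Q ` Mor L P Q = Mor F P Q \<and>
        (\<forall>\<psi>\<in>Mor L P Q. \<forall>\<psi>'\<in>Mor L P Q.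
           prj L P Q \<psi> = prj L P Q \<psi>' \<longleftrightarrow>
           (\<exists>g\<in>centralizer S P. \<psi>' = cmp L P P Q \<psi> (dlt L P P g)))) \<and>
     (\<forall>P\<in>H. \<forall>Q\<in>H. \<forall>g\<in>transporter S P Q. prj L P Q (dlt L P Q g) = conj_on S P g) \<and>
     (\<forall>P\<in>H. \<forall>Q\<in>H. \<forall>\<psi>\<in>Mor L P Q. \<forall>g\<in>P.
        cmp L P P Q \<psi> (dlt L P P g) = cmp L P Q Q (dlt L Q Q (prj L P Q \<psi> g)) \<psi>)"

definition linking_triple ::
  "nat \<Rightarrow> ('a, 'z) monoid_scheme \<Rightarrow> ('a set, 'a \<Rightarrow> 'a) cat \<Rightarrow> ('a, 'm) linking \<Rightarrow> bool" where
  "linking_triple p S F L \<longleftrightarrow>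
     discrete_p_toral p S \<and> fusion_system S F \<and> saturated p S F \<and>
     (\<exists>H. H \<subseteq> Obj F \<and>
          (\<forall>P\<in>H. conjugates F P \<subseteq> H) \<and>
          (\<forall>P\<in>H. \<forall>Q\<in>Obj F. P \<subseteq> Q \<longrightarrow> Q \<in> H) \<and>
          (\<forall>P. centric S F P \<and> radical p S F P \<longrightarrow> P \<in> H) \<and>
          linking_system p S F H L)"

definition incl :: "('a, 'z) monoid_scheme \<Rightarrow> ('a, 'm) linking \<Rightarrow> 'a set \<Rightarrow> 'a set \<Rightarrow> 'm" where
  "incl S L P Q = dlt L P Q \<one>\<^bsub>S\<^esub>"

text \<open>\<open>restr S L P Q P' Q' \<psi>\<close> is the restriction of \<open>\<psi> : P \<rightarrow> Q\<close> to a morphism \<open>P' \<rightarrow> Q'\<close>.\<close>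

definition restr ::
  "('a, 'z) monoid_scheme \<Rightarrow> ('a, 'm) linking
    \<Rightarrow> 'a set \<Rightarrow> 'a set \<Rightarrow> 'a set \<Rightarrow> 'a set \<Rightarrow> 'm \<Rightarrow> 'm" where
  "restr S L P Q P' Q' \<psi> =
     (THE \<psi>'. \<psi>' \<in> Mor L P' Q' \<and>
        cmp L P' P Q \<psi> (incl S L P' P) = cmp L P' Q' Q (incl S L Q' Q) \<psi>')"

definition Aut_typ_I ::
  "('a, 'z) monoid_scheme \<Rightarrow> ('a, 'm) linking \<Rightarrow> ('a set, 'm, 'a set, 'm) fctor monoid" where
  "Aut_typ_I S L = (end_functors L)\<lparr>carrier := {\<alpha> \<in> Units (end_functors L).
     (\<forall>P\<in>Obj L. \<forall>Q\<in>Obj L. P \<subseteq> Q \<longrightarrow>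
        fob \<alpha> P \<subseteq> fob \<alpha> Q \<and> fmor \<alpha> P Q (incl S L P Q) = incl S L (fob \<alpha> P) (fob \<alpha> Q)) \<and>
     (\<forall>P\<in>Obj L. fmor \<alpha> P P ` dlt L P P ` P = dlt L (fob \<alpha> P) (fob \<alpha> P) ` fob \<alpha> P)}\<rparr>"

definition Gam :: "('a, 'z) monoid_scheme \<Rightarrow> ('a, 'm) linking \<Rightarrow> 'm monoid" where
  "Gam S L = aut_group L (carrier S)"

definition conj_functor ::
  "('a, 'z) monoid_scheme \<Rightarrow> ('a, 'm) linking \<Rightarrow> 'm \<Rightarrow> ('a set, 'm, 'a set, 'm) fctor" where
  "conj_functor S L \<gamma> =
    (let im = (\<lambda>P. prj L (carrier S) (carrier S) \<gamma> ` P);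
         rs = (\<lambda>P. restr S L (carrier S) (carrier S) P (im P) \<gamma>)
     in \<lparr>fob = (\<lambda>P\<in>Obj L. im P),
         fmor = (\<lambda>P Q. \<lambda>\<phi>\<in>Mor L P Q.
           cmp L (im P) Q (im Q) (rs Q)
             (cmp L (im P) P Q \<phi> (inv_mor L P (im P) (rs P))))\<rparr>)"

text \<open>The strict monoidal groupoid \<open>\<A>ut\<^sub>t\<^sub>y\<^sub>p(L)\<close>. A natural transformation is identified with its value
  at the object \<open>S\<close>.\<close>

definition Aut_typ_cat ::
  "('a, 'z) monoid_scheme \<Rightarrow> ('a, 'm) linking \<Rightarrow> (('a set, 'm, 'a set, 'm) fctor, 'm) moncat" where
  "Aut_typ_cat S L =
    \<lparr>Obj = carrier (Aut_typ_I S L),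
     Mor = (\<lambda>\<alpha> \<beta>. {\<chi> \<in> carrier (Gam S L).
       \<alpha> \<in> carrier (Aut_typ_I S L) \<and> \<beta> \<in> carrier (Aut_typ_I S L) \<and>
       \<beta> = conj_functor S L \<chi> \<otimes>\<^bsub>Aut_typ_I S L\<^esub> \<alpha>}),
     cmp = (\<lambda>_ _ _. mult (Gam S L)),
     idm = (\<lambda>_. \<one>\<^bsub>Gam S L\<^esub>),
     oten = mult (Aut_typ_I S L),
     mten = (\<lambda>\<alpha> \<beta> \<chi> \<alpha>' \<beta>' \<chi>'. \<chi> \<otimes>\<^bsub>Gam S L\<^esub> fmor \<alpha> (carrier S) (carrier S) \<chi>'),
     unit_ob = \<one>\<^bsub>Aut_typ_I S L\<^esub>\<rparr>"


section \<open>Extension pairs\<close>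

text \<open>HOL types do not allow \<open>\<Gamma> = Aut\<^sub>L(S)\<close> to be literally a subset of an arbitrary group, so the
  containment of \<open>\<Gamma>\<close> in \<open>ehat U\<close> is an injective homomorphism \<open>einc U\<close>.\<close>

record ('a, 'm, 'g, 'h) ext_pair =
  ehat :: "'h monoid"
  einc :: "'m \<Rightarrow> 'h"
  erho :: "'h \<Rightarrow> 'g"
  etau :: "'h \<Rightarrow> ('a set, 'm, 'a set, 'm) fctor"

definition extension_pair ::
  "('a, 'z) monoid_scheme \<Rightarrow> ('a, 'm) linking \<Rightarrow> ('g, 'y) monoid_scheme
    \<Rightarrow> ('a, 'm, 'g, 'h) ext_pair \<Rightarrow> bool" where
  "extension_pair S L G U \<longleftrightarrow>
     group (ehat U) \<and>
     einc U \<in> mon (Gam S L) (ehat U) \<and>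
     einc U ` carrier (Gam S L) \<lhd> ehat U \<and>
     erho U \<in> epi (ehat U) G \<and>
     kernel (ehat U) G (erho U) = einc U ` carrier (Gam S L) \<and>
     etau U \<in> hom (ehat U) (Aut_typ_I S L) \<and>
     (\<forall>\<gamma>\<in>carrier (Gam S L). etau U (einc U \<gamma>) = conj_functor S L \<gamma>) \<and>
     (\<forall>x\<in>carrier (ehat U). \<forall>\<gamma>\<in>carrier (Gam S L).
        einc U (fmor (etau U x) (carrier S) (carrier S) \<gamma>) =
        x \<otimes>\<^bsub>ehat U\<^esub> einc U \<gamma> \<otimes>\<^bsub>ehat U\<^esub> inv\<^bsub>ehat U\<^esub> x)"

definition regular_section ::
  "('g, 'y) monoid_scheme \<Rightarrow> ('a, 'm, 'g, 'h) ext_pair \<Rightarrow> ('g \<Rightarrow> 'h) \<Rightarrow> bool" where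
  "regular_section G U t \<longleftrightarrow>
     t \<in> carrier G \<rightarrow> carrier (ehat U) \<and>
     (\<forall>g\<in>carrier G. erho U (t g) = g) \<and> t \<one>\<^bsub>G\<^esub> = \<one>\<^bsub>ehat U\<^esub>"

type_synonym ('a, 'm, 'g) twisting =
  "nat \<Rightarrow> (unit, 'g) simplex \<Rightarrow> (('a set, 'm, 'a set, 'm) fctor, 'm) simplex"

text \<open>Twisting functions \<open>\<phi>\<close> satisfying conditions (i) and (ii) for \<open>U\<close> and \<open>t\<close>. An object \<open>\<alpha>\<close> is the
  vertex \<open>([\<alpha>], [])\<close>, and the element underlying a \<open>1\<close>-simplex \<open>([\<beta>, \<alpha>], [\<chi>])\<close> is \<open>\<chi>\<close>.\<close>

definition twisting_for ::
  "('a, 'z) monoid_scheme \<Rightarrow> ('a, 'm) linking \<Rightarrow> ('g, 'y) monoid_scheme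
    \<Rightarrow> ('a, 'm, 'g, 'h) ext_pair \<Rightarrow> ('g \<Rightarrow> 'h) \<Rightarrow> ('a, 'm, 'g) twisting \<Rightarrow> bool" where
  "twisting_for S L G U t \<phi> \<longleftrightarrow>
     twisting_function (group_cat G) (Aut_typ_cat S L) \<phi> \<and>
     (\<forall>g\<in>carrier G. ([etau U (t g)], []) = \<phi> 1 (bar [g])) \<and>
     (\<forall>g\<in>carrier G. \<forall>h\<in>carrier G.
        t g \<otimes>\<^bsub>ehat U\<^esub> t h = einc U (hd (snd (\<phi> 2 (bar [g, h])))) \<otimes>\<^bsub>ehat U\<^esub> t (g \<otimes>\<^bsub>G\<^esub> h))"

definition phi_U ::
  "('a, 'z) monoid_scheme \<Rightarrow> ('a, 'm) linking \<Rightarrow> ('g, 'y) monoid_scheme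
    \<Rightarrow> ('a, 'm, 'g, 'h) ext_pair \<Rightarrow> ('g \<Rightarrow> 'h) \<Rightarrow> ('a, 'm, 'g) twisting" where
  "phi_U S L G U t = (THE \<phi>. twisting_for S L G U t \<phi>)"

end

theory Submission
  imports Defs
begin

text \<open>Sending \<open>\<chi>\<close> to \<open>c\<^sub>\<chi>\<close> makes \<open>\<Gamma> = Aut\<^sub>L(S) \<rightarrow> Aut\<^sub>t\<^sub>y\<^sub>p\<^sup>I(L)\<close> a crossed module, since restrictions of morphisms
  in \<open>L\<close> exist and are unique, and an extension pair is an extension of \<open>G\<close> by \<open>\<Gamma>\<close> compatible with it.
  The twisting function of \<open>(U, t)\<close> sends \<open>[g\<^sub>1|\<dots>|g\<^sub>n]\<close> to the simplex with vertices \<open>\<tau>(u\<^sub>k)\<close> and edges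
  \<open>u\<^sub>k\<^sub>-\<^sub>1 u\<^sub>k\<inverse> \<in> \<Gamma>\<close>, where \<open>u\<^sub>k = t(g\<^sub>1\<cdots>g\<^sub>k\<^sub>+\<^sub>1) t(g\<^sub>2\<cdots>g\<^sub>k\<^sub>+\<^sub>1)\<inverse>\<close>. It is determined by its values in degrees 1 and 2,
  as these determine all vertices and edges. Conversely, \<open>\<phi>\<^sub>1\<close> and \<open>\<phi>\<^sub>2\<close> form a nonabelian 2-cocycle, the
  cocycle identity being read off from the faces of \<open>\<phi>\<^sub>3[g|h|k]\<close>, and the resulting group structure on
  \<open>\<Gamma> \<times> G\<close> gives the extension pair.\<close>

text \<open>The formula for \<open>u\<^sub>k\<close> is forced. A face \<open>d\<^sub>i\<close> with
  i at least 2 deletes vertex i - 1, so every vertex but the first can be deleted. Deleting all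
  except vertices 0 and k (k at least 1) leaves
  \<open>[g\<^sub>1|g\<^sub>2\<cdots>g\<^sub>k\<^sub>+\<^sub>1]\<close>. In degree 2,
  \<open>d\<^sub>1\<close> says that vertex 1 of [g|h] times \<tau>(t(h)) is \<tau>(t(gh)). All
  \<open>u\<^sub>k\<close> lie over \<open>g\<^sub>1\<close>, which puts their quotients into
  \<Gamma>. The simplicial part uses the crossed module identities alone; the linking system enters
  through restrictions. Two obstacles shape that part. Axiom (A) gives lifts and a free action only
  for a fully centralized source, so statements about an arbitrary source are moved along an
  isomorphism of L. And an automorphism \<alpha> of L permutes subgroups without a formula on
  elements, so that \<alpha> takes the restriction of \<gamma> to the restriction of
  \<alpha>(\<gamma>) has to be recovered from inclusions and from the surjectivity of projected
  isomorphisms. Equivariance follows from this; the Peiffer identity is the case of the restriction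
  to S itself.\<close>

lemma (in group) inv_mult_cancel:
  assumes "x \<in> carrier G" "y \<in> carrier G"
  shows "inv x \<otimes> (x \<otimes> y) = y" "x \<otimes> (inv x \<otimes> y) = y"
  using assms by (simp_all flip: m_assoc)

section \<open>Crossed modules\<close>

text \<open>Equivariance is stated as a commutation, without an inverse of \<alpha>: for a linking
  system it is then an equality of two composite functors, which can be checked on objects and
  morphisms.\<close>

locale crossed_module = Gam: group \<Gamma> + Aut: group A
  for \<Gamma> :: "('m, 'v) monoid_scheme" and A :: "('f, 'w) monoid_scheme" and c :: "'m \<Rightarrow> 'f" and act :: "'f \<Rightarrow> 'm \<Rightarrow> 'm" +
  assumes c_hom: "c \<in> hom \<Gamma> A"
    and act_hom: "\<alpha> \<in> carrier A \<Longrightarrow> act \<alpha> \<in> hom \<Gamma> \<Gamma>"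
    and act_mult: "\<lbrakk>\<alpha> \<in> carrier A; \<beta> \<in> carrier A; x \<in> carrier \<Gamma>\<rbrakk> \<Longrightarrow>
      act (\<alpha> \<otimes>\<^bsub>A\<^esub> \<beta>) x = act \<alpha> (act \<beta> x)"
    and act_one: "x \<in> carrier \<Gamma> \<Longrightarrow> act \<one>\<^bsub>A\<^esub> x = x"
    and equivariant: "\<lbrakk>\<alpha> \<in> carrier A; x \<in> carrier \<Gamma>\<rbrakk> \<Longrightarrow> c (act \<alpha> x) \<otimes>\<^bsub>A\<^esub> \<alpha> = \<alpha> \<otimes>\<^bsub>A\<^esub> c x"
    and peiffer: "\<lbrakk>x \<in> carrier \<Gamma>; y \<in> carrier \<Gamma>\<rbrakk> \<Longrightarrow>
      act (c x) y = x \<otimes>\<^bsub>\<Gamma>\<^esub> y \<otimes>\<^bsub>\<Gamma>\<^esub> inv\<^bsub>\<Gamma>\<^esub> x"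
begin

text \<open>Written in the shape of \<open>Aut_typ_cat\<close>, so that
  \<open>Aut_typ_cat_eq\<close> is only an unfolding. Its nerve is the simplicial group of the
  crossed module.\<close>

definition M :: "('f, 'm) moncat" where
  "M = \<lparr>Obj = carrier A,
     Mor = (\<lambda>\<alpha> \<beta>. {\<chi> \<in> carrier \<Gamma>. \<alpha> \<in> carrier A \<and> \<beta> \<in> carrier A \<and> \<beta> = c \<chi> \<otimes>\<^bsub>A\<^esub> \<alpha>}),
     cmp = (\<lambda>_ _ _. mult \<Gamma>), idm = (\<lambda>_. \<one>\<^bsub>\<Gamma>\<^esub>), oten = mult A,
     mten = (\<lambda>\<alpha> \<beta> \<chi> \<alpha>' \<beta>' \<chi>'. \<chi> \<otimes>\<^bsub>\<Gamma>\<^esub> act \<alpha> \<chi>'), unit_ob = \<one>\<^bsub>A\<^esub>\<rparr>"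

lemma M_simps [simp]:
  "Obj M = carrier A" "cmp M X Y Z = mult \<Gamma>" "idm M X = \<one>\<^bsub>\<Gamma>\<^esub>" "oten M = mult A"
  "mten M \<alpha> \<beta> \<chi> \<alpha>' \<beta>' \<chi>' = \<chi> \<otimes>\<^bsub>\<Gamma>\<^esub> act \<alpha> \<chi>'" "unit_ob M = \<one>\<^bsub>A\<^esub>"
  by (simp_all add: M_def)

lemma Mor_M_iff: "\<chi> \<in> Mor M \<alpha> \<beta> \<longleftrightarrow>
    \<chi> \<in> carrier \<Gamma> \<and> \<alpha> \<in> carrier A \<and> \<beta> \<in> carrier A \<and> \<beta> = c \<chi> \<otimes>\<^bsub>A\<^esub> \<alpha>"
  by (auto simp: M_def)

lemma c_closed [simp]: "x \<in> carrier \<Gamma> \<Longrightarrow> c x \<in> carrier A"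
  using c_hom by (auto simp: hom_def)

lemma act_closed [simp]: "\<alpha> \<in> carrier A \<Longrightarrow> x \<in> carrier \<Gamma> \<Longrightarrow> act \<alpha> x \<in> carrier \<Gamma>"
  using act_hom by (auto simp: hom_def)

lemma c_mult: "\<lbrakk>x \<in> carrier \<Gamma>; y \<in> carrier \<Gamma>\<rbrakk> \<Longrightarrow> c (x \<otimes>\<^bsub>\<Gamma>\<^esub> y) = c x \<otimes>\<^bsub>A\<^esub> c y"
  using c_hom by (auto simp: hom_def)

lemma c_one: "c \<one>\<^bsub>\<Gamma>\<^esub> = \<one>\<^bsub>A\<^esub>"
  using c_hom hom_one Aut.is_group Gam.is_group by blast

lemma act_dist: "\<lbrakk>\<alpha> \<in> carrier A; x \<in> carrier \<Gamma>; y \<in> carrier \<Gamma>\<rbrakk> \<Longrightarrow>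
    act \<alpha> (x \<otimes>\<^bsub>\<Gamma>\<^esub> y) = act \<alpha> x \<otimes>\<^bsub>\<Gamma>\<^esub> act \<alpha> y"
  using act_hom by (auto simp: hom_def)

lemma act_one_right: "\<alpha> \<in> carrier A \<Longrightarrow> act \<alpha> \<one>\<^bsub>\<Gamma>\<^esub> = \<one>\<^bsub>\<Gamma>\<^esub>"
  using act_hom hom_one Gam.is_group by blast

end

section \<open>Simplices of the nerve of a group\<close>

definition bar_face :: "('g, 'y) monoid_scheme \<Rightarrow> nat \<Rightarrow> 'g list \<Rightarrow> 'g list" where
  "bar_face G i gs =
     (if i = 0 then tl gs else if i = length gs then butlast gs
      else take (i - 1) gs @ [gs ! (i - 1) \<otimes>\<^bsub>G\<^esub> gs ! i] @ drop (i + 1) gs)"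

definition bar_degen :: "('g, 'y) monoid_scheme \<Rightarrow> nat \<Rightarrow> 'g list \<Rightarrow> 'g list" where
  "bar_degen G i gs = take i gs @ [\<one>\<^bsub>G\<^esub>] @ drop i gs"

lemma set_tl_subset: "set gs \<subseteq> B \<Longrightarrow> set (tl gs) \<subseteq> B"
  by (cases gs) auto

lemma unit_list_eq: "length xs = length ys \<Longrightarrow> xs = (ys :: unit list)"
  by (rule nth_equalityI) auto

text \<open>All vertices are the unit object, so a simplex carries no information beyond its list of
  edges.\<close>

lemma nerve_group_cat:
  "nerve (group_cat G) n = bar ` {gs. length gs = n \<and> set gs \<subseteq> carrier G}"
proof -
  have "x \<in> bar ` {gs. length gs = n \<and> set gs \<subseteq> carrier G}" if "x \<in> nerve (group_cat G) n" for x
    using that unit_list_eq[of "fst x" "replicate (Suc n) ()"]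
    by (auto simp: nerve_def group_cat_def bar_def image_iff set_conv_nth)
  moreover have "bar gs \<in> nerve (group_cat G) n" if "length gs = n" "set gs \<subseteq> carrier G" for gs
    using that by (auto simp: nerve_def group_cat_def bar_def subset_eq)
  ultimately show ?thesis by auto
qed

lemma snd_bar [simp]: "snd (bar gs) = gs"
  by (simp add: bar_def)

lemma face_bar:
  assumes "i \<le> length gs" "gs \<noteq> []"
  shows "face (group_cat G) i (bar gs) = bar (bar_face G i gs)"
  using assms unfolding face_def bar_def bar_face_def group_cat_def
  by (auto simp: intro!: unit_list_eq)

lemma degen_bar:
  assumes "i \<le> length gs"
  shows "degen (group_cat G) i (bar gs) = bar (bar_degen G i gs)"
  using assms unfolding degen_def bar_def bar_degen_def group_cat_def
  by (auto simp: intro!: unit_list_eq)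

lemma length_bar_face: "i \<le> length gs \<Longrightarrow> length (bar_face G i gs) = length gs - 1"
  by (auto simp: bar_face_def)

lemma length_bar_degen: "i \<le> length gs \<Longrightarrow> length (bar_degen G i gs) = Suc (length gs)"
  by (auto simp: bar_degen_def)

lemma (in monoid) set_bar_face:
  assumes "set gs \<subseteq> carrier G" "i \<le> length gs"
  shows "set (bar_face G i gs) \<subseteq> carrier G"
proof (cases "i = 0 \<or> i = length gs")
  case True
  then show ?thesis using assms
    by (auto simp: bar_face_def dest: in_set_butlastD list.set_sel(2)) (metis list.sel(2) list.set_sel(2) subset_eq)
next
  case False
  with assms have "gs ! (i - 1) \<in> carrier G" "gs ! i \<in> carrier G"
    by (auto intro!: subsetD[OF assms(1)] nth_mem)
  with False assms show ?thesis
    by (auto simp: bar_face_def dest: in_set_takeD in_set_dropD)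
qed

lemma (in monoid) set_bar_degen:
  "set gs \<subseteq> carrier G \<Longrightarrow> set (bar_degen G i gs) \<subseteq> carrier G"
  by (auto simp: bar_degen_def dest: in_set_takeD in_set_dropD)

abbreviation lprod :: "('g, 'y) monoid_scheme \<Rightarrow> 'g list \<Rightarrow> 'g" where
  "lprod G gs \<equiv> foldr (mult G) gs \<one>\<^bsub>G\<^esub>"

context monoid begin

lemma lprod_closed [simp]: "set gs \<subseteq> carrier G \<Longrightarrow> lprod G gs \<in> carrier G"
  by (induction gs) auto

lemma lprod_append: "\<lbrakk>set xs \<subseteq> carrier G; set ys \<subseteq> carrier G\<rbrakk> \<Longrightarrow>
    lprod G (xs @ ys) = lprod G xs \<otimes> lprod G ys"
  by (induction xs) (auto simp: m_assoc)

lemma set_take_subset_carrier: "set gs \<subseteq> carrier G \<Longrightarrow> set (take k gs) \<subseteq> carrier G"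
  by (auto dest: in_set_takeD)

text \<open>Multiplying the entries i and i + 1 (counted from 1) leaves shorter prefix products
  alone and absorbs one entry into the longer ones. The bound on k covers the last face: there k < i
  always holds, so the dropped entry is never reached.\<close>

lemma lprod_take_bar_face:
  assumes "set gs \<subseteq> carrier G" "1 \<le> i" "i \<le> length gs" "k < length gs"
  shows "lprod G (take k (bar_face G i gs)) = lprod G (take (if k < i then k else Suc k) gs)"
proof (cases "i = length gs \<or> k < i")
  case True
  then show ?thesis using assms by (auto simp: bar_face_def take_butlast)
next
  case False
  define xs where "xs = take (i - 1) gs"
  define ys where "ys = drop (i + 1) gs"
  have gs: "gs = xs @ [gs ! (i - 1), gs ! i] @ ys"
    using False assms unfolding xs_def ys_def
    by (metis Cons_nth_drop_Suc One_nat_def Suc_eq_plus1 Suc_le_lessD Suc_pred append_Cons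
        append_Nil append_take_drop_id le_neq_implies_less less_imp_diff_less)
  have f: "bar_face G i gs = xs @ [gs ! (i - 1) \<otimes> gs ! i] @ ys"
    using False assms unfolding xs_def ys_def by (simp add: bar_face_def)
  have len: "length xs = i - 1" using assms by (simp add: xs_def)
  have "take k (bar_face G i gs) = xs @ [gs ! (i - 1) \<otimes> gs ! i] @ take (k - i) ys"
    using False assms len unfolding f by (auto simp: take_Cons' le_diff_conv)
  moreover have "take (Suc k) gs = xs @ [gs ! (i - 1), gs ! i] @ take (k - i) ys"
    using False assms len by (subst gs) (auto simp: take_Cons' le_diff_conv)
  moreover have "set xs \<subseteq> carrier G" "set (take (k - i) ys) \<subseteq> carrier G"
      "gs ! (i - 1) \<in> carrier G" "gs ! i \<in> carrier G"
    using assms False by (auto simp: xs_def ys_def dest: in_set_takeD in_set_dropD intro!: subsetD[OF assms(1)])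
  ultimately show ?thesis using False by (simp add: lprod_append m_assoc)
qed

text \<open>A prefix longer than i contains the inserted identity, which takes up one place and
  contributes nothing to the product.\<close>

lemma lprod_take_bar_degen:
  assumes "set gs \<subseteq> carrier G" "i \<le> length gs"
  shows "lprod G (take k (bar_degen G i gs)) = lprod G (take (if k \<le> i then k else k - 1) gs)"
proof (cases "k \<le> i")
  case False
  then have "take k (bar_degen G i gs) = take i gs @ [\<one>] @ take (k - 1 - i) (drop i gs)"
    using assms by (simp add: bar_degen_def take_Cons')
  moreover have "take (k - 1) gs = take i gs @ take (k - 1 - i) (drop i gs)"
    using False take_add[of i "k - 1 - i" gs] by simp
  moreover have "set (take i gs) \<subseteq> carrier G" "set (take (k - 1 - i) (drop i gs)) \<subseteq> carrier G"
    using assms by (auto dest: in_set_takeD in_set_dropD)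
  ultimately show ?thesis using False by (simp add: lprod_append)
qed (use assms in \<open>simp add: bar_degen_def\<close>)

end

section \<open>The twisting function of an extension\<close>

locale crossed_module_extension = crossed_module \<Gamma> A c act + E: group E + G: group G
  for \<Gamma> :: "('m, 'v) monoid_scheme" and A :: "('f, 'w) monoid_scheme" and c act
    and E :: "('h, 'x) monoid_scheme" and G :: "('g, 'y) monoid_scheme" +
  fixes e :: "'m \<Rightarrow> 'h" and \<rho> :: "'h \<Rightarrow> 'g" and \<tau> :: "'h \<Rightarrow> 'f" and t :: "'g \<Rightarrow> 'h"
  assumes e_mon: "e \<in> mon \<Gamma> E"
    and \<rho>_hom: "\<rho> \<in> hom E G"
    and kernel_\<rho>: "kernel E G \<rho> = e ` carrier \<Gamma>"
    and \<tau>_hom: "\<tau> \<in> hom E A"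
    and \<tau>_e: "x \<in> carrier \<Gamma> \<Longrightarrow> \<tau> (e x) = c x"
    and e_act: "\<lbrakk>u \<in> carrier E; x \<in> carrier \<Gamma>\<rbrakk> \<Longrightarrow> e (act (\<tau> u) x) = u \<otimes>\<^bsub>E\<^esub> e x \<otimes>\<^bsub>E\<^esub> inv\<^bsub>E\<^esub> u"
    and t_closed: "g \<in> carrier G \<Longrightarrow> t g \<in> carrier E"
    and \<rho>_t: "g \<in> carrier G \<Longrightarrow> \<rho> (t g) = g"
    and t_one: "t \<one>\<^bsub>G\<^esub> = \<one>\<^bsub>E\<^esub>"
begin

text \<open>The quotient of two elements over the same element of \<open>G\<close>, pulled back to
  \<Gamma>. It has a meaning only in that case, when the quotient lies in the kernel of
  \<open>\<rho>\<close>.\<close>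

definition dvn :: "'h \<Rightarrow> 'h \<Rightarrow> 'm" where
  "dvn u v = inv_into (carrier \<Gamma>) e (u \<otimes>\<^bsub>E\<^esub> inv\<^bsub>E\<^esub> v)"

text \<open>Elements of one fibre of \<open>\<rho>\<close>, joined by their quotients, form a
  simplex of the translation groupoid of \<Gamma> on \<open>E\<close>; this is its image under
  \<open>\<tau>\<close>. Edge k runs from vertex k + 1 to vertex k, as the nerve convention
  requires.\<close>

definition simplex :: "'h list \<Rightarrow> ('f, 'm) simplex" where
  "simplex us = (map \<tau> us, map (\<lambda>k. dvn (us ! k) (us ! Suc k)) [0..<length us - 1])"

text \<open>A subset of a singleton and not an equality, so that the empty list qualifies.\<close>

definition fibre_list :: "'h list \<Rightarrow> bool" where
  "fibre_list us \<longleftrightarrow> set us \<subseteq> carrier E \<and> (\<exists>g. \<rho> ` set us \<subseteq> {g})"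

lemma dvn:
  assumes "u \<in> carrier E" "v \<in> carrier E" "\<rho> u = \<rho> v"
  shows dvn_closed: "dvn u v \<in> carrier \<Gamma>" and e_dvn: "e (dvn u v) = u \<otimes>\<^bsub>E\<^esub> inv\<^bsub>E\<^esub> v"
proof -
  interpret \<rho>: group_hom E G \<rho>
    using \<rho>_hom by unfold_locales
  have "\<rho> u \<in> carrier G" using assms by simp
  then have "u \<otimes>\<^bsub>E\<^esub> inv\<^bsub>E\<^esub> v \<in> kernel E G \<rho>"
    using assms by (simp add: kernel_def)
  then have *: "u \<otimes>\<^bsub>E\<^esub> inv\<^bsub>E\<^esub> v \<in> e ` carrier \<Gamma>" by (simp add: kernel_\<rho>)
  show "dvn u v \<in> carrier \<Gamma>" "e (dvn u v) = u \<otimes>\<^bsub>E\<^esub> inv\<^bsub>E\<^esub> v"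
    using inv_into_into[OF *] f_inv_into_f[OF *] by (simp_all add: dvn_def)
qed

lemma e_closed [simp]: "x \<in> carrier \<Gamma> \<Longrightarrow> e x \<in> carrier E"
  using e_mon by (auto simp: mon_def hom_def)

lemma e_mult: "x \<in> carrier \<Gamma> \<Longrightarrow> y \<in> carrier \<Gamma> \<Longrightarrow> e (x \<otimes>\<^bsub>\<Gamma>\<^esub> y) = e x \<otimes>\<^bsub>E\<^esub> e y"
  using e_mon by (auto simp: mon_def hom_def)

lemma e_eq_iff: "x \<in> carrier \<Gamma> \<Longrightarrow> y \<in> carrier \<Gamma> \<Longrightarrow> e x = e y \<longleftrightarrow> x = y"
  using e_mon by (auto simp: mon_def inj_on_def)

lemma e_one: "e \<one>\<^bsub>\<Gamma>\<^esub> = \<one>\<^bsub>E\<^esub>"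
  using e_mon hom_one[of e \<Gamma> E] Gam.is_group E.is_group by (auto simp: mon_def)

lemma \<tau>_closed [simp]: "u \<in> carrier E \<Longrightarrow> \<tau> u \<in> carrier A"
  using \<tau>_hom by (auto simp: hom_def)

lemma \<tau>_mult: "u \<in> carrier E \<Longrightarrow> v \<in> carrier E \<Longrightarrow> \<tau> (u \<otimes>\<^bsub>E\<^esub> v) = \<tau> u \<otimes>\<^bsub>A\<^esub> \<tau> v"
  using \<tau>_hom by (auto simp: hom_def)

lemma \<tau>_one: "\<tau> \<one>\<^bsub>E\<^esub> = \<one>\<^bsub>A\<^esub>"
  using \<tau>_hom hom_one E.is_group Aut.is_group by blast

lemma dvn_eqI:
  assumes "x \<in> carrier \<Gamma>" "u \<in> carrier E" "v \<in> carrier E" "e x \<otimes>\<^bsub>E\<^esub> v = u"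
  shows "dvn u v = x"
proof -
  have "u \<otimes>\<^bsub>E\<^esub> inv\<^bsub>E\<^esub> v = e x"
    using assms by (metis E.inv_solve_right' e_closed)
  then show ?thesis
    using assms e_mon by (simp add: dvn_def mon_def inv_into_f_f)
qed

lemma dvn_refl: "u \<in> carrier E \<Longrightarrow> dvn u u = \<one>\<^bsub>\<Gamma>\<^esub>"
  by (rule dvn_eqI) (auto simp: e_one)

lemma dvn_mult:
  assumes "u \<in> carrier E" "v \<in> carrier E" "w \<in> carrier E" "\<rho> u = \<rho> v" "\<rho> v = \<rho> w"
  shows "dvn u v \<otimes>\<^bsub>\<Gamma>\<^esub> dvn v w = dvn u w"
proof -
  have "e (dvn u v \<otimes>\<^bsub>\<Gamma>\<^esub> dvn v w) \<otimes>\<^bsub>E\<^esub> w = u"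
    using assms by (simp add: e_mult dvn E.m_assoc E.inv_mult_cancel)
  then show ?thesis using assms by (intro dvn_eqI[symmetric]) (auto simp: dvn_closed)
qed

text \<open>The quotient of u u' by v v' is u v^-1 times the conjugate of u' v'^-1 by v, and
  conjugation by v is \<open>act (\<tau> v)\<close>.\<close>

lemma dvn_act:
  assumes "u \<in> carrier E" "v \<in> carrier E" "\<rho> u = \<rho> v" "u' \<in> carrier E" "v' \<in> carrier E" "\<rho> u' = \<rho> v'"
  shows "dvn u v \<otimes>\<^bsub>\<Gamma>\<^esub> act (\<tau> v) (dvn u' v') = dvn (u \<otimes>\<^bsub>E\<^esub> u') (v \<otimes>\<^bsub>E\<^esub> v')"
proof -
  have "e (dvn u v \<otimes>\<^bsub>\<Gamma>\<^esub> act (\<tau> v) (dvn u' v')) \<otimes>\<^bsub>E\<^esub> (v \<otimes>\<^bsub>E\<^esub> v') = u \<otimes>\<^bsub>E\<^esub> u'"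
    using assms by (simp add: e_mult dvn e_act E.m_assoc E.inv_mult_cancel)
  then show ?thesis using assms by (intro dvn_eqI[symmetric]) (auto simp: dvn_closed)
qed

lemma fibre_list_nth:
  assumes "fibre_list us" "i < length us" "j < length us"
  shows "us ! i \<in> carrier E" "\<rho> (us ! i) = \<rho> (us ! j)"
  using assms nth_mem[of i us] nth_mem[of j us] unfolding fibre_list_def by blast+

lemma simplex_nerve:
  assumes "fibre_list us" "us \<noteq> []"
  shows "simplex us \<in> nerve M (length us - 1)"
proof -
  have "dvn (us ! k) (us ! Suc k) \<in> Mor M (\<tau> (us ! Suc k)) (\<tau> (us ! k))"
    if "Suc k < length us" for k
  proof -
    note u = fibre_list_nth[OF assms(1), of k "Suc k"] fibre_list_nth[OF assms(1), of "Suc k" k]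
    have "c (dvn (us ! k) (us ! Suc k)) \<otimes>\<^bsub>A\<^esub> \<tau> (us ! Suc k) =
        \<tau> (e (dvn (us ! k) (us ! Suc k)) \<otimes>\<^bsub>E\<^esub> us ! Suc k)"
      using u that by (simp add: \<tau>_mult \<tau>_e dvn_closed)
    also have "\<dots> = \<tau> (us ! k)" using u that by (simp add: dvn E.m_assoc)
    finally show ?thesis using u that by (simp add: Mor_M_iff dvn_closed)
  qed
  then show ?thesis
    using assms by (auto simp: simplex_def nerve_def fibre_list_def subset_eq)
qed

lemma length_simplex [simp]:
  "length (fst (simplex us)) = length us" "length (snd (simplex us)) = length us - 1"
  by (simp_all add: simplex_def)

lemma simplex_nth:
  "k < length us \<Longrightarrow> fst (simplex us) ! k = \<tau> (us ! k)"
  "Suc k < length us \<Longrightarrow> snd (simplex us) ! k = dvn (us ! k) (us ! Suc k)"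
  by (simp_all add: simplex_def less_diff_conv)

text \<open>An inner face multiplies the two edges at the omitted vertex, and by
  \<open>dvn_mult\<close> their product is the quotient of the two neighbours; an outer face only
  drops an edge.\<close>

lemma face_simplex:
  assumes "fibre_list us" "i < length us" "2 \<le> length us"
  shows "face M i (simplex us) = simplex (take i us @ drop (Suc i) us)"
proof -
  define f where "f = snd (simplex us)"
  have f: "snd (face M i (simplex us)) =
      (if i = 0 then tl f else if i = length us - 1 then butlast f
       else take (i - 1) f @ [f ! (i - 1) \<otimes>\<^bsub>\<Gamma>\<^esub> f ! i] @ drop (i + 1) f)"
    by (simp add: face_def f_def split_beta)
  have lf: "length f = length us - 1" by (simp add: f_def)
  have f_nth: "f ! k = dvn (us ! k) (us ! Suc k)" if "Suc k < length us" for k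
    using that by (simp add: f_def simplex_nth)
  have "snd (face M i (simplex us)) = snd (simplex (take i us @ drop (Suc i) us))"
  proof (rule nth_equalityI)
    show len: "length (snd (face M i (simplex us))) = length (snd (simplex (take i us @ drop (Suc i) us)))"
      using assms by (auto simp: f lf)
    fix k assume "k < length (snd (face M i (simplex us)))"
    then have k: "Suc (Suc k) < length us"
      using assms unfolding len by auto
    note u = fibre_list_nth[OF assms(1), of k "Suc k"] fibre_list_nth[OF assms(1), of "Suc k" k]
      fibre_list_nth[OF assms(1), of "Suc (Suc k)" k]
    have r: "snd (simplex (take i us @ drop (Suc i) us)) ! k =
        dvn ((take i us @ drop (Suc i) us) ! k) ((take i us @ drop (Suc i) us) ! Suc k)"
      using k assms(2) by (intro simplex_nth) auto
    \<comment> \<open>Position of the omitted vertex i relative to edge k, which joins the entries k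
      and k + 1 of the shortened list. Only an inner i = k + 1 gives a composite edge.\<close>
    consider "i = 0" | "i = length us - 1" "i \<noteq> 0" | "Suc k < i" "k < i - 1" "i < length us - 1"
      | "i = Suc k" "i < length us - 1" | "i \<le> k" "i \<noteq> 0" "i < length us - 1"
      using assms(2) by linarith
    then show "snd (face M i (simplex us)) ! k = snd (simplex (take i us @ drop (Suc i) us)) ! k"
    proof cases
      case 1
      then show ?thesis unfolding f r using k by (simp add: nth_tl f_nth lf)
    next
      case 2
      then show ?thesis unfolding f r using k by (simp add: nth_butlast nth_append f_nth lf)
    next
      case 3
      then show ?thesis unfolding f r using k by (simp add: nth_append f_nth lf)
    next
      case 4
      then show ?thesis unfolding f r using k u by (simp add: nth_append f_nth lf dvn_mult)
    next
      case 5
      then obtain j where "k = i + j" using le_Suc_ex by blast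
      moreover from this have "\<not> i + j < i - Suc 0" by linarith
      ultimately show ?thesis unfolding f r using k 5 by (simp add: nth_append f_nth lf)
    qed
  qed
  moreover have "fst (face M i (simplex us)) = fst (simplex (take i us @ drop (Suc i) us))"
    by (simp add: face_def simplex_def take_map drop_map)
  ultimately show ?thesis by (simp add: prod_eq_iff)
qed

text \<open>The repeated vertex has quotient 1 with itself, which is the identity edge that the
  degeneracy inserts.\<close>

lemma degen_simplex:
  assumes "fibre_list us" "i < length us"
  shows "degen M i (simplex us) = simplex (take (Suc i) us @ [us ! i] @ drop (Suc i) us)"
proof -
  define f where "f = snd (simplex us)"
  have f: "snd (degen M i (simplex us)) = take i f @ [\<one>\<^bsub>\<Gamma>\<^esub>] @ drop i f"
    by (simp add: degen_def f_def split_beta)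
  have lf: "length f = length us - 1" by (simp add: f_def)
  have f_nth: "f ! k = dvn (us ! k) (us ! Suc k)" if "Suc k < length us" for k
    using that by (simp add: f_def simplex_nth)
  have "snd (degen M i (simplex us)) = snd (simplex (take (Suc i) us @ [us ! i] @ drop (Suc i) us))"
  proof (rule nth_equalityI)
    show len: "length (snd (degen M i (simplex us))) =
        length (snd (simplex (take (Suc i) us @ [us ! i] @ drop (Suc i) us)))"
      using assms by (auto simp: f lf)
    fix k assume "k < length (snd (degen M i (simplex us)))"
    then have k: "k < length us"
      using assms unfolding len by auto
    have r: "snd (simplex (take (Suc i) us @ [us ! i] @ drop (Suc i) us)) ! k =
        dvn ((take (Suc i) us @ [us ! i] @ drop (Suc i) us) ! k)
          ((take (Suc i) us @ [us ! i] @ drop (Suc i) us) ! Suc k)"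
      using k assms(2) by (intro simplex_nth) auto
    consider "k < i" "k < length us - 1" | "k = i" "\<not> length us - 1 < i" | "i < k"
      using k assms(2) by linarith
    then show "snd (degen M i (simplex us)) ! k =
        snd (simplex (take (Suc i) us @ [us ! i] @ drop (Suc i) us)) ! k"
    proof cases
      case 1
      then show ?thesis unfolding f r using k assms(2) by (simp add: nth_append f_nth lf)
    next
      case 2
      then have "min (length us - Suc 0) i = i" by linarith
      with 2 show ?thesis unfolding f r using k assms(2) fibre_list_nth(1)[OF assms assms(2)]
        by (simp add: nth_append dvn_refl lf)
    next
      case 3
      then obtain j where j: "k = Suc (i + j)" using less_imp_Suc_add by blast
      have "min (length us - Suc 0) i = i" using assms(2) k 3 by linarith
      then show ?thesis unfolding f r using k assms(2) unfolding j
        by (cases j) (simp_all add: nth_append lf f_nth)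
    qed
  qed
  moreover have "fst (degen M i (simplex us)) = fst (simplex (take (Suc i) us @ [us ! i] @ drop (Suc i) us))"
    using assms(2) by (simp add: degen_def simplex_def take_map drop_map)
  ultimately show ?thesis by (simp add: prod_eq_iff)
qed

text \<open>Vertices multiply because \<open>\<tau>\<close> is a homomorphism. On edges,
  \<open>dvn_act\<close> turns the twisted product of the monoidal category into the plain product
  of \<open>E\<close>.\<close>

lemma nerve_mult_simplex:
  assumes "fibre_list us" "fibre_list vs" "length us = length vs"
  shows "nerve_mult M (simplex us) (simplex vs) = simplex (map2 (mult E) us vs)"
proof -
  have "fst (nerve_mult M (simplex us) (simplex vs)) = fst (simplex (map2 (mult E) us vs))"
    using assms(3) fibre_list_nth(1)[OF assms(1)] fibre_list_nth(1)[OF assms(2)]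
    by (intro nth_equalityI) (simp_all add: nerve_mult_def simplex_def \<tau>_mult)
  moreover have "snd (nerve_mult M (simplex us) (simplex vs)) = snd (simplex (map2 (mult E) us vs))"
  proof (rule nth_equalityI)
    fix k assume "k < length (snd (nerve_mult M (simplex us) (simplex vs)))"
    then have k: "Suc k < length us" "Suc k < length vs"
      using assms(3) by (simp_all add: nerve_mult_def simplex_def)
    note u = fibre_list_nth[OF assms(1), of k "Suc k"] fibre_list_nth[OF assms(1), of "Suc k" k]
       fibre_list_nth[OF assms(2), of k "Suc k"] fibre_list_nth[OF assms(2), of "Suc k" k]
    then show "snd (nerve_mult M (simplex us) (simplex vs)) ! k = snd (simplex (map2 (mult E) us vs)) ! k"
      using k by (simp add: nerve_mult_def simplex_def dvn_act)
  qed (use assms(3) in \<open>simp add: nerve_mult_def simplex_def\<close>)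
  ultimately show ?thesis by (simp add: prod_eq_iff)
qed

text \<open>The vertex \<open>k\<close> of \<open>\<phi>\<^sub>n [g\<^sub>1|\<dots>|g\<^sub>n]\<close> lifts to \<open>t(g\<^sub>1\<cdots>g\<^sub>k\<^sub>+\<^sub>1) t(g\<^sub>2\<cdots>g\<^sub>k\<^sub>+\<^sub>1)\<inverse>\<close>, so \<open>d\<^sub>1\<close>
  becomes the telescoping product of lifts.\<close>

definition lift :: "'g list \<Rightarrow> nat \<Rightarrow> 'h" where
  "lift gs k = t (lprod G (take (Suc k) gs)) \<otimes>\<^bsub>E\<^esub> inv\<^bsub>E\<^esub> t (lprod G (take k (tl gs)))"

definition lifts :: "'g list \<Rightarrow> 'h list" where
  "lifts gs = map (lift gs) [0..<length gs]"

lemma lift_closed [simp]: "set gs \<subseteq> carrier G \<Longrightarrow> lift gs k \<in> carrier E"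
  by (simp add: lift_def t_closed G.set_take_subset_carrier set_tl_subset)

text \<open>The arguments of the two values of \<open>t\<close> differ by the leading entry only.
  The result is independent of k, so the lifts of one list share a fibre and \<open>dvn\<close>
  applies to them.\<close>

lemma \<rho>_lift:
  assumes "set gs \<subseteq> carrier G" "gs \<noteq> []"
  shows "\<rho> (lift gs k) = hd gs"
proof -
  interpret \<rho>: group_hom E G \<rho>
    using \<rho>_hom by unfold_locales
  have P: "lprod G (take k (tl gs)) \<in> carrier G"
    using assms by (simp add: G.set_take_subset_carrier set_tl_subset)
  have "lprod G (take (Suc k) gs) = hd gs \<otimes>\<^bsub>G\<^esub> lprod G (take k (tl gs))"
    using assms(2) by (cases gs) auto
  moreover have "hd gs \<in> carrier G" using assms by auto
  ultimately show ?thesis using assms P by (simp add: lift_def t_closed \<rho>_t G.m_assoc)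
qed

lemma fibre_list_lifts: "set gs \<subseteq> carrier G \<Longrightarrow> fibre_list (lifts gs)"
  by (cases "gs = []") (auto simp: fibre_list_def lifts_def \<rho>_lift intro!: exI[of _ "hd gs"])

text \<open>For i at least 2 the leading entry keeps its place, so the tail of face i is face i - 1
  of the tail, and both products in \<open>lift\<close> skip the same index. The omitted vertex has
  number i - 1, which is the index shift in a twisting function.\<close>

lemma lifts_bar_face:
  assumes "set gs \<subseteq> carrier G" "2 \<le> i" "i \<le> length gs"
  shows "lifts (bar_face G i gs) = take (i - 1) (lifts gs) @ drop i (lifts gs)"
proof (rule nth_equalityI)
  show len: "length (lifts (bar_face G i gs)) = length (take (i - 1) (lifts gs) @ drop i (lifts gs))"
    using assms by (auto simp: lifts_def length_bar_face)
  fix k assume "k < length (lifts (bar_face G i gs))"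
  then have k: "Suc k < length gs" using assms by (simp add: lifts_def length_bar_face)
  have tl: "tl (bar_face G i gs) = bar_face G (i - 1) (tl gs)"
    using assms by (cases gs) (auto simp: bar_face_def numeral_2_eq_2 Suc_le_eq take_Cons' nth_Cons')
  have "lprod G (take (Suc k) (bar_face G i gs)) = lprod G (take (if Suc k < i then Suc k else Suc (Suc k)) gs)"
    using assms k by (intro G.lprod_take_bar_face) auto
  moreover have "lprod G (take k (tl (bar_face G i gs))) =
      lprod G (take (if k < i - 1 then k else Suc k) (tl gs))"
    unfolding tl using assms k by (intro G.lprod_take_bar_face) (auto simp: set_tl_subset)
  ultimately have "lift (bar_face G i gs) k = lift gs (if Suc k < i then k else Suc k)"
    using assms by (auto simp: lift_def)
  then show "lifts (bar_face G i gs) ! k = (take (i - 1) (lifts gs) @ drop i (lifts gs)) ! k"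
    using assms k by (auto simp: lifts_def nth_append length_bar_face)
qed

lemma lifts_bar_degen:
  assumes "set gs \<subseteq> carrier G" "1 \<le> i" "i \<le> length gs"
  shows "lifts (bar_degen G i gs) = take i (lifts gs) @ [lifts gs ! (i - 1)] @ drop i (lifts gs)"
proof (rule nth_equalityI)
  show len: "length (lifts (bar_degen G i gs)) =
      length (take i (lifts gs) @ [lifts gs ! (i - 1)] @ drop i (lifts gs))"
    using assms by (auto simp: lifts_def length_bar_degen)
  fix k assume "k < length (lifts (bar_degen G i gs))"
  then have k: "k < Suc (length gs)" using assms by (simp add: lifts_def length_bar_degen)
  have tl: "tl (bar_degen G i gs) = bar_degen G (i - 1) (tl gs)"
    using assms by (cases gs) (auto simp: bar_degen_def take_Cons' drop_Cons')
  have "lprod G (take (Suc k) (bar_degen G i gs)) = lprod G (take (if Suc k \<le> i then Suc k else k) gs)"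
    using G.lprod_take_bar_degen[OF assms(1,3), of "Suc k"] by simp
  moreover have "lprod G (take k (tl (bar_degen G i gs))) =
      lprod G (take (if k \<le> i - 1 then k else k - 1) (tl gs))"
    unfolding tl using assms by (intro G.lprod_take_bar_degen) (auto simp: set_tl_subset)
  \<comment> \<open>The conditionals coming from the list, from its tail and from the claim switch
    at the same k.\<close>
  moreover have "k < i \<and> Suc k \<le> i \<and> k \<le> i - 1 \<or> \<not> k < i \<and> \<not> Suc k \<le> i \<and> \<not> k \<le> i - 1 \<and> Suc (k - 1) = k"
    using assms(2) by linarith
  ultimately have "lift (bar_degen G i gs) k = lift gs (if k < i then k else k - 1)"
    by (elim disjE conjE) (simp_all only: lift_def if_True if_False)
  then show "lifts (bar_degen G i gs) ! k = (take i (lifts gs) @ [lifts gs ! (i - 1)] @ drop i (lifts gs)) ! k"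
    using assms k by (cases "k < i"; cases "k = i") (auto simp: lifts_def nth_append length_bar_degen simp del: upt_Suc)
qed

text \<open>A leading identity makes the two arguments of \<open>t\<close> in \<open>lift\<close>
  equal.\<close>

lemma lifts_one_Cons:
  assumes "set gs \<subseteq> carrier G"
  shows "lifts (\<one>\<^bsub>G\<^esub> # gs) = replicate (Suc (length gs)) \<one>\<^bsub>E\<^esub>"
  using assms
  by (intro nth_equalityI)
    (simp_all add: lifts_def lift_def t_closed G.set_take_subset_carrier del: upt_Suc replicate_Suc)

text \<open>The second factor of vertex k + 1 of \<open>gs\<close> is the inverse of the first
  factor of vertex k of \<open>tl gs\<close>.\<close>

lemma lifts_bar_face_1:
  assumes "set gs \<subseteq> carrier G" "2 \<le> length gs"
  shows "lifts (bar_face G 1 gs) = map2 (mult E) (tl (lifts gs)) (lifts (tl gs))"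
proof (rule nth_equalityI)
  show "length (lifts (bar_face G 1 gs)) = length (map2 (mult E) (tl (lifts gs)) (lifts (tl gs)))"
    using assms by (simp add: lifts_def length_bar_face)
  fix k assume "k < length (lifts (bar_face G 1 gs))"
  then have k: "Suc k < length gs" using assms by (simp add: lifts_def length_bar_face)
  have "lprod G (take (Suc k) (bar_face G 1 gs)) = lprod G (take (Suc (Suc k)) gs)"
    using G.lprod_take_bar_face[of gs 1 "Suc k"] assms k by simp
  moreover have "tl (bar_face G 1 gs) = tl (tl gs)"
    using assms by (cases gs; cases "tl gs") (auto simp: bar_face_def)
  ultimately have "lift (bar_face G 1 gs) k = lift gs (Suc k) \<otimes>\<^bsub>E\<^esub> lift (tl gs) k"
    using assms
    by (simp add: lift_def t_closed G.set_take_subset_carrier set_tl_subset E.m_assoc E.inv_mult_cancel)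
  then show "lifts (bar_face G 1 gs) ! k = map2 (mult E) (tl (lifts gs)) (lifts (tl gs)) ! k"
    using assms k by (simp add: lifts_def nth_tl length_bar_face)
qed

end

section \<open>The twisting function of an extension and its values in degrees 1 and 2\<close>

context crossed_module_extension begin

definition twist :: "nat \<Rightarrow> (unit, 'g) simplex \<Rightarrow> ('f, 'm) simplex" where
  "twist = (\<lambda>n\<in>{1..}. \<lambda>x\<in>nerve (group_cat G) n. simplex (lifts (snd x)))"

lemma twist_bar: "\<lbrakk>set gs \<subseteq> carrier G; length gs = n; gs \<noteq> []\<rbrakk> \<Longrightarrow> twist n (bar gs) = simplex (lifts gs)"
  by (auto simp: twist_def nerve_group_cat Suc_le_eq)

lemma length_lifts [simp]: "length (lifts gs) = length gs"
  by (simp add: lifts_def)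

lemma simplex_lifts_nerve:
  assumes "set gs \<subseteq> carrier G" "gs \<noteq> []"
  shows "simplex (lifts gs) \<in> nerve M (length gs - 1)"
  using simplex_nerve[OF fibre_list_lifts[OF assms(1)]] assms(2)
  by (metis length_lifts length_greater_0_conv)

text \<open>Every condition becomes an identity between lists of lifts, since \<open>simplex\<close>
  takes omitted entries, repeated entries and entrywise products to faces, degeneracies and
  products.\<close>

lemma twisting_function_twist: "twisting_function (group_cat G) M twist"
  unfolding twisting_function_def
proof (intro conjI allI impI ballI)
  have "simplex (lifts (snd x)) \<in> nerve M (n - 1)" if "n \<in> {1..}" "x \<in> nerve (group_cat G) n" for n x
    using that simplex_lifts_nerve[of "snd x"] by (cases "snd x = []") (auto simp: nerve_group_cat)
  then show "twist \<in> (\<Pi>\<^sub>E n\<in>{1..}. nerve (group_cat G) n \<rightarrow>\<^sub>E nerve M (n - 1))"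
    unfolding twist_def by auto
next
  fix n :: nat and x i assume n: "2 \<le> n" and x: "x \<in> nerve (group_cat G) n" and i: "i \<in> {2..n}"
  then obtain gs where gs: "x = bar gs" "length gs = n" "set gs \<subseteq> carrier G" "gs \<noteq> []"
    by (force simp: nerve_group_cat)
  \<comment> \<open>\<open>twist_bar\<close> asks for a nonempty list; a face in degree at least 2
    still has an entry.\<close>
  have "bar_face G i gs \<noteq> []" using length_bar_face[of i gs G] gs n i by auto
  moreover have "i - 1 < n" "Suc (i - 1) = i" using i by auto
  ultimately show "twist (n - 1) (face (group_cat G) i x) = face M (i - 1) (twist n x)"
    using gs n i fibre_list_lifts[of gs]
    by (simp add: face_bar twist_bar G.set_bar_face length_bar_face lifts_bar_face face_simplex del: One_nat_def)
next
  fix n :: nat and x assume n: "2 \<le> n" and x: "x \<in> nerve (group_cat G) n"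
  then obtain gs where gs: "x = bar gs" "length gs = n" "set gs \<subseteq> carrier G" "gs \<noteq> []"
    by (force simp: nerve_group_cat)
  have ne: "bar_face G 1 gs \<noteq> []" "tl gs \<noteq> []"
    using length_bar_face[of 1 gs G] gs n by (auto simp flip: length_0_conv)
  have "face M 0 (twist n x) = simplex (tl (lifts gs))"
    using gs n fibre_list_lifts[of gs] by (simp add: twist_bar face_simplex drop_Suc)
  moreover have "twist (n - 1) (face (group_cat G) 0 x) = simplex (lifts (tl gs))"
    using gs n ne by (simp add: face_bar bar_face_def twist_bar set_tl_subset)
  moreover have "fibre_list (tl (lifts gs))"
    using fibre_list_lifts[OF gs(3)] by (cases "lifts gs") (auto simp: fibre_list_def)
  ultimately show "twist (n - 1) (face (group_cat G) 1 x) =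
      nerve_mult M (face M 0 (twist n x)) (twist (n - 1) (face (group_cat G) 0 x))"
    using gs n ne fibre_list_lifts[of "tl gs"]
    by (simp add: face_bar twist_bar G.set_bar_face length_bar_face lifts_bar_face_1
        nerve_mult_simplex set_tl_subset del: One_nat_def)
next
  fix n :: nat and x i assume n: "1 \<le> n" and x: "x \<in> nerve (group_cat G) n" and i: "i \<in> {1..n}"
  then obtain gs where gs: "x = bar gs" "length gs = n" "set gs \<subseteq> carrier G" "gs \<noteq> []"
    by (force simp: nerve_group_cat)
  have "bar_degen G i gs \<noteq> []" by (simp add: bar_degen_def)
  moreover have "i - 1 < n" "Suc (i - 1) = i" using i by auto
  ultimately show "twist (n + 1) (degen (group_cat G) i x) = degen M (i - 1) (twist n x)"
    using gs n i fibre_list_lifts[of gs]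
    by (simp add: degen_bar twist_bar G.set_bar_degen length_bar_degen lifts_bar_degen degen_simplex
        del: One_nat_def)
next
  fix n x assume "x \<in> nerve (group_cat G) n"
  then obtain gs where gs: "x = bar gs" "length gs = n" "set gs \<subseteq> carrier G"
    by (auto simp: nerve_group_cat)
  have "simplex (replicate (Suc n) \<one>\<^bsub>E\<^esub>) = nerve_one M n"
    unfolding simplex_def nerve_one_def
    by (auto intro!: nth_equalityI simp: \<tau>_one dvn_refl simp del: replicate_Suc)
  then show "twist (n + 1) (degen (group_cat G) 0 x) = nerve_one M n"
    using gs by (simp add: degen_bar bar_degen_def twist_bar lifts_one_Cons del: replicate_Suc)
qed

lemma twist_1: "g \<in> carrier G \<Longrightarrow> twist 1 (bar [g]) = ([\<tau> (t g)], [])"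
  by (simp add: twist_bar lifts_def lift_def simplex_def t_closed t_one)

text \<open>The two vertices lift to t(g) and t(gh) t(h)^-1, so the edge maps to t(g) t(h)
  t(gh)^-1.\<close>

lemma e_twist_2:
  assumes "g \<in> carrier G" "h \<in> carrier G"
  shows "t g \<otimes>\<^bsub>E\<^esub> t h = e (hd (snd (twist 2 (bar [g, h])))) \<otimes>\<^bsub>E\<^esub> t (g \<otimes>\<^bsub>G\<^esub> h)"
proof -
  have "hd (snd (twist 2 (bar [g, h]))) = dvn (lift [g, h] 0) (lift [g, h] 1)"
    using assms by (simp add: twist_bar lifts_def simplex_def upt_rec)
  also have "e \<dots> = lift [g, h] 0 \<otimes>\<^bsub>E\<^esub> inv\<^bsub>E\<^esub> lift [g, h] 1"
    using assms by (intro e_dvn) (auto simp: \<rho>_lift)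
  also have "\<dots> = t g \<otimes>\<^bsub>E\<^esub> (t h \<otimes>\<^bsub>E\<^esub> inv\<^bsub>E\<^esub> t (g \<otimes>\<^bsub>G\<^esub> h))"
    using assms by (simp add: lift_def t_closed t_one E.inv_mult_group)
  finally show ?thesis using assms by (simp add: t_closed E.m_assoc)
qed

end

section \<open>Twisting functions are determined by degrees 1 and 2\<close>

lemma twisting_functionD:
  assumes "twisting_function C D \<phi>" "x \<in> nerve C n"
  shows twisting_function_nerve: "1 \<le> n \<Longrightarrow> \<phi> n x \<in> nerve D (n - 1)"
    and twisting_function_face: "\<lbrakk>2 \<le> i; i \<le> n\<rbrakk> \<Longrightarrow> \<phi> (n - 1) (face C i x) = face D (i - 1) (\<phi> n x)"
    and twisting_function_face_1: "2 \<le> n \<Longrightarrow>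
      \<phi> (n - 1) (face C 1 x) = nerve_mult D (face D 0 (\<phi> n x)) (\<phi> (n - 1) (face C 0 x))"
    and twisting_function_degen: "\<lbrakk>1 \<le> i; i \<le> n\<rbrakk> \<Longrightarrow> \<phi> (n + 1) (degen C i x) = degen D (i - 1) (\<phi> n x)"
    and twisting_function_degen_0: "\<phi> (n + 1) (degen C 0 x) = nerve_one D n"
proof -
  note tw = assms(1)[unfolded twisting_function_def]
  have "\<phi> \<in> (\<Pi>\<^sub>E n\<in>{1..}. nerve C n \<rightarrow>\<^sub>E nerve D (n - 1))" using tw by blast
  then show "\<phi> n x \<in> nerve D (n - 1)" if "1 \<le> n"
    using that assms(2) by (auto dest!: PiE_mem[of _ _ _ n])
  show "\<phi> (n - 1) (face C i x) = face D (i - 1) (\<phi> n x)" if "2 \<le> i" "i \<le> n"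
    using tw that assms(2) by (meson atLeastAtMost_iff order_trans)
  show "\<phi> (n - 1) (face C 1 x) = nerve_mult D (face D 0 (\<phi> n x)) (\<phi> (n - 1) (face C 0 x))" if "2 \<le> n"
    using tw that assms(2) by blast
  show "\<phi> (n + 1) (degen C i x) = degen D (i - 1) (\<phi> n x)" if "1 \<le> i" "i \<le> n"
    using tw that assms(2) by (meson atLeastAtMost_iff order_trans)
  show "\<phi> (n + 1) (degen C 0 x) = nerve_one D n"
    using tw assms(2) by blast
qed

text \<open>\<open>PiE\<close> fixes the values in degree 0 and off the nerve, so only simplices of
  positive degree have to be compared.\<close>

lemma twisting_function_eqI:
  assumes "twisting_function C D \<phi>" "twisting_function C D \<psi>"
    "\<And>n x. 1 \<le> n \<Longrightarrow> x \<in> nerve C n \<Longrightarrow> \<phi> n x = \<psi> n x"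
  shows "\<phi> = \<psi>"
proof -
  have "\<phi> \<in> (\<Pi>\<^sub>E n\<in>{1..}. nerve C n \<rightarrow>\<^sub>E nerve D (n - 1))"
    "\<psi> \<in> (\<Pi>\<^sub>E n\<in>{1..}. nerve C n \<rightarrow>\<^sub>E nerve D (n - 1))"
    using assms(1,2) by (simp_all add: twisting_function_def)
  then show ?thesis
  proof (rule PiE_ext)
    fix n :: nat assume n: "n \<in> {1..}"
    then have "\<phi> n \<in> nerve C n \<rightarrow>\<^sub>E nerve D (n - 1)" "\<psi> n \<in> nerve C n \<rightarrow>\<^sub>E nerve D (n - 1)"
      using \<open>\<phi> \<in> _\<close> \<open>\<psi> \<in> _\<close> by (blast dest: PiE_mem)+
    then show "\<phi> n = \<psi> n"
      by (rule PiE_ext) (use n in \<open>auto intro: assms(3)\<close>)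
  qed
qed

lemma face_0_nerve: "x \<in> nerve C (Suc n) \<Longrightarrow> face C 0 x \<in> nerve C n"
  using set_tl_subset[of "fst x" "Obj C"]
  by (simp add: nerve_def face_def drop_Suc nth_tl split_beta)

context crossed_module begin

text \<open>Vertices come first: in a product of edges the right factor is acted on by the source
  vertex of the left edge, so it can be cancelled only once these vertices agree.\<close>

lemma nerve_mult_cancel:
  assumes x: "x \<in> nerve M n" and y: "y \<in> nerve M n" and z: "z \<in> nerve M n"
    and eq: "nerve_mult M x z = nerve_mult M y z"
  shows "x = y"
proof -
  obtain c1 f1 c2 f2 c3 f3 where [simp]: "x = (c1, f1)" "y = (c2, f2)" "z = (c3, f3)"
    by (metis surj_pair)
  have len: "length c1 = Suc n" "length c2 = Suc n" "length c3 = Suc n"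
    "length f1 = n" "length f2 = n" "length f3 = n"
    using x y z by (auto simp: nerve_def)
  have c_in: "c1 ! i \<in> carrier A" "c2 ! i \<in> carrier A" "c3 ! i \<in> carrier A" if "i \<le> n" for i
    using x y z that by (auto simp: nerve_def subset_eq)
  have f_in: "f1 ! i \<in> carrier \<Gamma>" "f2 ! i \<in> carrier \<Gamma>" "f3 ! i \<in> carrier \<Gamma>" if "i < n" for i
    using x y z that by (auto simp: nerve_def Mor_M_iff)
  have "c1 ! i = c2 ! i" if "i \<le> n" for i
  proof -
    have "map2 (mult A) c1 c3 ! i = map2 (mult A) c2 c3 ! i"
      using eq by (simp add: nerve_mult_def)
    then show ?thesis using that len c_in[OF that] by simp
  qed
  then have c_eq: "c1 = c2"
    using len by (intro nth_equalityI) auto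
  have "f1 ! i = f2 ! i" if "i < n" for i
  proof -
    have "f1 ! i \<otimes>\<^bsub>\<Gamma>\<^esub> act (c1 ! Suc i) (f3 ! i) = f2 ! i \<otimes>\<^bsub>\<Gamma>\<^esub> act (c1 ! Suc i) (f3 ! i)"
      using arg_cong[OF eq, of "\<lambda>x. snd x ! i"] that len by (simp add: nerve_mult_def c_eq)
    then show ?thesis using f_in[OF that] c_in[of "Suc i"] that by simp
  qed
  with c_eq show ?thesis using len by (auto intro: nth_equalityI)
qed

text \<open>For \<open>n \<ge> 3\<close>, \<open>d\<^sub>n\<close> determines all of \<open>\<phi>\<^sub>n(x)\<close> but its last vertex and edge, and \<open>d\<^sub>1\<close>
  determines \<open>d\<^sub>0 \<phi>\<^sub>n(x)\<close> by cancellation in the simplicial group.\<close>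

lemma twisting_function_unique:
  fixes G :: "('g, 'y) monoid_scheme"
  assumes "group G"
    and \<phi>: "twisting_function (group_cat G) M \<phi>" and \<psi>: "twisting_function (group_cat G) M \<psi>"
    and eq1: "\<And>g. g \<in> carrier G \<Longrightarrow> \<phi> 1 (bar [g]) = \<psi> 1 (bar [g])"
    and eq2: "\<And>g h. g \<in> carrier G \<Longrightarrow> h \<in> carrier G \<Longrightarrow>
      hd (snd (\<phi> 2 (bar [g, h]))) = hd (snd (\<psi> 2 (bar [g, h])))"
  shows "\<phi> = \<psi>"
proof (rule twisting_function_eqI[OF \<phi> \<psi>])
  interpret G: group G by fact
  fix n x assume "1 \<le> n" "x \<in> nerve (group_cat G) n"
  then show "\<phi> n x = \<psi> n x"
  proof (induction n arbitrary: x)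
    case (Suc n)
    obtain gs where gs: "x = bar gs" "length gs = Suc n" "set gs \<subseteq> carrier G" "gs \<noteq> []"
      using Suc.prems by (force simp: nerve_group_cat)
    show ?case
    proof (cases "n = 0")
      case True
      then show ?thesis using gs eq1 by (auto simp: length_Suc_conv)
    next
      case n: False
      have face_in: "face (group_cat G) i x \<in> nerve (group_cat G) n" if "i \<le> Suc n" for i
        using gs that n by (auto simp: nerve_group_cat face_bar length_bar_face
            intro!: imageI dest: subsetD[OF G.set_bar_face, rotated 2])
      have IH: "\<phi> n (face (group_cat G) i x) = \<psi> n (face (group_cat G) i x)" if "i \<le> Suc n" for i
        using Suc.IH face_in[OF that] n by simp
      obtain c1 f1 c2 f2 where cf: "\<phi> (Suc n) x = (c1, f1)" "\<psi> (Suc n) x = (c2, f2)"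
        by (metis surj_pair)
      have in_nerve: "\<phi> (Suc n) x \<in> nerve M n" "\<psi> (Suc n) x \<in> nerve M n"
        using twisting_function_nerve[OF \<phi> Suc.prems(2)] twisting_function_nerve[OF \<psi> Suc.prems(2)]
        by simp_all
      then have len: "length c1 = Suc n" "length f1 = n" "length c2 = Suc n" "length f2 = n"
        by (simp_all add: nerve_def cf)
      \<comment> \<open>The induction hypothesis covers the two terms of lower degree in the
        \<open>d\<^sub>1\<close> condition. What remains are the faces \<open>d\<^sub>0\<close> of
        both simplices, multiplied by the same simplex.\<close>
      have "nerve_mult M (face M 0 (\<phi> (Suc n) x)) (\<phi> n (face (group_cat G) 0 x)) =
          \<phi> n (face (group_cat G) 1 x)"
        using twisting_function_face_1[OF \<phi> Suc.prems(2)] n by simp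
      also have "\<dots> = nerve_mult M (face M 0 (\<psi> (Suc n) x)) (\<psi> n (face (group_cat G) 0 x))"
        using twisting_function_face_1[OF \<psi> Suc.prems(2)] n IH[of 1] by simp
      also have "\<psi> n (face (group_cat G) 0 x) = \<phi> n (face (group_cat G) 0 x)"
        using IH[of 0] by simp
      finally have "nerve_mult M (face M 0 (\<phi> (Suc n) x)) (\<phi> n (face (group_cat G) 0 x)) =
          nerve_mult M (face M 0 (\<psi> (Suc n) x)) (\<phi> n (face (group_cat G) 0 x))" .
      moreover have "\<phi> n (face (group_cat G) 0 x) \<in> nerve M (n - 1)"
        using twisting_function_nerve[OF \<phi> face_in] n by simp
      moreover have "face M 0 (\<phi> (Suc n) x) \<in> nerve M (n - 1)" "face M 0 (\<psi> (Suc n) x) \<in> nerve M (n - 1)"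
        using in_nerve n by (simp_all add: face_0_nerve)
      ultimately have "face M 0 (\<phi> (Suc n) x) = face M 0 (\<psi> (Suc n) x)"
        by (metis nerve_mult_cancel)
      then have tl: "tl c1 = tl c2" "tl f1 = tl f2"
        by (simp_all add: face_def drop_Suc cf)
      have "face M n (\<phi> (Suc n) x) = face M n (\<psi> (Suc n) x)"
      proof -
        have "\<phi> n (face (group_cat G) (Suc n) x) = face M n (\<phi> (Suc n) x)"
          using twisting_function_face[OF \<phi> Suc.prems(2), of "Suc n"] n by simp
        moreover have "\<psi> n (face (group_cat G) (Suc n) x) = face M n (\<psi> (Suc n) x)"
          using twisting_function_face[OF \<psi> Suc.prems(2), of "Suc n"] n by simp
        ultimately show ?thesis using IH[of "Suc n"] by simp
      qed
      then have "take n c1 = take n c2" "butlast f1 = butlast f2"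
        using len n by (auto simp: face_def cf)
      moreover have "hd c1 = hd c2"
        using calculation(1) n by (metis hd_take gr0I)
      \<comment> \<open>For n = 1 there is a single edge, which the last face drops; this is where
        the hypothesis on degree 2 enters. For larger n the last face keeps the first edge.\<close>
      moreover have "hd f1 = hd f2"
      proof (cases "n = 1")
        case True
        then obtain g h where "gs = [g, h]" using gs by (auto simp: length_Suc_conv)
        then show ?thesis using eq2[of g h] gs True cf by (simp add: numeral_2_eq_2)
      next
        case False
        then have "1 < length f1" "1 < length f2" using len n by auto
        moreover have "hd (butlast f) = hd f" if "1 < length f" for f :: "'m list"
          using that by (cases f) auto
        ultimately show ?thesis using \<open>butlast f1 = butlast f2\<close> by metis
      qed
      moreover have "c1 \<noteq> []" "c2 \<noteq> []" "f1 \<noteq> []" "f2 \<noteq> []"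
        using len n by auto
      ultimately show ?thesis using tl cf by (simp add: list.expand)
    qed
  qed simp
qed

end

section \<open>The extension of a twisting function\<close>

locale twisting_cocycle = crossed_module \<Gamma> A c act + G: group G
  for \<Gamma> :: "('m, 'v) monoid_scheme" and A :: "('f, 'w) monoid_scheme" and c act
    and G :: "('g, 'y) monoid_scheme" +
  fixes \<phi> :: "nat \<Rightarrow> (unit, 'g) simplex \<Rightarrow> ('f, 'm) simplex"
  assumes twisting: "twisting_function (group_cat G) M \<phi>"
begin

definition a :: "'g \<Rightarrow> 'f" where "a g = hd (fst (\<phi> 1 (bar [g])))"

text \<open>The factor set: in the extension to be built, \<open>t g\<close> times
  \<open>t h\<close> is \<open>e (\<chi> g h)\<close> times \<open>t\<close> of the product.\<close>

definition \<chi> :: "'g \<Rightarrow> 'g \<Rightarrow> 'm" where "\<chi> g h = hd (snd (\<phi> 2 (bar [g, h])))"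

lemma bar_nerve: "set gs \<subseteq> carrier G \<Longrightarrow> bar gs \<in> nerve (group_cat G) (length gs)"
  by (auto simp: nerve_group_cat)

lemma phi_1:
  assumes "g \<in> carrier G"
  shows "\<phi> 1 (bar [g]) = ([a g], [])" "a g \<in> carrier A"
proof -
  have "\<phi> 1 (bar [g]) \<in> nerve M 0"
    using twisting_function_nerve[OF twisting bar_nerve[of "[g]"]] assms by simp
  then show "\<phi> 1 (bar [g]) = ([a g], [])" "a g \<in> carrier A"
    unfolding a_def by (auto simp: nerve_def length_Suc_conv)
qed

lemma nerve_mult_single: "nerve_mult M ([x], []) ([y], []) = ([x \<otimes>\<^bsub>A\<^esub> y], [])"
  by (simp add: nerve_mult_def)

text \<open>The face \<open>d\<^sub>2\<close> identifies the first vertex with \<open>a g\<close>.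
  The twisted face \<open>d\<^sub>1\<close> determines the second vertex b through its product with
  \<open>a h\<close>.\<close>

lemma phi_2:
  assumes g: "g \<in> carrier G" and h: "h \<in> carrier G"
  obtains b where "\<phi> 2 (bar [g, h]) = ([a g, b], [\<chi> g h])" "b \<in> carrier A" "\<chi> g h \<in> carrier \<Gamma>"
    "a g = c (\<chi> g h) \<otimes>\<^bsub>A\<^esub> b" "b \<otimes>\<^bsub>A\<^esub> a h = a (g \<otimes>\<^bsub>G\<^esub> h)"
proof -
  have x: "bar [g, h] \<in> nerve (group_cat G) 2"
    using bar_nerve[of "[g, h]"] g h by (simp add: numeral_2_eq_2)
  have "\<phi> 2 (bar [g, h]) \<in> nerve M 1"
    using twisting_function_nerve[OF twisting x] by simp
  then obtain b0 b where p: "\<phi> 2 (bar [g, h]) = ([b0, b], [\<chi> g h])" "b0 \<in> carrier A" "b \<in> carrier A"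
    "\<chi> g h \<in> Mor M b b0"
    unfolding \<chi>_def by (auto simp: nerve_def length_Suc_conv)
  have "\<phi> 1 (bar [g]) = face M 1 (\<phi> 2 (bar [g, h]))"
    using twisting_function_face[OF twisting x, of 2] g h by (simp add: face_bar bar_face_def)
  then have "b0 = a g" using phi_1[OF g] by (simp add: p face_def)
  moreover have "\<phi> 1 (bar [g \<otimes>\<^bsub>G\<^esub> h]) = nerve_mult M (face M 0 (\<phi> 2 (bar [g, h]))) (\<phi> 1 (bar [h]))"
    using twisting_function_face_1[OF twisting x] g h by (simp add: face_bar bar_face_def)
  then have "b \<otimes>\<^bsub>A\<^esub> a h = a (g \<otimes>\<^bsub>G\<^esub> h)"
    using phi_1[OF h] phi_1[of "g \<otimes>\<^bsub>G\<^esub> h"] g h by (simp add: p face_def nerve_mult_single)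
  ultimately show ?thesis using p by (intro that[of b]) (auto simp: Mor_M_iff)
qed

lemma \<chi>_closed [simp]: "g \<in> carrier G \<Longrightarrow> h \<in> carrier G \<Longrightarrow> \<chi> g h \<in> carrier \<Gamma>"
  using phi_2[of g h] by blast

lemma a_closed [simp]: "g \<in> carrier G \<Longrightarrow> a g \<in> carrier A"
  by (rule phi_1)

text \<open>Multiply the edge relation between \<open>a g\<close> and the second vertex by
  \<open>a h\<close>.\<close>

lemma a_mult:
  assumes "g \<in> carrier G" "h \<in> carrier G"
  shows "a g \<otimes>\<^bsub>A\<^esub> a h = c (\<chi> g h) \<otimes>\<^bsub>A\<^esub> a (g \<otimes>\<^bsub>G\<^esub> h)"
proof -
  obtain b where "b \<in> carrier A" "a g = c (\<chi> g h) \<otimes>\<^bsub>A\<^esub> b" "b \<otimes>\<^bsub>A\<^esub> a h = a (g \<otimes>\<^bsub>G\<^esub> h)"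
    using phi_2[OF assms] by metis
  then show ?thesis using assms by (simp add: Aut.m_assoc)
qed

text \<open>The normalisations of \<open>a\<close> and \<open>\<chi>\<close> are the degeneracy
  conditions, applied to the vertex of the nerve and to the simplex [g]. They make the pair of
  identities neutral in the extension.\<close>

lemma a_one: "a \<one>\<^bsub>G\<^esub> = \<one>\<^bsub>A\<^esub>"
  using twisting_function_degen_0[OF twisting bar_nerve[of "[]"]] phi_1[of "\<one>\<^bsub>G\<^esub>"]
  by (simp add: degen_bar bar_degen_def nerve_one_def)

lemma \<chi>_one_left: "g \<in> carrier G \<Longrightarrow> \<chi> \<one>\<^bsub>G\<^esub> g = \<one>\<^bsub>\<Gamma>\<^esub>"
  using twisting_function_degen_0[OF twisting bar_nerve[of "[g]"]]
  by (simp add: degen_bar bar_degen_def nerve_one_def \<chi>_def numeral_2_eq_2)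

lemma \<chi>_one_right:
  assumes "g \<in> carrier G"
  shows "\<chi> g \<one>\<^bsub>G\<^esub> = \<one>\<^bsub>\<Gamma>\<^esub>"
proof -
  have "degen (group_cat G) 1 (bar [g]) = bar [g, \<one>\<^bsub>G\<^esub>]"
    by (simp add: degen_bar bar_degen_def)
  moreover have "\<phi> 2 (degen (group_cat G) 1 (bar [g])) = degen M 0 ([a g], [])"
    using twisting_function_degen[OF twisting bar_nerve[of "[g]"], of 1] phi_1[of g] assms
    by (simp add: numeral_2_eq_2)
  ultimately show ?thesis by (simp add: \<chi>_def degen_def)
qed

text \<open>Let f1, f2 be the edges and b2 the last vertex of \<open>\<phi>\<^sub>3\<close> at
  [g|h|k]. The faces \<open>d\<^sub>3\<close>, \<open>d\<^sub>2\<close>, \<open>d\<^sub>1\<close>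
  give f1 = \<chi>(g,h), f1 f2 = \<chi>(g,hk) and \<chi>(gh,k) = f2 b2(\<chi>(h,k)). Eliminating f2
  leaves the identity up to the order of two factors.\<close>

lemma \<chi>_cocycle:
  assumes g: "g \<in> carrier G" and h: "h \<in> carrier G" and k: "k \<in> carrier G"
  shows "act (a g) (\<chi> h k) \<otimes>\<^bsub>\<Gamma>\<^esub> \<chi> g (h \<otimes>\<^bsub>G\<^esub> k) = \<chi> g h \<otimes>\<^bsub>\<Gamma>\<^esub> \<chi> (g \<otimes>\<^bsub>G\<^esub> h) k"
proof -
  have x: "bar [g, h, k] \<in> nerve (group_cat G) 3"
    using bar_nerve[of "[g, h, k]"] g h k by (simp add: numeral_3_eq_3)
  have "\<phi> 3 (bar [g, h, k]) \<in> nerve M 2"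
    using twisting_function_nerve[OF twisting x] by simp
  then obtain b0 b1 b2 f1 f2 where p: "\<phi> 3 (bar [g, h, k]) = ([b0, b1, b2], [f1, f2])"
    and f: "f1 \<in> Mor M b1 b0" "f2 \<in> Mor M b2 b1"
    by (auto simp: nerve_def length_Suc_conv numeral_2_eq_2 All_less_Suc)
  obtain b where gh: "\<phi> 2 (bar [g, h]) = ([a g, b], [\<chi> g h])"
    using phi_2[OF g h] by metis
  obtain b' where ghk: "\<phi> 2 (bar [g, h \<otimes>\<^bsub>G\<^esub> k]) = ([a g, b'], [\<chi> g (h \<otimes>\<^bsub>G\<^esub> k)])"
    "a g = c (\<chi> g (h \<otimes>\<^bsub>G\<^esub> k)) \<otimes>\<^bsub>A\<^esub> b'" "b' \<in> carrier A"
    using phi_2[of g "h \<otimes>\<^bsub>G\<^esub> k"] g h k by (metis G.m_closed)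
  obtain b'' where hk: "\<phi> 2 (bar [h, k]) = ([a h, b''], [\<chi> h k])"
    using phi_2[OF h k] by metis
  obtain b3 where gh_k: "\<phi> 2 (bar [g \<otimes>\<^bsub>G\<^esub> h, k]) = ([a (g \<otimes>\<^bsub>G\<^esub> h), b3], [\<chi> (g \<otimes>\<^bsub>G\<^esub> h) k])"
    using phi_2[of "g \<otimes>\<^bsub>G\<^esub> h" k] g h k by (metis G.m_closed)
  have "\<phi> 2 (bar [g, h]) = face M 2 (\<phi> 3 (bar [g, h, k]))"
    using twisting_function_face[OF twisting x, of 3] by (simp add: face_bar bar_face_def)
  then have f1: "f1 = \<chi> g h" by (simp add: gh p face_def)
  have "\<phi> 2 (bar [g, h \<otimes>\<^bsub>G\<^esub> k]) = face M 1 (\<phi> 3 (bar [g, h, k]))"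
    using twisting_function_face[OF twisting x, of 2] by (simp add: face_bar bar_face_def)
  then have f12: "f1 \<otimes>\<^bsub>\<Gamma>\<^esub> f2 = \<chi> g (h \<otimes>\<^bsub>G\<^esub> k)" "b' = b2"
    by (simp_all add: ghk p face_def)
  have "\<phi> 2 (bar [g \<otimes>\<^bsub>G\<^esub> h, k]) = nerve_mult M (face M 0 (\<phi> 3 (bar [g, h, k]))) (\<phi> 2 (bar [h, k]))"
    using twisting_function_face_1[OF twisting x] by (simp add: face_bar bar_face_def)
  then have "\<chi> (g \<otimes>\<^bsub>G\<^esub> h) k = f2 \<otimes>\<^bsub>\<Gamma>\<^esub> act b2 (\<chi> h k)"
    by (simp add: gh_k hk p face_def nerve_mult_def)
  then have "\<chi> g h \<otimes>\<^bsub>\<Gamma>\<^esub> \<chi> (g \<otimes>\<^bsub>G\<^esub> h) k = \<chi> g (h \<otimes>\<^bsub>G\<^esub> k) \<otimes>\<^bsub>\<Gamma>\<^esub> act b2 (\<chi> h k)"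
    using f g h k by (simp add: Mor_M_iff f1 Gam.m_assoc flip: f12(1))
  \<comment> \<open>The Peiffer identity moves \<chi>(g,hk) to the right at the cost of acting by
    its image under \<open>c\<close>, which combines with b2 to \<open>a g\<close>.\<close>
  also have "\<dots> = act (c (\<chi> g (h \<otimes>\<^bsub>G\<^esub> k))) (act b2 (\<chi> h k)) \<otimes>\<^bsub>\<Gamma>\<^esub> \<chi> g (h \<otimes>\<^bsub>G\<^esub> k)"
    using g h k ghk f12 by (simp add: peiffer Gam.m_assoc)
  also have "act (c (\<chi> g (h \<otimes>\<^bsub>G\<^esub> k))) (act b2 (\<chi> h k)) = act (a g) (\<chi> h k)"
    using g h k ghk f12 by (simp add: act_mult)
  finally show ?thesis by simp
qed

text \<open>The product of \<open>a g\<close> and \<open>a h\<close> differs from \<open>a\<close>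
  of the product by \<open>c (\<chi> g h)\<close>, which acts as conjugation by
  \<open>\<chi> g h\<close>.\<close>

lemma act_a_mult:
  assumes "g \<in> carrier G" "h \<in> carrier G" "z \<in> carrier \<Gamma>"
  shows "act (a g) (act (a h) z) \<otimes>\<^bsub>\<Gamma>\<^esub> \<chi> g h = \<chi> g h \<otimes>\<^bsub>\<Gamma>\<^esub> act (a (g \<otimes>\<^bsub>G\<^esub> h)) z"
proof -
  have "act (a g) (act (a h) z) = act (c (\<chi> g h)) (act (a (g \<otimes>\<^bsub>G\<^esub> h)) z)"
    using assms by (simp add: a_mult flip: act_mult)
  then show ?thesis using assms by (simp add: peiffer Gam.m_assoc)
qed

text \<open>The pair (x, g) stands for x t(g). The product comes from moving t(g) past y, which
  applies \<open>a g\<close> to y, and from replacing t(g) t(h) by \<chi>(g,h) t(gh).\<close>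

definition E :: "('m \<times> 'g) monoid" where
  "E = \<lparr>carrier = carrier \<Gamma> \<times> carrier G,
     mult = (\<lambda>(x, g) (y, h). (x \<otimes>\<^bsub>\<Gamma>\<^esub> act (a g) y \<otimes>\<^bsub>\<Gamma>\<^esub> \<chi> g h, g \<otimes>\<^bsub>G\<^esub> h)),
     one = (\<one>\<^bsub>\<Gamma>\<^esub>, \<one>\<^bsub>G\<^esub>)\<rparr>"

lemma E_simps [simp]:
  "carrier E = carrier \<Gamma> \<times> carrier G" "\<one>\<^bsub>E\<^esub> = (\<one>\<^bsub>\<Gamma>\<^esub>, \<one>\<^bsub>G\<^esub>)"
  "(x, g) \<otimes>\<^bsub>E\<^esub> (y, h) = (x \<otimes>\<^bsub>\<Gamma>\<^esub> act (a g) y \<otimes>\<^bsub>\<Gamma>\<^esub> \<chi> g h, g \<otimes>\<^bsub>G\<^esub> h)"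
  by (simp_all add: E_def)

text \<open>After expansion the sides differ in the part that contains z: \<open>act_a_mult\<close>
  moves z to the left there, and the cocycle identity rewrites the two remaining values of
  \<open>\<chi>\<close>.\<close>

lemma E_assoc:
  assumes "x \<in> carrier \<Gamma>" "y \<in> carrier \<Gamma>" "z \<in> carrier \<Gamma>"
    "g \<in> carrier G" "h \<in> carrier G" "k \<in> carrier G"
  shows "(x, g) \<otimes>\<^bsub>E\<^esub> (y, h) \<otimes>\<^bsub>E\<^esub> (z, k) = (x, g) \<otimes>\<^bsub>E\<^esub> ((y, h) \<otimes>\<^bsub>E\<^esub> (z, k))"
proof -
  have "\<chi> g h \<otimes>\<^bsub>\<Gamma>\<^esub> (act (a (g \<otimes>\<^bsub>G\<^esub> h)) z \<otimes>\<^bsub>\<Gamma>\<^esub> \<chi> (g \<otimes>\<^bsub>G\<^esub> h) k) =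
      act (a g) (act (a h) z) \<otimes>\<^bsub>\<Gamma>\<^esub> \<chi> g h \<otimes>\<^bsub>\<Gamma>\<^esub> \<chi> (g \<otimes>\<^bsub>G\<^esub> h) k"
    using assms by (simp add: act_a_mult Gam.m_assoc)
  also have "\<dots> = act (a g) (act (a h) z) \<otimes>\<^bsub>\<Gamma>\<^esub> (act (a g) (\<chi> h k) \<otimes>\<^bsub>\<Gamma>\<^esub> \<chi> g (h \<otimes>\<^bsub>G\<^esub> k))"
    using assms by (simp add: \<chi>_cocycle Gam.m_assoc)
  finally show ?thesis
    using assms by (simp add: act_dist Gam.m_assoc G.m_assoc)
qed

lemma group_E: "group E"
proof (rule groupI)
  fix u assume "u \<in> carrier E"
  then obtain x g where u: "u = (x, g)" "x \<in> carrier \<Gamma>" "g \<in> carrier G" by auto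
  \<comment> \<open>Chosen so that the first component of (y, g^-1) times (x, g) is 1.\<close>
  define y where "y = inv\<^bsub>\<Gamma>\<^esub> (act (a (inv\<^bsub>G\<^esub> g)) x \<otimes>\<^bsub>\<Gamma>\<^esub> \<chi> (inv\<^bsub>G\<^esub> g) g)"
  have "y \<in> carrier \<Gamma>" using u by (simp add: y_def)
  moreover have "y \<otimes>\<^bsub>\<Gamma>\<^esub> act (a (inv\<^bsub>G\<^esub> g)) x \<otimes>\<^bsub>\<Gamma>\<^esub> \<chi> (inv\<^bsub>G\<^esub> g) g = \<one>\<^bsub>\<Gamma>\<^esub>"
    using u \<open>y \<in> carrier \<Gamma>\<close> by (simp add: Gam.m_assoc) (simp add: y_def)
  ultimately show "\<exists>v\<in>carrier E. v \<otimes>\<^bsub>E\<^esub> u = \<one>\<^bsub>E\<^esub>"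
    using u by (intro bexI[of _ "(y, inv\<^bsub>G\<^esub> g)"]) auto
next
  show "u \<otimes>\<^bsub>E\<^esub> v \<otimes>\<^bsub>E\<^esub> w = u \<otimes>\<^bsub>E\<^esub> (v \<otimes>\<^bsub>E\<^esub> w)"
    if "u \<in> carrier E" "v \<in> carrier E" "w \<in> carrier E" for u v w
    using that E_assoc[of "fst u" "fst v" "fst w" "snd u" "snd v" "snd w"]
    by (auto simp del: E_simps(3))
qed (auto simp: a_one act_one \<chi>_one_left)

definition e :: "'m \<Rightarrow> 'm \<times> 'g" where "e x = (x, \<one>\<^bsub>G\<^esub>)"

text \<open>Forced by the factorisation of (x, g) as \<open>e x\<close> times \<open>t g\<close>,
  with \<open>c\<close> prescribed on \<Gamma> and \<open>a\<close> on the section.\<close>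

definition \<tau> :: "'m \<times> 'g \<Rightarrow> 'f" where "\<tau> = (\<lambda>(x, g). c x \<otimes>\<^bsub>A\<^esub> a g)"

definition t :: "'g \<Rightarrow> 'm \<times> 'g" where "t g = (\<one>\<^bsub>\<Gamma>\<^esub>, g)"

text \<open>\<open>a_mult\<close> splits the last two factors into \<open>a g\<close> and
  \<open>a h\<close>; equivariance then carries \<open>a g\<close> past the image of y.\<close>

lemma \<tau>_mult_E:
  assumes "x \<in> carrier \<Gamma>" "y \<in> carrier \<Gamma>" "g \<in> carrier G" "h \<in> carrier G"
  shows "\<tau> ((x, g) \<otimes>\<^bsub>E\<^esub> (y, h)) = \<tau> (x, g) \<otimes>\<^bsub>A\<^esub> \<tau> (y, h)"
proof -
  have "\<tau> ((x, g) \<otimes>\<^bsub>E\<^esub> (y, h)) = c x \<otimes>\<^bsub>A\<^esub> c (act (a g) y) \<otimes>\<^bsub>A\<^esub> (c (\<chi> g h) \<otimes>\<^bsub>A\<^esub> a (g \<otimes>\<^bsub>G\<^esub> h))"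
    using assms by (simp add: \<tau>_def c_mult Aut.m_assoc)
  also have "\<dots> = c x \<otimes>\<^bsub>A\<^esub> (c (act (a g) y) \<otimes>\<^bsub>A\<^esub> a g) \<otimes>\<^bsub>A\<^esub> a h"
    using assms by (simp add: Aut.m_assoc flip: a_mult)
  also have "\<dots> = \<tau> (x, g) \<otimes>\<^bsub>A\<^esub> \<tau> (y, h)"
    using assms by (simp add: equivariant \<tau>_def Aut.m_assoc)
  finally show ?thesis .
qed

text \<open>Checked after multiplication by (x, g) from the right, which avoids an explicit inverse
  in \<open>E\<close>. In that form it is the Peiffer identity for x.\<close>

lemma e_act_E:
  assumes "x \<in> carrier \<Gamma>" "g \<in> carrier G" "y \<in> carrier \<Gamma>"
  shows "e (act (\<tau> (x, g)) y) = (x, g) \<otimes>\<^bsub>E\<^esub> e y \<otimes>\<^bsub>E\<^esub> inv\<^bsub>E\<^esub> (x, g)"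
proof -
  interpret E: group E by (rule group_E)
  have "e (act (\<tau> (x, g)) y) \<otimes>\<^bsub>E\<^esub> (x, g) = (x, g) \<otimes>\<^bsub>E\<^esub> e y"
    using assms by (simp add: e_def \<tau>_def act_mult peiffer a_one act_one \<chi>_one_left \<chi>_one_right Gam.m_assoc)
  moreover have "(x, g) \<in> carrier E" "e y \<in> carrier E" "e (act (\<tau> (x, g)) y) \<in> carrier E"
    using assms by (auto simp: e_def \<tau>_def)
  ultimately show ?thesis
    by (intro E.inv_solve_right[THEN iffD2]) (auto simp del: E_simps)
qed

lemma crossed_module_extension: "crossed_module_extension \<Gamma> A c act E G e snd \<tau> t"
proof -
  interpret E: group E by (rule group_E)
  show ?thesis
  proof unfold_locales
    show "e \<in> mon \<Gamma> E"
      by (auto simp: mon_def hom_def inj_on_def e_def a_one act_one \<chi>_one_left)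
    show "snd \<in> hom E G"
      by (auto simp: hom_def)
    show "kernel E G snd = e ` carrier \<Gamma>"
      by (auto simp: kernel_def e_def)
    show "\<tau> \<in> hom E A"
      using \<tau>_mult_E by (auto simp: hom_def \<tau>_def simp del: E_simps(3))
    show "\<tau> (e x) = c x" if "x \<in> carrier \<Gamma>" for x
      using that by (simp add: \<tau>_def e_def a_one)
    show "e (act (\<tau> u) x) = u \<otimes>\<^bsub>E\<^esub> e x \<otimes>\<^bsub>E\<^esub> inv\<^bsub>E\<^esub> u" if "u \<in> carrier E" "x \<in> carrier \<Gamma>" for u x
      using that e_act_E by (cases u) simp
  qed (auto simp: t_def)
qed

text \<open>The extension was built to return \<open>a\<close> and \<open>\<chi>\<close> in degrees
  1 and 2, and a twisting function has no freedom beyond these degrees.\<close>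

lemma twist_eq: "crossed_module_extension.twist \<Gamma> E G e \<tau> t = \<phi>"
proof -
  interpret ext: crossed_module_extension \<Gamma> A c act E G e snd \<tau> t
    by (rule crossed_module_extension)
  show ?thesis
  proof (rule twisting_function_unique[OF G.is_group ext.twisting_function_twist twisting])
    show "ext.twist 1 (bar [g]) = \<phi> 1 (bar [g])" if "g \<in> carrier G" for g
      using that ext.twist_1[OF that] phi_1[OF that] by (simp add: \<tau>_def t_def c_one)
    fix g h assume gh: "g \<in> carrier G" "h \<in> carrier G"
    have "ext.twist 2 (bar [g, h]) \<in> nerve M 1"
      using twisting_function_nerve[OF ext.twisting_function_twist bar_nerve[of "[g, h]"]] gh
      by (simp add: numeral_2_eq_2)
    \<comment> \<open>Membership in \<Gamma> lets the identities in the product with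
      \<open>t\<close> be simplified away, so that first components can be compared.\<close>
    then have "hd (snd (ext.twist 2 (bar [g, h]))) \<in> carrier \<Gamma>"
      by (auto simp: nerve_def length_Suc_conv Mor_M_iff)
    with ext.e_twist_2[OF gh] gh
    show "hd (snd (ext.twist 2 (bar [g, h]))) = hd (snd (\<phi> 2 (bar [g, h])))"
      by (simp add: t_def e_def a_one act_one act_one_right \<chi>_one_left flip: \<chi>_def)
  qed
qed

end

section \<open>Categories and their endofunctors\<close>

lemma inverse_morD:
  assumes "inverse_mor C X Y f g"
  shows "g \<in> Mor C Y X" "cmp C X Y X g f = idm C X" "cmp C Y X Y f g = idm C Y"
  using assms by (simp_all add: inverse_mor_def)

locale category_locale =
  fixes C :: "('o, 'm, 'z) cat_scheme"
  assumes category: "category C"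
begin

lemma Mor_Obj: "f \<in> Mor C X Y \<Longrightarrow> X \<in> Obj C" "f \<in> Mor C X Y \<Longrightarrow> Y \<in> Obj C"
  using category unfolding category_def by blast+

lemma idm_closed [simp]: "X \<in> Obj C \<Longrightarrow> idm C X \<in> Mor C X X"
  using category unfolding category_def by blast

lemma cmp_closed [simp]: "\<lbrakk>f \<in> Mor C X Y; g \<in> Mor C Y Z\<rbrakk> \<Longrightarrow> cmp C X Y Z g f \<in> Mor C X Z"
  using category unfolding category_def by blast

lemma cmp_idm [simp]:
  "f \<in> Mor C X Y \<Longrightarrow> cmp C X X Y f (idm C X) = f"
  "f \<in> Mor C X Y \<Longrightarrow> cmp C X Y Y (idm C Y) f = f"
  using category unfolding category_def by blast+

lemma cmp_assoc: "\<lbrakk>f \<in> Mor C W X; g \<in> Mor C X Y; h \<in> Mor C Y Z\<rbrakk> \<Longrightarrow>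
    cmp C W X Z (cmp C X Y Z h g) f = cmp C W Y Z h (cmp C W X Y g f)"
  using category unfolding category_def by blast

text \<open>The second law has the form in which a commutative square is solved for its unknown
  side.\<close>

lemma inverse_mor_cancel:
  assumes "f \<in> Mor C X Y" "inverse_mor C X Y f g"
  shows "h \<in> Mor C W X \<Longrightarrow> cmp C W Y X g (cmp C W X Y f h) = h"
    and "\<lbrakk>k \<in> Mor C Y Z; cmp C X Y Z k f = l\<rbrakk> \<Longrightarrow> cmp C Y X Z l g = k"
proof -
  note g = inverse_morD[OF assms(2)]
  show "cmp C W Y X g (cmp C W X Y f h) = h" if "h \<in> Mor C W X"
    using assms g that by (simp flip: cmp_assoc)
  show "cmp C Y X Z l g = k" if "k \<in> Mor C Y Z" "cmp C X Y Z k f = l"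
    using assms g that by (auto simp: cmp_assoc)
qed

lemma inverse_mor_sym: "\<lbrakk>f \<in> Mor C X Y; inverse_mor C X Y f g\<rbrakk> \<Longrightarrow> inverse_mor C Y X g f"
  by (simp add: inverse_mor_def)

lemma inv_mor_eqI:
  assumes "f \<in> Mor C X Y" "inverse_mor C X Y f g"
  shows "inv_mor C X Y f = g"
  unfolding inv_mor_def
proof (rule the_equality[where P = "inverse_mor C X Y f", OF assms(2)])
  fix g' assume "inverse_mor C X Y f g'"
  note g' = inverse_morD[OF this] and g = inverse_morD[OF assms(2)]
  have "g' = cmp C Y X X (cmp C X Y X g f) g'" using g g' by simp
  also have "\<dots> = g" unfolding cmp_assoc[OF g'(1) assms(1) g(1)] using g g' by simp
  finally show "g' = g" .
qed

lemma group_aut_group: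
  assumes "X \<in> Obj C"
  shows "group (aut_group C X)"
proof (rule groupI)
  fix f assume "f \<in> carrier (aut_group C X)"
  then obtain g where f: "f \<in> Mor C X X" "inverse_mor C X X f g"
    by (auto simp: aut_group_def Iso_def)
  then have "inverse_mor C X X g f" by (rule inverse_mor_sym)
  then show "\<exists>g\<in>carrier (aut_group C X). g \<otimes>\<^bsub>aut_group C X\<^esub> f = \<one>\<^bsub>aut_group C X\<^esub>"
    using inverse_morD[OF f(2)] by (auto simp: aut_group_def Iso_def)
next
  show "\<one>\<^bsub>aut_group C X\<^esub> \<in> carrier (aut_group C X)"
    using assms by (auto simp: aut_group_def Iso_def inverse_mor_def intro!: exI[of _ "idm C X"])
next
  fix f f' assume "f \<in> carrier (aut_group C X)" "f' \<in> carrier (aut_group C X)"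
  then obtain g g' where *: "f \<in> Mor C X X" "inverse_mor C X X f g" "f' \<in> Mor C X X" "inverse_mor C X X f' g'"
    by (auto simp: aut_group_def Iso_def)
  note g = inverse_morD[OF *(2)] inverse_morD[OF *(4)]
  have "cmp C X X X f (cmp C X X X f' (cmp C X X X g' g)) = idm C X"
    using inverse_mor_cancel(1)[OF g(4) inverse_mor_sym[OF *(3,4)] g(1)] g by simp
  moreover have "cmp C X X X g' (cmp C X X X g (cmp C X X X f f')) = idm C X"
    using inverse_mor_cancel(1)[OF *(1,2,3)] g by simp
  ultimately have "inverse_mor C X X (cmp C X X X f f') (cmp C X X X g' g)"
    using * g by (simp add: inverse_mor_def cmp_assoc)
  then show "f \<otimes>\<^bsub>aut_group C X\<^esub> f' \<in> carrier (aut_group C X)"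
    using * by (auto simp: aut_group_def Iso_def)
qed (auto simp: aut_group_def Iso_def cmp_assoc)

end

text \<open>Kept general in source and target because it serves both the projection from L to F and
  the automorphisms of L.\<close>

lemma functor_inverse_mor:
  assumes \<Phi>: "is_functor C D \<Phi>" and XY: "X \<in> Obj C" "Y \<in> Obj C" and f: "f \<in> Mor C X Y"
    and inv: "inverse_mor C X Y f g"
  shows "inverse_mor D (fob \<Phi> X) (fob \<Phi> Y) (fmor \<Phi> X Y f) (fmor \<Phi> Y X g)"
proof -
  note g = inverse_morD[OF inv]
  have "cmp D (fob \<Phi> X) (fob \<Phi> Y) (fob \<Phi> X) (fmor \<Phi> Y X g) (fmor \<Phi> X Y f) = fmor \<Phi> X X (idm C X)"
    "cmp D (fob \<Phi> Y) (fob \<Phi> X) (fob \<Phi> Y) (fmor \<Phi> X Y f) (fmor \<Phi> Y X g) = fmor \<Phi> Y Y (idm C Y)"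
    "fmor \<Phi> Y X g \<in> Mor D (fob \<Phi> Y) (fob \<Phi> X)"
    using \<Phi> XY f g unfolding is_functor_def by metis+
  then show ?thesis
    using \<Phi> XY by (simp add: inverse_mor_def is_functor_def)
qed

context category_locale begin

lemma end_functorsD:
  assumes "\<Phi> \<in> carrier (end_functors C)"
  shows "is_functor C C \<Phi>"
    and fob_closed: "X \<in> Obj C \<Longrightarrow> fob \<Phi> X \<in> Obj C"
    and fmor_closed: "f \<in> Mor C X Y \<Longrightarrow> fmor \<Phi> X Y f \<in> Mor C (fob \<Phi> X) (fob \<Phi> Y)"
    and fmor_idm: "X \<in> Obj C \<Longrightarrow> fmor \<Phi> X X (idm C X) = idm C (fob \<Phi> X)"
    and fmor_cmp: "\<lbrakk>f \<in> Mor C X Y; g \<in> Mor C Y Z\<rbrakk> \<Longrightarrow>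
      fmor \<Phi> X Z (cmp C X Y Z g f) =
      cmp C (fob \<Phi> X) (fob \<Phi> Y) (fob \<Phi> Z) (fmor \<Phi> Y Z g) (fmor \<Phi> X Y f)"
proof -
  show *: "is_functor C C \<Phi>" using assms by (simp add: end_functors_def)
  show "X \<in> Obj C \<Longrightarrow> fob \<Phi> X \<in> Obj C"
    "X \<in> Obj C \<Longrightarrow> fmor \<Phi> X X (idm C X) = idm C (fob \<Phi> X)"
    using * unfolding is_functor_def by blast+
  show "f \<in> Mor C X Y \<Longrightarrow> fmor \<Phi> X Y f \<in> Mor C (fob \<Phi> X) (fob \<Phi> Y)"
    using * Mor_Obj[of f X Y] unfolding is_functor_def by blast
  show "\<lbrakk>f \<in> Mor C X Y; g \<in> Mor C Y Z\<rbrakk> \<Longrightarrow>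
      fmor \<Phi> X Z (cmp C X Y Z g f) =
      cmp C (fob \<Phi> X) (fob \<Phi> Y) (fob \<Phi> Z) (fmor \<Phi> Y Z g) (fmor \<Phi> X Y f)"
    using * Mor_Obj[of f X Y] Mor_Obj[of g Y Z] unfolding is_functor_def by blast
qed

lemma end_functorsI:
  assumes "\<And>X. X \<in> Obj C \<Longrightarrow> fob \<Phi> X \<in> Obj C"
    and "\<And>X Y f. f \<in> Mor C X Y \<Longrightarrow> fmor \<Phi> X Y f \<in> Mor C (fob \<Phi> X) (fob \<Phi> Y)"
    and "\<And>X. X \<in> Obj C \<Longrightarrow> fmor \<Phi> X X (idm C X) = idm C (fob \<Phi> X)"
    and "\<And>X Y Z f g. \<lbrakk>f \<in> Mor C X Y; g \<in> Mor C Y Z\<rbrakk> \<Longrightarrow>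
      fmor \<Phi> X Z (cmp C X Y Z g f) =
      cmp C (fob \<Phi> X) (fob \<Phi> Y) (fob \<Phi> Z) (fmor \<Phi> Y Z g) (fmor \<Phi> X Y f)"
    and "fob \<Phi> \<in> extensional (Obj C)" "\<And>X Y. fmor \<Phi> X Y \<in> extensional (Mor C X Y)"
  shows "\<Phi> \<in> carrier (end_functors C)"
  using assms by (simp add: end_functors_def is_functor_def)

lemma end_functors_eqI:
  assumes "\<Phi> \<in> carrier (end_functors C)" "\<Psi> \<in> carrier (end_functors C)"
    and ob: "\<And>X. X \<in> Obj C \<Longrightarrow> fob \<Phi> X = fob \<Psi> X"
    and mor: "\<And>X Y f. f \<in> Mor C X Y \<Longrightarrow> fmor \<Phi> X Y f = fmor \<Psi> X Y f"
  shows "\<Phi> = \<Psi>"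
proof -
  have "fob \<Phi> = fob \<Psi>"
    using assms by (intro extensionalityI[of _ "Obj C"]) (auto simp: end_functors_def)
  moreover have "fmor \<Phi> X Y = fmor \<Psi> X Y" for X Y
    using assms by (intro extensionalityI[of _ "Mor C X Y"]) (auto simp: end_functors_def)
  ultimately show ?thesis by (cases \<Phi>; cases \<Psi>) (auto simp: fun_eq_iff)
qed

lemma end_functors_mult:
  "X \<in> Obj C \<Longrightarrow> fob (\<Phi> \<otimes>\<^bsub>end_functors C\<^esub> \<Psi>) X = fob \<Phi> (fob \<Psi> X)"
  "f \<in> Mor C X Y \<Longrightarrow> fmor (\<Phi> \<otimes>\<^bsub>end_functors C\<^esub> \<Psi>) X Y f = fmor \<Phi> (fob \<Psi> X) (fob \<Psi> Y) (fmor \<Psi> X Y f)"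
  by (simp_all add: end_functors_def compose_def)

lemma end_functors_one:
  "X \<in> Obj C \<Longrightarrow> fob \<one>\<^bsub>end_functors C\<^esub> X = X"
  "f \<in> Mor C X Y \<Longrightarrow> fmor \<one>\<^bsub>end_functors C\<^esub> X Y f = f"
  by (simp_all add: end_functors_def)

lemma end_functors_mult_closed:
  assumes "\<Phi> \<in> carrier (end_functors C)" "\<Psi> \<in> carrier (end_functors C)"
  shows "\<Phi> \<otimes>\<^bsub>end_functors C\<^esub> \<Psi> \<in> carrier (end_functors C)"
proof (rule end_functorsI)
  show "fob (\<Phi> \<otimes>\<^bsub>end_functors C\<^esub> \<Psi>) \<in> extensional (Obj C)"
    "fmor (\<Phi> \<otimes>\<^bsub>end_functors C\<^esub> \<Psi>) X Y \<in> extensional (Mor C X Y)" for X Y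
    by (simp_all add: end_functors_def compose_extensional)
next
  fix X Y f assume f: "f \<in> Mor C X Y"
  then show "fmor (\<Phi> \<otimes>\<^bsub>end_functors C\<^esub> \<Psi>) X Y f \<in>
      Mor C (fob (\<Phi> \<otimes>\<^bsub>end_functors C\<^esub> \<Psi>) X) (fob (\<Phi> \<otimes>\<^bsub>end_functors C\<^esub> \<Psi>) Y)"
    using assms Mor_Obj[OF f] by (simp add: end_functors_mult fmor_closed)
next
  fix X Y Z f g assume fg: "f \<in> Mor C X Y" "g \<in> Mor C Y Z"
  then show "fmor (\<Phi> \<otimes>\<^bsub>end_functors C\<^esub> \<Psi>) X Z (cmp C X Y Z g f) =
      cmp C (fob (\<Phi> \<otimes>\<^bsub>end_functors C\<^esub> \<Psi>) X) (fob (\<Phi> \<otimes>\<^bsub>end_functors C\<^esub> \<Psi>) Y)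
        (fob (\<Phi> \<otimes>\<^bsub>end_functors C\<^esub> \<Psi>) Z) (fmor (\<Phi> \<otimes>\<^bsub>end_functors C\<^esub> \<Psi>) Y Z g)
        (fmor (\<Phi> \<otimes>\<^bsub>end_functors C\<^esub> \<Psi>) X Y f)"
    using assms Mor_Obj[of f X Y] Mor_Obj[of g Y Z]
    by (simp add: end_functors_mult fmor_closed fmor_cmp)
qed (use assms in \<open>auto simp: end_functors_mult fob_closed fmor_idm\<close>)

lemma monoid_end_functors: "monoid (end_functors C)"
proof (rule monoidI)
  show one: "\<one>\<^bsub>end_functors C\<^esub> \<in> carrier (end_functors C)"
  proof (rule end_functorsI)
    show "fob \<one>\<^bsub>end_functors C\<^esub> \<in> extensional (Obj C)"
      "fmor \<one>\<^bsub>end_functors C\<^esub> X Y \<in> extensional (Mor C X Y)" for X Y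
      by (simp_all add: end_functors_def)
  next
    fix X Y f assume "f \<in> Mor C X Y"
    then show "fmor \<one>\<^bsub>end_functors C\<^esub> X Y f \<in> Mor C (fob \<one>\<^bsub>end_functors C\<^esub> X) (fob \<one>\<^bsub>end_functors C\<^esub> Y)"
      using Mor_Obj[of f X Y] by (simp add: end_functors_one)
  next
    fix X Y Z f g assume "f \<in> Mor C X Y" "g \<in> Mor C Y Z"
    then show "fmor \<one>\<^bsub>end_functors C\<^esub> X Z (cmp C X Y Z g f) =
        cmp C (fob \<one>\<^bsub>end_functors C\<^esub> X) (fob \<one>\<^bsub>end_functors C\<^esub> Y) (fob \<one>\<^bsub>end_functors C\<^esub> Z)
          (fmor \<one>\<^bsub>end_functors C\<^esub> Y Z g) (fmor \<one>\<^bsub>end_functors C\<^esub> X Y f)"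
      using Mor_Obj[of f X Y] Mor_Obj[of g Y Z] by (simp add: end_functors_one)
  qed (simp_all add: end_functors_one)
  fix \<Phi> \<Psi> \<Theta>
  assume *: "\<Phi> \<in> carrier (end_functors C)"
  show "\<one>\<^bsub>end_functors C\<^esub> \<otimes>\<^bsub>end_functors C\<^esub> \<Phi> = \<Phi>"
    using * by (intro end_functors_eqI end_functors_mult_closed one)
      (simp_all add: end_functors_mult end_functors_one fob_closed fmor_closed)
  show "\<Phi> \<otimes>\<^bsub>end_functors C\<^esub> \<one>\<^bsub>end_functors C\<^esub> = \<Phi>"
  proof (intro end_functors_eqI end_functors_mult_closed one *)
    show "fmor (\<Phi> \<otimes>\<^bsub>end_functors C\<^esub> \<one>\<^bsub>end_functors C\<^esub>) X Y f = fmor \<Phi> X Y f"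
      if "f \<in> Mor C X Y" for X Y f
      using * that Mor_Obj[of f X Y] by (simp add: end_functors_mult end_functors_one)
  qed (simp_all add: end_functors_mult end_functors_one)
  assume **: "\<Psi> \<in> carrier (end_functors C)" "\<Theta> \<in> carrier (end_functors C)"
  show "\<Phi> \<otimes>\<^bsub>end_functors C\<^esub> \<Psi> \<otimes>\<^bsub>end_functors C\<^esub> \<Theta> = \<Phi> \<otimes>\<^bsub>end_functors C\<^esub> (\<Psi> \<otimes>\<^bsub>end_functors C\<^esub> \<Theta>)"
  proof (intro end_functors_eqI end_functors_mult_closed * **)
    show "fmor (\<Phi> \<otimes>\<^bsub>end_functors C\<^esub> \<Psi> \<otimes>\<^bsub>end_functors C\<^esub> \<Theta>) X Y f =
        fmor (\<Phi> \<otimes>\<^bsub>end_functors C\<^esub> (\<Psi> \<otimes>\<^bsub>end_functors C\<^esub> \<Theta>)) X Y f" if "f \<in> Mor C X Y" for X Y f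
      using * ** that Mor_Obj[of f X Y] by (simp add: end_functors_mult fob_closed fmor_closed)
  qed (use * ** in \<open>simp_all add: end_functors_mult fob_closed\<close>)
qed (rule end_functors_mult_closed)

end

section \<open>Restrictions in linking systems\<close>

text \<open>\<open>S_Obj\<close> is obtained from an element of \<Gamma> wherever this context is
  entered.\<close>

locale linking_setting =
  fixes p :: nat and S :: "('a, 'z) monoid_scheme" and F :: "('a set, 'a \<Rightarrow> 'a) cat" and L :: "('a, 'm) linking"
  assumes triple: "linking_triple p S F L"
    and S_Obj: "carrier S \<in> Obj L"
begin

sublocale S: group S
  using triple unfolding linking_triple_def discrete_p_toral_def by (elim conjE)

lemma fusion: "fusion_system S F"
  using triple unfolding linking_triple_def by (elim conjE)

lemma Obj_L_closed:
  shows Obj_L: "Obj L \<subseteq> Obj F" "P \<in> Obj L \<Longrightarrow> conjugates F P \<subseteq> Obj L"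
    and linking: "linking_system p S F (Obj L) L"
proof -
  obtain H where H: "H \<subseteq> Obj F" "\<forall>P\<in>H. conjugates F P \<subseteq> H" "linking_system p S F H L"
    using triple unfolding linking_triple_def by (elim conjE exE) blast
  \<comment> \<open>The set H of the existential is recovered as the object set of L, so no choice
    of H has to be carried along.\<close>
  moreover have "Obj L = H" using H(3) unfolding linking_system_def by (elim conjE)
  ultimately show "Obj L \<subseteq> Obj F" "P \<in> Obj L \<Longrightarrow> conjugates F P \<subseteq> Obj L"
    "linking_system p S F (Obj L) L"
    by simp_all
qed

sublocale F: category_locale F
  using fusion unfolding fusion_system_def by unfold_locales (elim conjE)

sublocale L: category_locale L
  using linking unfolding linking_system_def by unfold_locales (elim conjE)

lemma dlt_functor: "is_functor (transporter_cat S (Obj L)) L \<lparr>fob = (\<lambda>P. P), fmor = dlt L\<rparr>"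
  using linking unfolding linking_system_def by (elim conjE)

lemma prj_functor: "is_functor L F \<lparr>fob = (\<lambda>P. P), fmor = prj L\<rparr>"
  using linking unfolding linking_system_def by (elim conjE)

lemma Obj_F: "P \<in> Obj F \<longleftrightarrow> subgroup P S"
  using fusion by (simp add: fusion_system_def)

lemma Obj_L_subset: "P \<in> Obj L \<Longrightarrow> P \<subseteq> carrier S"
  using Obj_L(1) Obj_F subgroup.subset by blast

lemma Mor_F:
  assumes "f \<in> Mor F P Q"
  shows "f \<in> P \<rightarrow> Q" "f \<in> extensional P" "inj_on f P" 
proof -
  have "f \<in> Inj S P Q"
    using fusion assms F.Mor_Obj[OF assms] unfolding fusion_system_def by blast
  then show "f \<in> P \<rightarrow> Q" "f \<in> extensional P" "inj_on f P"
    by (auto simp: Inj_def mon_def hom_def)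
qed

lemma idm_F: "P \<in> Obj F \<Longrightarrow> idm F P = (\<lambda>x\<in>P. x)"
  using fusion unfolding fusion_system_def by blast

lemma cmp_F: "\<lbrakk>f \<in> Mor F P Q; g \<in> Mor F Q R\<rbrakk> \<Longrightarrow> cmp F P Q R g f = compose P g f"
  using fusion unfolding fusion_system_def by blast

text \<open>Invertibility in the category \<open>F\<close> becomes surjectivity once the composite
  is read as a composition of functions.\<close>

lemma Iso_F_image:
  assumes "f \<in> Mor F P Q" "inverse_mor F P Q f g"
  shows "f ` P = Q"
proof -
  note g = inverse_morD[OF assms(2)]
  have "compose Q f g = (\<lambda>y\<in>Q. y)"
    using g(3) cmp_F[OF g(1) assms(1)] idm_F F.Mor_Obj[OF assms(1)] by simp
  then have "f (g y) = y" "g y \<in> P" if "y \<in> Q" for y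
    using that Mor_F(1)[OF g(1)] by (auto simp: compose_def dest: fun_cong[of _ _ y])
  then show ?thesis using Mor_F[OF assms(1)] by (force simp: image_iff)
qed

abbreviation \<iota> :: "'a set \<Rightarrow> 'a set \<Rightarrow> 'm" where "\<iota> \<equiv> incl S L"

lemma prj_closed [simp]:
  assumes "\<psi> \<in> Mor L P Q"
  shows "prj L P Q \<psi> \<in> Mor F P Q"
  using prj_functor assms L.Mor_Obj[OF assms] by (simp add: is_functor_def)

lemma prj_idm: "P \<in> Obj L \<Longrightarrow> prj L P P (idm L P) = (\<lambda>x\<in>P. x)"
  using Obj_L(1) prj_functor by (auto simp: is_functor_def idm_F)

lemma prj_cmp:
  assumes "\<psi> \<in> Mor L P Q" "\<chi> \<in> Mor L Q R"
  shows "prj L P R (cmp L P Q R \<chi> \<psi>) = compose P (prj L Q R \<chi>) (prj L P Q \<psi>)"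
proof -
  have "prj L P R (cmp L P Q R \<chi> \<psi>) = cmp F P Q R (prj L Q R \<chi>) (prj L P Q \<psi>)"
    using prj_functor assms L.Mor_Obj[OF assms(1)] L.Mor_Obj[OF assms(2)]
    by (simp add: is_functor_def)
  then show ?thesis using assms by (simp add: cmp_F)
qed

lemma dlt_closed:
  assumes "P \<in> Obj L" "Q \<in> Obj L" "g \<in> transporter S P Q"
  shows "dlt L P Q g \<in> Mor L P Q"
  using dlt_functor assms by (simp add: is_functor_def transporter_cat_def)

lemma dlt_cmp:
  assumes "P \<in> Obj L" "Q \<in> Obj L" "R \<in> Obj L" "g \<in> transporter S P Q" "h \<in> transporter S Q R"
  shows "cmp L P Q R (dlt L Q R h) (dlt L P Q g) = dlt L P R (h \<otimes>\<^bsub>S\<^esub> g)"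
  using dlt_functor assms by (simp add: is_functor_def transporter_cat_def)

lemma dlt_one: "P \<in> Obj L \<Longrightarrow> dlt L P P \<one>\<^bsub>S\<^esub> = idm L P"
  using dlt_functor by (simp add: is_functor_def transporter_cat_def)

lemma prj_dlt: "\<lbrakk>P \<in> Obj L; Q \<in> Obj L; g \<in> transporter S P Q\<rbrakk> \<Longrightarrow> prj L P Q (dlt L P Q g) = conj_on S P g"
  using linking unfolding linking_system_def by (elim conjE) simp

lemma dlt_commute: "\<lbrakk>\<psi> \<in> Mor L P Q; g \<in> P\<rbrakk> \<Longrightarrow>
    cmp L P P Q \<psi> (dlt L P P g) = cmp L P Q Q (dlt L Q Q (prj L P Q \<psi> g)) \<psi>"
  using linking L.Mor_Obj[of \<psi> P Q] unfolding linking_system_def by (elim conjE) simp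

lemma conj_on_one: "P \<in> Obj L \<Longrightarrow> conj_on S P \<one>\<^bsub>S\<^esub> = (\<lambda>x\<in>P. x)"
  using Obj_L_subset[of P] by (auto simp: conj_on_def subset_eq intro!: restrict_ext)

lemma one_transporter: "\<lbrakk>P \<in> Obj L; P \<subseteq> Q\<rbrakk> \<Longrightarrow> \<one>\<^bsub>S\<^esub> \<in> transporter S P Q"
  by (auto simp: transporter_def conj_on_one)

lemma centralizer_transporter:
  assumes "P \<in> Obj L" "g \<in> centralizer S P"
  shows "g \<in> transporter S P P" "conj_on S P g = (\<lambda>x\<in>P. x)"
proof -
  have "g \<otimes>\<^bsub>S\<^esub> x \<otimes>\<^bsub>S\<^esub> inv\<^bsub>S\<^esub> g = x" if "x \<in> P" for x
    using assms Obj_L_subset[OF assms(1)] that by (auto simp: centralizer_def S.m_assoc subset_eq)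
  then show *: "conj_on S P g = (\<lambda>x\<in>P. x)"
    by (auto simp: conj_on_def)
  show "g \<in> transporter S P P"
    using assms(2) * by (simp add: transporter_def centralizer_def)
qed

lemma self_transporter:
  assumes "P \<in> Obj L" "g \<in> P"
  shows "g \<in> transporter S P P"
proof -
  have "subgroup P S" using assms(1) Obj_L(1) Obj_F by auto
  then show ?thesis
    using assms(2) by (auto simp: transporter_def conj_on_def subgroup.m_closed subgroup.m_inv_closed subgroup.mem_carrier)
qed

lemma incl_closed [simp]: "\<lbrakk>P \<in> Obj L; Q \<in> Obj L; P \<subseteq> Q\<rbrakk> \<Longrightarrow> \<iota> P Q \<in> Mor L P Q"
  by (simp add: incl_def dlt_closed one_transporter)

lemma prj_incl: "\<lbrakk>P \<in> Obj L; Q \<in> Obj L; P \<subseteq> Q\<rbrakk> \<Longrightarrow> prj L P Q (\<iota> P Q) = (\<lambda>x\<in>P. x)"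
  by (simp add: incl_def prj_dlt one_transporter conj_on_one)

lemma incl_cmp: "\<lbrakk>P \<in> Obj L; Q \<in> Obj L; R \<in> Obj L; P \<subseteq> Q; Q \<subseteq> R\<rbrakk> \<Longrightarrow>
    cmp L P Q R (\<iota> Q R) (\<iota> P Q) = \<iota> P R"
  by (simp add: incl_def dlt_cmp one_transporter)

lemma incl_refl: "P \<in> Obj L \<Longrightarrow> \<iota> P P = idm L P"
  by (simp add: incl_def dlt_one)

lemma axiom_A:
  assumes "fully_centralized p S F P" "P \<in> Obj L" "Q \<in> Obj L"
  shows axiom_A_free: "\<lbrakk>\<psi> \<in> Mor L P Q; g \<in> centralizer S P; cmp L P P Q \<psi> (dlt L P P g) = \<psi>\<rbrakk> \<Longrightarrow> g = \<one>\<^bsub>S\<^esub>"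
    and axiom_A_onto: "f \<in> Mor F P Q \<Longrightarrow> \<exists>\<psi>\<in>Mor L P Q. prj L P Q \<psi> = f"
    and axiom_A_orbit: "\<lbrakk>\<psi> \<in> Mor L P Q; \<psi>' \<in> Mor L P Q; prj L P Q \<psi> = prj L P Q \<psi>'\<rbrakk> \<Longrightarrow>
      \<exists>g\<in>centralizer S P. \<psi>' = cmp L P P Q \<psi> (dlt L P P g)"
proof -
  have *: "(\<forall>\<psi>\<in>Mor L P Q. \<forall>g\<in>centralizer S P. cmp L P P Q \<psi> (dlt L P P g) = \<psi> \<longrightarrow> g = \<one>\<^bsub>S\<^esub>) \<and>
        prj L P Q ` Mor L P Q = Mor F P Q \<and>
        (\<forall>\<psi>\<in>Mor L P Q. \<forall>\<psi>'\<in>Mor L P Q.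
           prj L P Q \<psi> = prj L P Q \<psi>' \<longleftrightarrow>
           (\<exists>g\<in>centralizer S P. \<psi>' = cmp L P P Q \<psi> (dlt L P P g)))"
    using linking assms unfolding linking_system_def by (elim conjE) simp
  show "g = \<one>\<^bsub>S\<^esub>" if "\<psi> \<in> Mor L P Q" "g \<in> centralizer S P" "cmp L P P Q \<psi> (dlt L P P g) = \<psi>"
    using * that by simp
  show "\<exists>\<psi>\<in>Mor L P Q. prj L P Q \<psi> = f" if "f \<in> Mor F P Q"
    using * that by (metis imageE)
  show "\<exists>g\<in>centralizer S P. \<psi>' = cmp L P P Q \<psi> (dlt L P P g)"
    if "\<psi> \<in> Mor L P Q" "\<psi>' \<in> Mor L P Q" "prj L P Q \<psi> = prj L P Q \<psi>'"
    using conjunct2[OF conjunct2[OF *], THEN bspec, OF that(1), THEN bspec, OF that(2)] that(3) by (rule iffD1)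
qed

lemma fully_centralized_iso:
  assumes "P \<in> Obj L"
  obtains Q \<theta> \<theta>' where "Q \<in> Obj L" "fully_centralized p S F Q" "\<theta> \<in> Mor L P Q" "inverse_mor L P Q \<theta> \<theta>'"
proof -
  have "\<forall>P\<in>Obj L. \<exists>Q\<in>Obj L. Iso L P Q \<noteq> {} \<and> fully_centralized p S F Q"
    using linking unfolding linking_system_def by (elim conjE)
  then obtain Q \<theta> where "Q \<in> Obj L" "\<theta> \<in> Iso L P Q" "fully_centralized p S F Q"
    using assms by blast
  then show ?thesis using that by (auto simp: Iso_def)
qed

text \<open>The centralizer acts freely only when the source is fully centralized; the general case is
  transported along an \<open>L\<close>-isomorphism from such an object.\<close>

lemma lift_unique:
  assumes \<phi>: "\<phi> \<in> Mor L P Q" and \<psi>: "\<psi> \<in> Mor L P Q" and \<chi>: "\<chi> \<in> Mor L Q R"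
    and eq: "cmp L P Q R \<chi> \<phi> = cmp L P Q R \<chi> \<psi>" and prj: "prj L P Q \<phi> = prj L P Q \<psi>"
  shows "\<phi> = \<psi>"
proof -
  have *: "\<phi> = \<psi>" if P: "fully_centralized p S F P" and \<phi>: "\<phi> \<in> Mor L P Q" and \<psi>: "\<psi> \<in> Mor L P Q"
    and eq: "cmp L P Q R \<chi> \<phi> = cmp L P Q R \<chi> \<psi>" and prj: "prj L P Q \<phi> = prj L P Q \<psi>" for P \<phi> \<psi>
  proof -
    note ob = L.Mor_Obj[OF \<phi>] L.Mor_Obj[OF \<chi>]
    obtain g where g: "g \<in> centralizer S P" "\<psi> = cmp L P P Q \<phi> (dlt L P P g)"
      using axiom_A_orbit[OF P ob(1,2) \<phi> \<psi> prj] by blast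
    have "dlt L P P g \<in> Mor L P P"
      using ob centralizer_transporter(1)[OF ob(1) g(1)] by (simp add: dlt_closed)
    \<comment> \<open>Freeness is used on morphisms to R: g fixes the composite of \<chi> and
      \<phi>, although its effect on \<phi> is not known yet.\<close>
    then have "cmp L P P R (cmp L P Q R \<chi> \<phi>) (dlt L P P g) = cmp L P Q R \<chi> (cmp L P P Q \<phi> (dlt L P P g))"
      using \<phi> \<chi> by (simp add: L.cmp_assoc)
    also have "\<dots> = cmp L P Q R \<chi> \<phi>" using eq g(2) by simp
    finally have "g = \<one>\<^bsub>S\<^esub>"
      using axiom_A_free[OF P ob(1,4)] \<phi> \<chi> g(1) by (metis L.cmp_closed)
    then show ?thesis using g(2) \<phi> ob(1) by (simp add: dlt_one)
  qed
  obtain P' \<theta> \<theta>' where \<theta>: "fully_centralized p S F P'" "\<theta> \<in> Mor L P P'" "inverse_mor L P P' \<theta> \<theta>'"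
    using fully_centralized_iso L.Mor_Obj[OF \<phi>] by metis
  note \<theta>' = inverse_morD[OF \<theta>(3)]
  \<comment> \<open>Precomposition with \<open>\<theta>'\<close> moves the source to the fully
    centralized P', and precomposition with \<open>\<theta>\<close> moves the result back.\<close>
  have "cmp L P' P Q \<phi> \<theta>' = cmp L P' P Q \<psi> \<theta>'"
  proof (rule *[OF \<theta>(1)])
    show "cmp L P' P Q \<phi> \<theta>' \<in> Mor L P' Q" "cmp L P' P Q \<psi> \<theta>' \<in> Mor L P' Q"
      using \<theta>'(1) \<phi> \<psi> by simp_all
    show "cmp L P' Q R \<chi> (cmp L P' P Q \<phi> \<theta>') = cmp L P' Q R \<chi> (cmp L P' P Q \<psi> \<theta>')"
      using L.cmp_assoc[OF \<theta>'(1) \<phi> \<chi>] L.cmp_assoc[OF \<theta>'(1) \<psi> \<chi>] eq by simp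
    show "prj L P' Q (cmp L P' P Q \<phi> \<theta>') = prj L P' Q (cmp L P' P Q \<psi> \<theta>')"
      using \<theta>'(1) \<phi> \<psi> prj by (simp add: prj_cmp)
  qed
  then show ?thesis
    by (metis L.cmp_assoc L.cmp_idm(1) \<phi> \<psi> \<theta>(2) \<theta>'(1,2))
qed

text \<open>For a fully centralized source, any lift of f composed with \<chi> has the projection of
  \<psi>, so the two differ by an element of the centralizer. Precomposing the lift with that
  element corrects it without changing its projection.\<close>

lemma lift_exists:
  assumes \<psi>: "\<psi> \<in> Mor L P R" and \<chi>: "\<chi> \<in> Mor L Q R" and f: "f \<in> Mor F P Q"
    and prj: "prj L P R \<psi> = compose P (prj L Q R \<chi>) f"
  shows "\<exists>\<psi>'\<in>Mor L P Q. prj L P Q \<psi>' = f \<and> cmp L P Q R \<chi> \<psi>' = \<psi>"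
proof -
  have *: "\<exists>\<psi>'\<in>Mor L P Q. prj L P Q \<psi>' = f \<and> cmp L P Q R \<chi> \<psi>' = \<psi>"
    if P: "fully_centralized p S F P" and \<psi>: "\<psi> \<in> Mor L P R" and f: "f \<in> Mor F P Q"
    and prj: "prj L P R \<psi> = compose P (prj L Q R \<chi>) f" for P \<psi> f
  proof -
    note ob = L.Mor_Obj[OF \<psi>] L.Mor_Obj[OF \<chi>]
    obtain \<psi>0 where \<psi>0: "\<psi>0 \<in> Mor L P Q" "prj L P Q \<psi>0 = f"
      using axiom_A_onto[OF P ob(1,3) f] by blast
    have "prj L P R (cmp L P Q R \<chi> \<psi>0) = prj L P R \<psi>"
      using \<psi>0 \<chi> prj by (simp add: prj_cmp)
    then obtain g where g: "g \<in> centralizer S P" "\<psi> = cmp L P P R (cmp L P Q R \<chi> \<psi>0) (dlt L P P g)"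
      using axiom_A_orbit[OF P ob(1,2) L.cmp_closed[OF \<psi>0(1) \<chi>] \<psi>] by blast
    note gt = centralizer_transporter[OF ob(1) g(1)]
    have d: "dlt L P P g \<in> Mor L P P"
      using ob gt by (simp add: dlt_closed)
    have "prj L P Q (cmp L P P Q \<psi>0 (dlt L P P g)) = compose P f (\<lambda>x\<in>P. x)"
      using \<psi>0 d ob gt by (simp add: prj_cmp prj_dlt)
    also have "\<dots> = f" using Mor_F(2)[OF f] by (auto simp: compose_def extensional_def)
    finally show ?thesis using g \<psi>0 \<chi> d
      by (intro bexI[of _ "cmp L P P Q \<psi>0 (dlt L P P g)"]) (simp_all add: L.cmp_assoc)
  qed
  obtain P' \<theta> \<theta>' where \<theta>: "fully_centralized p S F P'" "\<theta> \<in> Mor L P P'" "inverse_mor L P P' \<theta> \<theta>'"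
    using fully_centralized_iso L.Mor_Obj[OF \<psi>] by metis
  note \<theta>' = inverse_morD[OF \<theta>(3)]
  have f': "compose P' f (prj L P' P \<theta>') \<in> Mor F P' Q"
    using F.cmp_closed[OF prj_closed[OF \<theta>'(1)] f] cmp_F[OF prj_closed[OF \<theta>'(1)] f] by simp
  have "prj L P' R (cmp L P' P R \<psi> \<theta>') = compose P' (prj L Q R \<chi>) (compose P' f (prj L P' P \<theta>'))"
    using \<psi> \<theta>'(1) Mor_F(1)[OF prj_closed[OF \<theta>'(1)]]
    by (auto simp: prj_cmp prj compose_def Pi_iff intro!: restrict_ext)
  then obtain \<psi>' where \<psi>': "\<psi>' \<in> Mor L P' Q" "prj L P' Q \<psi>' = compose P' f (prj L P' P \<theta>')"
    "cmp L P' Q R \<chi> \<psi>' = cmp L P' P R \<psi> \<theta>'"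
    using *[OF \<theta>(1) L.cmp_closed[OF \<theta>'(1) \<psi>] f'] by blast
  have \<psi>\<theta>: "cmp L P Q R \<chi> (cmp L P P' Q \<psi>' \<theta>) = \<psi>"
    using L.cmp_assoc[OF \<theta>(2) \<psi>'(1) \<chi>] L.cmp_assoc[OF \<theta>(2) \<theta>'(1) \<psi>] \<psi>'(3) \<theta>'(2) \<psi> by simp
  \<comment> \<open>The projection of \<open>\<theta>'\<close> undoes that of
    \<open>\<theta>\<close>, so moving back along \<open>\<theta>\<close> restores f itself.\<close>
  have "compose P (prj L P' P \<theta>') (prj L P P' \<theta>) = (\<lambda>x\<in>P. x)"
    using prj_cmp[OF \<theta>(2) \<theta>'(1)] \<theta>'(2) prj_idm L.Mor_Obj[OF \<psi>] by simp
  then have "prj L P' P \<theta>' (prj L P P' \<theta> x) = x" if "x \<in> P" for x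
    using that by (auto simp: compose_def dest: fun_cong[of _ _ x])
  then have "compose P (compose P' f (prj L P' P \<theta>')) (prj L P P' \<theta>) = f"
    using Mor_F[OF prj_closed[OF \<theta>(2)]] Mor_F(2)[OF f]
    by (intro extensionalityI[of _ P]) (auto simp: compose_def)
  then have "prj L P Q (cmp L P P' Q \<psi>' \<theta>) = f"
    using \<psi>' \<theta>(2) by (simp add: prj_cmp)
  then show ?thesis
    by (intro bexI[of _ "cmp L P P' Q \<psi>' \<theta>"] conjI \<psi>\<theta> L.cmp_closed[OF \<theta>(2) \<psi>'(1)])
qed

text \<open>An inclusion does not change the function underlying a projection, so the hypothesis
  already gives equal projections and \<open>lift_unique\<close> applies.\<close>

lemma incl_monic:
  assumes \<phi>: "\<phi> \<in> Mor L P Q" and \<psi>: "\<psi> \<in> Mor L P Q" and R: "R \<in> Obj L" "Q \<subseteq> R"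
    and eq: "cmp L P Q R (\<iota> Q R) \<phi> = cmp L P Q R (\<iota> Q R) \<psi>"
  shows "\<phi> = \<psi>"
proof (rule lift_unique[OF \<phi> \<psi> incl_closed eq])
  have *: "compose P (\<lambda>x\<in>Q. x) (prj L P Q \<phi>) = prj L P Q \<phi>" if \<phi>: "\<phi> \<in> Mor L P Q" for \<phi>
    using Mor_F[OF prj_closed[OF \<phi>]] by (intro extensionalityI[of _ P]) (auto simp: compose_def)
  have "prj L P R (cmp L P Q R (\<iota> Q R) \<phi>) = prj L P Q \<phi>" if \<phi>: "\<phi> \<in> Mor L P Q" for \<phi>
    using R L.Mor_Obj[OF \<phi>] *[OF \<phi>] \<phi> by (simp add: prj_cmp prj_incl)
  then show "prj L P Q \<phi> = prj L P Q \<psi>" using eq \<phi> \<psi> by metis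
qed (use R L.Mor_Obj[OF \<phi>] in auto)

section \<open>Images and restrictions of endomorphisms of S\<close>

abbreviation T :: "'a set" where "T \<equiv> carrier S"

definition im :: "'m \<Rightarrow> 'a set \<Rightarrow> 'a set" where "im \<gamma> P = prj L T T \<gamma> ` P"

definition r :: "'m \<Rightarrow> 'a set \<Rightarrow> 'm" where "r \<gamma> P = restr S L T T P (im \<gamma> P) \<gamma>"

lemma restrict_prj:
  assumes "\<gamma> \<in> Mor L T T" "P \<in> Obj L"
  shows "prj L P T (cmp L P T T \<gamma> (\<iota> P T)) = restrict (prj L T T \<gamma>) P"
  using assms S_Obj Obj_L_subset[OF assms(2)] by (auto simp: prj_cmp prj_incl compose_def)

text \<open>In \<open>F\<close> the restricted map factors as an isomorphism onto some R followed by
  an inclusion. This R is the image and is conjugate to P, and the objects of L are closed under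
  conjugacy.\<close>

lemma im_closed:
  assumes "\<gamma> \<in> Mor L T T" "P \<in> Obj L"
  shows "im \<gamma> P \<in> Obj L" "restrict (prj L T T \<gamma>) P \<in> Mor F P (im \<gamma> P)"
proof -
  define f where "f = restrict (prj L T T \<gamma>) P"
  have "cmp L P T T \<gamma> (\<iota> P T) \<in> Mor L P T"
    using assms S_Obj Obj_L_subset[OF assms(2)] by auto
  then have f: "f \<in> Mor F P T"
    using restrict_prj[OF assms] prj_closed unfolding f_def by fastforce
  then obtain R f' where R: "R \<in> Obj F" "R \<subseteq> T" "f' \<in> Iso F P R" "f = cmp F P R T (\<lambda>x\<in>R. x) f'"
    using fusion f unfolding fusion_system_def by blast
  obtain g where f': "f' \<in> Mor F P R" "inverse_mor F P R f' g"
    using R(3) by (auto simp: Iso_def)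
  \<comment> \<open>The inclusion of R is conjugation by 1, hence a morphism of \<open>F\<close>;
    only for morphisms of \<open>F\<close> is \<open>cmp F\<close> known to be the composition of
    functions.\<close>
  have "\<one>\<^bsub>S\<^esub> \<in> transporter S R T" "conj_on S R \<one>\<^bsub>S\<^esub> = (\<lambda>x\<in>R. x)"
    using R(2) by (auto simp: transporter_def conj_on_def subset_eq)
  then have "(\<lambda>x\<in>R. x) \<in> Hom_S S R T" unfolding Hom_S_def by (metis image_eqI)
  then have "(\<lambda>x\<in>R. x) \<in> Mor F R T"
    using fusion R(1) F.Mor_Obj[OF f] unfolding fusion_system_def by blast
  then have "f = compose P (\<lambda>x\<in>R. x) f'" using R(4) f'(1) by (simp add: cmp_F)
  also have "\<dots> = f'"
    using Mor_F[OF f'(1)] by (intro extensionalityI[of _ P]) (auto simp: compose_def)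
  finally have ff': "f = f'" .
  then have "R = f ` P" using Iso_F_image[OF f'] by simp
  then have "R = im \<gamma> P" by (simp add: f_def im_def)
  then show "restrict (prj L T T \<gamma>) P \<in> Mor F P (im \<gamma> P)"
    using f'(1) ff' unfolding f_def by simp
  have "R \<in> conjugates F P" using R by (auto simp: conjugates_def)
  then show "im \<gamma> P \<in> Obj L" using Obj_L(2)[OF assms(2)] \<open>R = im \<gamma> P\<close> by blast
qed

lemma im_subset: "\<lbrakk>\<gamma> \<in> Mor L T T; P \<in> Obj L\<rbrakk> \<Longrightarrow> im \<gamma> P \<subseteq> T"
  using im_closed Obj_L_subset by blast

text \<open>\<open>lift_exists\<close> for the inclusion of the image yields a restriction and
  \<open>incl_monic\<close> makes it unique, so the \<open>THE\<close> in \<open>restr\<close> is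
  well defined.\<close>

lemma restr_props:
  assumes \<gamma>: "\<gamma> \<in> Mor L T T" and P: "P \<in> Obj L"
  shows r_closed: "r \<gamma> P \<in> Mor L P (im \<gamma> P)"
    and r_incl: "cmp L P (im \<gamma> P) T (\<iota> (im \<gamma> P) T) (r \<gamma> P) = cmp L P T T \<gamma> (\<iota> P T)"
    and r_unique: "\<lbrakk>\<psi> \<in> Mor L P (im \<gamma> P);
      cmp L P (im \<gamma> P) T (\<iota> (im \<gamma> P) T) \<psi> = cmp L P T T \<gamma> (\<iota> P T)\<rbrakk> \<Longrightarrow> r \<gamma> P = \<psi>"
proof -
  note sub = im_subset[OF assms] Obj_L_subset[OF P]
  have incl: "cmp L P T T \<gamma> (\<iota> P T) \<in> Mor L P T" "\<iota> (im \<gamma> P) T \<in> Mor L (im \<gamma> P) T"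
    using assms S_Obj sub im_closed[OF assms] by auto
  have "prj L P T (cmp L P T T \<gamma> (\<iota> P T)) =
      compose P (prj L (im \<gamma> P) T (\<iota> (im \<gamma> P) T)) (restrict (prj L T T \<gamma>) P)"
    using sub im_closed[OF assms] S_Obj
    by (auto simp: restrict_prj[OF assms] prj_incl compose_def im_def)
  then obtain \<psi>' where \<psi>': "\<psi>' \<in> Mor L P (im \<gamma> P)"
      "cmp L P (im \<gamma> P) T (\<iota> (im \<gamma> P) T) \<psi>' = cmp L P T T \<gamma> (\<iota> P T)"
    using lift_exists[OF incl im_closed(2)[OF assms]] by blast
  have uniq: "\<psi> = \<psi>'" if "\<psi> \<in> Mor L P (im \<gamma> P)"
      "cmp L P (im \<gamma> P) T (\<iota> (im \<gamma> P) T) \<psi> = cmp L P T T \<gamma> (\<iota> P T)" for \<psi>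
    using incl_monic[OF that(1) \<psi>'(1) S_Obj sub(1)] \<psi>'(2) that(2) by simp
  have r: "r \<gamma> P = \<psi>'"
    unfolding r_def restr_def
  proof (rule the_equality)
    fix \<psi> assume "\<psi> \<in> Mor L P (im \<gamma> P) \<and>
      cmp L P T T \<gamma> (\<iota> P T) = cmp L P (im \<gamma> P) T (\<iota> (im \<gamma> P) T) \<psi>"
    then show "\<psi> = \<psi>'" by (intro uniq) (elim conjE, assumption, elim conjE, erule sym)
  qed (intro conjI \<psi>' sym[OF \<psi>'(2)])
  show "r \<gamma> P \<in> Mor L P (im \<gamma> P)"
    "cmp L P (im \<gamma> P) T (\<iota> (im \<gamma> P) T) (r \<gamma> P) = cmp L P T T \<gamma> (\<iota> P T)"
    unfolding r by (fact \<psi>')+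
  show "r \<gamma> P = \<psi>" if "\<psi> \<in> Mor L P (im \<gamma> P)"
    "cmp L P (im \<gamma> P) T (\<iota> (im \<gamma> P) T) \<psi> = cmp L P T T \<gamma> (\<iota> P T)"
    unfolding r by (rule sym[OF uniq[OF that]])
qed

lemma prj_r:
  assumes \<gamma>: "\<gamma> \<in> Mor L T T" and P: "P \<in> Obj L" and x: "x \<in> P"
  shows "prj L P (im \<gamma> P) (r \<gamma> P) x = prj L T T \<gamma> x"
proof -
  note sub = im_subset[OF assms(1,2)] Obj_L_subset[OF P]
  have "prj L P T (cmp L P (im \<gamma> P) T (\<iota> (im \<gamma> P) T) (r \<gamma> P)) x = prj L P (im \<gamma> P) (r \<gamma> P) x"
    using assms S_Obj sub im_closed(1)[OF \<gamma> P] Mor_F(1)[OF prj_closed[OF r_closed[OF \<gamma> P]]]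
    by (auto simp: prj_cmp prj_incl compose_def r_closed)
  then show ?thesis using x by (simp add: r_incl[OF \<gamma> P] restrict_prj[OF \<gamma> P])
qed

lemma im_cmp:
  assumes "\<gamma> \<in> Mor L T T" "\<gamma>' \<in> Mor L T T" "P \<in> Obj L"
  shows "im (cmp L T T T \<gamma> \<gamma>') P = im \<gamma> (im \<gamma>' P)"
  using assms Obj_L_subset[OF assms(3)] by (force simp: im_def prj_cmp compose_def image_image)

lemma im_idm: "P \<in> Obj L \<Longrightarrow> im (idm L T) P = P"
  using Obj_L_subset[of P] S_Obj by (force simp: im_def prj_idm)

text \<open>Two restriction squares side by side form a restriction square for the composite, and
  such a square is unique.\<close>

lemma r_cmp:
  assumes \<gamma>: "\<gamma> \<in> Mor L T T" and \<gamma>': "\<gamma>' \<in> Mor L T T" and P: "P \<in> Obj L"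
  shows "r (cmp L T T T \<gamma> \<gamma>') P = cmp L P (im \<gamma>' P) (im \<gamma> (im \<gamma>' P)) (r \<gamma> (im \<gamma>' P)) (r \<gamma>' P)"
proof -
  define P1 where "P1 = im \<gamma>' P"
  define P2 where "P2 = im \<gamma> P1"
  have P1: "P1 \<in> Obj L" using im_closed(1)[OF \<gamma>' P] by (simp add: P1_def)
  have P2: "P2 \<in> Obj L" using im_closed(1)[OF \<gamma> P1] by (simp add: P2_def)
  have sub: "P \<subseteq> T" "P1 \<subseteq> T" "P2 \<subseteq> T" using P P1 P2 Obj_L_subset by auto
  have r': "r \<gamma>' P \<in> Mor L P P1" "cmp L P P1 T (\<iota> P1 T) (r \<gamma>' P) = cmp L P T T \<gamma>' (\<iota> P T)"
    using r_closed[OF \<gamma>' P] r_incl[OF \<gamma>' P] by (simp_all add: P1_def)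
  have r1: "r \<gamma> P1 \<in> Mor L P1 P2" "cmp L P1 P2 T (\<iota> P2 T) (r \<gamma> P1) = cmp L P1 T T \<gamma> (\<iota> P1 T)"
    using r_closed[OF \<gamma> P1] r_incl[OF \<gamma> P1] by (simp_all add: P2_def)
  have i: "\<iota> P T \<in> Mor L P T" "\<iota> P1 T \<in> Mor L P1 T" "\<iota> P2 T \<in> Mor L P2 T"
    using sub P P1 P2 S_Obj by auto
  have im2: "im (cmp L T T T \<gamma> \<gamma>') P = P2"
    using im_cmp[OF \<gamma> \<gamma>' P] by (simp add: P1_def P2_def)
  have "cmp L P P2 T (\<iota> P2 T) (cmp L P P1 P2 (r \<gamma> P1) (r \<gamma>' P)) =
      cmp L P P1 T (cmp L P1 P2 T (\<iota> P2 T) (r \<gamma> P1)) (r \<gamma>' P)"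
    by (rule L.cmp_assoc[OF r'(1) r1(1) i(3), symmetric])
  also have "\<dots> = cmp L P T T \<gamma> (cmp L P P1 T (\<iota> P1 T) (r \<gamma>' P))"
    unfolding r1(2) using r'(1) i(2) \<gamma> by (simp add: L.cmp_assoc)
  also have "\<dots> = cmp L P T T (cmp L T T T \<gamma> \<gamma>') (\<iota> P T)"
    unfolding r'(2) using i(1) \<gamma> \<gamma>' by (simp add: L.cmp_assoc)
  finally have "r (cmp L T T T \<gamma> \<gamma>') P = cmp L P P1 P2 (r \<gamma> P1) (r \<gamma>' P)"
    using r' r1 \<gamma> \<gamma>' P by (intro r_unique) (simp_all add: im2)
  then show ?thesis by (simp only: P1_def P2_def)
qed

lemma r_idm: "P \<in> Obj L \<Longrightarrow> r (idm L T) P = idm L P"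
  using S_Obj Obj_L_subset[of P] by (intro r_unique) (simp_all add: im_idm)

end

section \<open>The crossed module of a linking system\<close>

context linking_setting begin

lemma Gam_simps [simp]:
  "x \<otimes>\<^bsub>Gam S L\<^esub> y = cmp L T T T x y" "\<one>\<^bsub>Gam S L\<^esub> = idm L T"
  by (simp_all add: Gam_def aut_group_def)

sublocale Gam: group "Gam S L"
  unfolding Gam_def by (rule L.group_aut_group[OF S_Obj])

lemma Gam_Mor: "\<gamma> \<in> carrier (Gam S L) \<Longrightarrow> \<gamma> \<in> Mor L T T"
  by (auto simp: Gam_def aut_group_def Iso_def)

lemma Gam_I: "\<lbrakk>\<gamma> \<in> Mor L T T; inverse_mor L T T \<gamma> \<gamma>'\<rbrakk> \<Longrightarrow> \<gamma> \<in> carrier (Gam S L)"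
  by (auto simp: Gam_def aut_group_def Iso_def)

lemma Gam_inverse_mor: "\<gamma> \<in> carrier (Gam S L) \<Longrightarrow> inverse_mor L T T \<gamma> (inv\<^bsub>Gam S L\<^esub> \<gamma>)"
  using Gam.l_inv[of \<gamma>] Gam.r_inv[of \<gamma>] Gam_Mor[OF Gam.inv_closed[of \<gamma>]]
  by (simp add: inverse_mor_def)

lemma im_inverse:
  assumes "\<gamma> \<in> carrier (Gam S L)" "P \<in> Obj L"
  shows "im (inv\<^bsub>Gam S L\<^esub> \<gamma>) (im \<gamma> P) = P"
  using im_cmp[OF Gam_Mor[OF Gam.inv_closed[OF assms(1)]] Gam_Mor[OF assms(1)] assms(2)]
    inverse_morD(2)[OF Gam_inverse_mor[OF assms(1)]] im_idm[OF assms(2)]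
  by simp

text \<open>Restriction respects composition and identities, so it takes inverses to
  inverses.\<close>

lemma r_inverse:
  assumes \<gamma>: "\<gamma> \<in> carrier (Gam S L)" and P: "P \<in> Obj L"
  shows "inverse_mor L P (im \<gamma> P) (r \<gamma> P) (r (inv\<^bsub>Gam S L\<^esub> \<gamma>) (im \<gamma> P))"
proof -
  define \<gamma>' where "\<gamma>' = inv\<^bsub>Gam S L\<^esub> \<gamma>"
  have \<gamma>'[simp]: "\<gamma>' \<in> carrier (Gam S L)" by (simp add: \<gamma>'_def \<gamma>)
  note mor = Gam_Mor[OF \<gamma>] Gam_Mor[OF \<gamma>']
  note inv = inverse_morD[OF Gam_inverse_mor[OF \<gamma>], folded \<gamma>'_def]
  have im': "im \<gamma>' (im \<gamma> P) = P" using im_inverse[OF \<gamma> P] by (simp add: \<gamma>'_def)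
  have P': "im \<gamma> P \<in> Obj L" using im_closed(1)[OF mor(1) P] .
  have "r \<gamma>' (im \<gamma> P) \<in> Mor L (im \<gamma> P) P"
    using r_closed[OF mor(2) P'] im' by simp
  moreover have "cmp L P (im \<gamma> P) P (r \<gamma>' (im \<gamma> P)) (r \<gamma> P) = idm L P"
    using r_cmp[OF mor(2,1) P] inv(2) r_idm[OF P] im' by simp
  moreover have "cmp L (im \<gamma> P) P (im \<gamma> P) (r \<gamma> P) (r \<gamma>' (im \<gamma> P)) = idm L (im \<gamma> P)"
    using r_cmp[OF mor(1,2) P'] inv(3) r_idm[OF P'] im' by simp
  ultimately show ?thesis by (simp add: inverse_mor_def \<gamma>'_def)
qed

abbreviation cf :: "'m \<Rightarrow> ('a set, 'm, 'a set, 'm) fctor" where "cf \<equiv> conj_functor S L"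

lemma fob_cf: "P \<in> Obj L \<Longrightarrow> fob (cf \<gamma>) P = im \<gamma> P"
  by (simp add: conj_functor_def Let_def im_def)

text \<open>The value at \<phi> is the only morphism completing the square formed by \<phi> and the
  restrictions of \<gamma>. Later identities for these functors are proved by exhibiting such a
  square instead of computing with \<open>inv_mor\<close>.\<close>

lemma cf_props:
  assumes \<gamma>: "\<gamma> \<in> carrier (Gam S L)" and \<phi>: "\<phi> \<in> Mor L P Q"
  shows fmor_cf_closed: "fmor (cf \<gamma>) P Q \<phi> \<in> Mor L (im \<gamma> P) (im \<gamma> Q)"
    and fmor_cf_r: "cmp L P (im \<gamma> P) (im \<gamma> Q) (fmor (cf \<gamma>) P Q \<phi>) (r \<gamma> P) = cmp L P Q (im \<gamma> Q) (r \<gamma> Q) \<phi>"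
    and fmor_cf_unique: "\<lbrakk>\<psi> \<in> Mor L (im \<gamma> P) (im \<gamma> Q);
      cmp L P (im \<gamma> P) (im \<gamma> Q) \<psi> (r \<gamma> P) = cmp L P Q (im \<gamma> Q) (r \<gamma> Q) \<phi>\<rbrakk> \<Longrightarrow> fmor (cf \<gamma>) P Q \<phi> = \<psi>"
proof -
  note ob = L.Mor_Obj[OF \<phi>] and mor = Gam_Mor[OF \<gamma>]
  define r' where "r' = r (inv\<^bsub>Gam S L\<^esub> \<gamma>) (im \<gamma> P)"
  have rP: "r \<gamma> P \<in> Mor L P (im \<gamma> P)" and rQ: "r \<gamma> Q \<in> Mor L Q (im \<gamma> Q)"
    using r_closed[OF mor] ob by blast+
  have inv: "inverse_mor L P (im \<gamma> P) (r \<gamma> P) r'"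
    unfolding r'_def by (rule r_inverse[OF \<gamma> ob(1)])
  note r' = inverse_morD[OF inv]
  have "inv_mor L P (im \<gamma> P) (r \<gamma> P) = r'"
    by (rule L.inv_mor_eqI[OF rP inv])
  then have "fmor (cf \<gamma>) P Q \<phi> = cmp L (im \<gamma> P) Q (im \<gamma> Q) (r \<gamma> Q) (cmp L (im \<gamma> P) P Q \<phi> r')"
    using \<phi> by (simp add: conj_functor_def Let_def im_def r_def)
  also have "\<dots> = cmp L (im \<gamma> P) P (im \<gamma> Q) (cmp L P Q (im \<gamma> Q) (r \<gamma> Q) \<phi>) r'"
    by (rule L.cmp_assoc[OF r'(1) \<phi> rQ, symmetric])
  finally have eq: "fmor (cf \<gamma>) P Q \<phi> = cmp L (im \<gamma> P) P (im \<gamma> Q) (cmp L P Q (im \<gamma> Q) (r \<gamma> Q) \<phi>) r'" .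
  have c: "cmp L P Q (im \<gamma> Q) (r \<gamma> Q) \<phi> \<in> Mor L P (im \<gamma> Q)"
    by (rule L.cmp_closed[OF \<phi> rQ])
  show "fmor (cf \<gamma>) P Q \<phi> \<in> Mor L (im \<gamma> P) (im \<gamma> Q)"
    unfolding eq by (rule L.cmp_closed[OF r'(1) c])
  show "cmp L P (im \<gamma> P) (im \<gamma> Q) (fmor (cf \<gamma>) P Q \<phi>) (r \<gamma> P) = cmp L P Q (im \<gamma> Q) (r \<gamma> Q) \<phi>"
    unfolding eq by (rule L.inverse_mor_cancel(2)[OF r'(1) L.inverse_mor_sym[OF rP inv] c refl])
  show "fmor (cf \<gamma>) P Q \<phi> = \<psi>" if "\<psi> \<in> Mor L (im \<gamma> P) (im \<gamma> Q)"
      "cmp L P (im \<gamma> P) (im \<gamma> Q) \<psi> (r \<gamma> P) = cmp L P Q (im \<gamma> Q) (r \<gamma> Q) \<phi>"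
    unfolding eq by (rule L.inverse_mor_cancel(2)[OF rP inv that])
qed

lemma cf_end_functors:
  assumes \<gamma>: "\<gamma> \<in> carrier (Gam S L)"
  shows "cf \<gamma> \<in> carrier (end_functors L)"
proof (rule L.end_functorsI)
  note mor = Gam_Mor[OF \<gamma>]
  show "fob (cf \<gamma>) P \<in> Obj L" if "P \<in> Obj L" for P
    using im_closed(1)[OF mor that] that by (simp add: fob_cf)
  show "fmor (cf \<gamma>) P Q \<phi> \<in> Mor L (fob (cf \<gamma>) P) (fob (cf \<gamma>) Q)" if \<phi>: "\<phi> \<in> Mor L P Q" for P Q \<phi>
    using fmor_cf_closed[OF \<gamma> \<phi>] L.Mor_Obj[OF \<phi>] by (simp add: fob_cf)
  show "fmor (cf \<gamma>) P P (idm L P) = idm L (fob (cf \<gamma>) P)" if P: "P \<in> Obj L" for P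
  proof -
    have "fmor (cf \<gamma>) P P (idm L P) = idm L (im \<gamma> P)"
      using r_closed[OF mor P] im_closed(1)[OF mor P]
      by (intro fmor_cf_unique[OF \<gamma> L.idm_closed[OF P]]) simp_all
    then show ?thesis using P by (simp add: fob_cf)
  qed
  show "fmor (cf \<gamma>) P R (cmp L P Q R \<psi> \<phi>) =
      cmp L (fob (cf \<gamma>) P) (fob (cf \<gamma>) Q) (fob (cf \<gamma>) R) (fmor (cf \<gamma>) Q R \<psi>) (fmor (cf \<gamma>) P Q \<phi>)"
    if \<phi>: "\<phi> \<in> Mor L P Q" and \<psi>: "\<psi> \<in> Mor L Q R" for P Q R \<phi> \<psi>
  proof -
    note ob = L.Mor_Obj[OF \<phi>] L.Mor_Obj[OF \<psi>]
    note cl = fmor_cf_closed[OF \<gamma> \<phi>] fmor_cf_closed[OF \<gamma> \<psi>]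
    note r = r_closed[OF mor ob(1)] r_closed[OF mor ob(2)] r_closed[OF mor ob(4)]
    let ?X = "cmp L (im \<gamma> P) (im \<gamma> Q) (im \<gamma> R) (fmor (cf \<gamma>) Q R \<psi>) (fmor (cf \<gamma>) P Q \<phi>)"
    have "cmp L P (im \<gamma> P) (im \<gamma> R) ?X (r \<gamma> P) =
        cmp L P (im \<gamma> Q) (im \<gamma> R) (fmor (cf \<gamma>) Q R \<psi>) (cmp L P Q (im \<gamma> Q) (r \<gamma> Q) \<phi>)"
      unfolding L.cmp_assoc[OF r(1) cl] fmor_cf_r[OF \<gamma> \<phi>] ..
    also have "\<dots> = cmp L P Q (im \<gamma> R) (cmp L Q R (im \<gamma> R) (r \<gamma> R) \<psi>) \<phi>"
      unfolding L.cmp_assoc[OF \<phi> r(2) cl(2), symmetric] fmor_cf_r[OF \<gamma> \<psi>] ..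
    also have "\<dots> = cmp L P R (im \<gamma> R) (r \<gamma> R) (cmp L P Q R \<psi> \<phi>)"
      by (rule L.cmp_assoc[OF \<phi> \<psi> r(3)])
    finally have "fmor (cf \<gamma>) P R (cmp L P Q R \<psi> \<phi>) = ?X"
      by (rule fmor_cf_unique[OF \<gamma> L.cmp_closed[OF \<phi> \<psi>] L.cmp_closed[OF cl]])
    then show ?thesis using ob by (simp add: fob_cf)
  qed
  show "fob (cf \<gamma>) \<in> extensional (Obj L)" "fmor (cf \<gamma>) P Q \<in> extensional (Mor L P Q)" for P Q
    by (simp_all add: conj_functor_def Let_def)
qed

text \<open>By \<open>r_cmp\<close>, stacking the squares for \<gamma>' and \<gamma> gives a square
  for their product.\<close>

lemma cf_mult:
  assumes \<gamma>: "\<gamma> \<in> carrier (Gam S L)" and \<gamma>': "\<gamma>' \<in> carrier (Gam S L)"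
  shows "cf (\<gamma> \<otimes>\<^bsub>Gam S L\<^esub> \<gamma>') = cf \<gamma> \<otimes>\<^bsub>end_functors L\<^esub> cf \<gamma>'"
proof (rule L.end_functors_eqI)
  note mor = Gam_Mor[OF \<gamma>] Gam_Mor[OF \<gamma>']
  have \<gamma>\<gamma>': "\<gamma> \<otimes>\<^bsub>Gam S L\<^esub> \<gamma>' \<in> carrier (Gam S L)" using \<gamma> \<gamma>' by (rule Gam.m_closed)
  show "cf (\<gamma> \<otimes>\<^bsub>Gam S L\<^esub> \<gamma>') \<in> carrier (end_functors L)"
    "cf \<gamma> \<otimes>\<^bsub>end_functors L\<^esub> cf \<gamma>' \<in> carrier (end_functors L)"
    using \<gamma> \<gamma>' \<gamma>\<gamma>' by (blast intro: cf_end_functors L.end_functors_mult_closed)+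
  have im: "im (\<gamma> \<otimes>\<^bsub>Gam S L\<^esub> \<gamma>') P = im \<gamma> (im \<gamma>' P)" if "P \<in> Obj L" for P
    using im_cmp[OF mor that] by simp
  show "fob (cf (\<gamma> \<otimes>\<^bsub>Gam S L\<^esub> \<gamma>')) P = fob (cf \<gamma> \<otimes>\<^bsub>end_functors L\<^esub> cf \<gamma>') P" if "P \<in> Obj L" for P
    using im[OF that] that im_closed(1)[OF mor(2) that] by (simp add: fob_cf L.end_functors_mult del: Gam_simps)
  show "fmor (cf (\<gamma> \<otimes>\<^bsub>Gam S L\<^esub> \<gamma>')) P Q \<phi> = fmor (cf \<gamma> \<otimes>\<^bsub>end_functors L\<^esub> cf \<gamma>') P Q \<phi>"
    if \<phi>: "\<phi> \<in> Mor L P Q" for P Q \<phi>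
  proof -
    note ob = L.Mor_Obj[OF \<phi>]
    define P1 where "P1 = im \<gamma>' P"
    define Q1 where "Q1 = im \<gamma>' Q"
    have ob1: "P1 \<in> Obj L" "Q1 \<in> Obj L"
      unfolding P1_def Q1_def using im_closed(1)[OF mor(2)] ob by blast+
    have \<phi>1: "fmor (cf \<gamma>') P Q \<phi> \<in> Mor L P1 Q1"
      unfolding P1_def Q1_def by (rule fmor_cf_closed[OF \<gamma>' \<phi>])
    let ?X = "fmor (cf \<gamma>) P1 Q1 (fmor (cf \<gamma>') P Q \<phi>)"
    have X: "?X \<in> Mor L (im \<gamma> P1) (im \<gamma> Q1)" by (rule fmor_cf_closed[OF \<gamma> \<phi>1])
    have r: "r \<gamma>' P \<in> Mor L P P1" "r \<gamma>' Q \<in> Mor L Q Q1"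
      "r \<gamma> P1 \<in> Mor L P1 (im \<gamma> P1)" "r \<gamma> Q1 \<in> Mor L Q1 (im \<gamma> Q1)"
      using r_closed[OF mor(2)] r_closed[OF mor(1)] ob ob1 unfolding P1_def Q1_def by blast+
    have rm: "r (\<gamma> \<otimes>\<^bsub>Gam S L\<^esub> \<gamma>') P = cmp L P P1 (im \<gamma> P1) (r \<gamma> P1) (r \<gamma>' P)"
      "r (\<gamma> \<otimes>\<^bsub>Gam S L\<^esub> \<gamma>') Q = cmp L Q Q1 (im \<gamma> Q1) (r \<gamma> Q1) (r \<gamma>' Q)"
      using r_cmp[OF mor ob(1)] r_cmp[OF mor ob(2)] by (simp_all add: P1_def Q1_def)
    have ims: "im (\<gamma> \<otimes>\<^bsub>Gam S L\<^esub> \<gamma>') P = im \<gamma> P1" "im (\<gamma> \<otimes>\<^bsub>Gam S L\<^esub> \<gamma>') Q = im \<gamma> Q1"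
      using im ob by (simp_all add: P1_def Q1_def del: Gam_simps)
    have "cmp L P (im \<gamma> P1) (im \<gamma> Q1) ?X (cmp L P P1 (im \<gamma> P1) (r \<gamma> P1) (r \<gamma>' P)) =
        cmp L P P1 (im \<gamma> Q1) (cmp L P1 Q1 (im \<gamma> Q1) (r \<gamma> Q1) (fmor (cf \<gamma>') P Q \<phi>)) (r \<gamma>' P)"
      unfolding L.cmp_assoc[OF r(1,3) X, symmetric] fmor_cf_r[OF \<gamma> \<phi>1] ..
    also have "\<dots> = cmp L P Q1 (im \<gamma> Q1) (r \<gamma> Q1) (cmp L P Q Q1 (r \<gamma>' Q) \<phi>)"
      unfolding L.cmp_assoc[OF r(1) \<phi>1 r(4)] using fmor_cf_r[OF \<gamma>' \<phi>] by (simp only: P1_def Q1_def)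
    also have "\<dots> = cmp L P Q (im \<gamma> Q1) (cmp L Q Q1 (im \<gamma> Q1) (r \<gamma> Q1) (r \<gamma>' Q)) \<phi>"
      by (rule L.cmp_assoc[OF \<phi> r(2,4), symmetric])
    finally have "fmor (cf (\<gamma> \<otimes>\<^bsub>Gam S L\<^esub> \<gamma>')) P Q \<phi> = ?X"
      using X by (intro fmor_cf_unique[OF \<gamma>\<gamma>' \<phi>]) (simp_all only: ims rm)
    then show ?thesis
      using \<phi> ob by (simp add: L.end_functors_mult fob_cf P1_def Q1_def del: Gam_simps)
  qed
qed

lemma cf_one: "cf (idm L T) = \<one>\<^bsub>end_functors L\<^esub>"
proof (rule L.end_functors_eqI)
  have one: "idm L T \<in> carrier (Gam S L)" using Gam.one_closed by simp
  show "cf (idm L T) \<in> carrier (end_functors L)" by (rule cf_end_functors[OF one])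
  show "\<one>\<^bsub>end_functors L\<^esub> \<in> carrier (end_functors L)"
    by (rule monoid.one_closed[OF L.monoid_end_functors])
  show "fob (cf (idm L T)) P = fob \<one>\<^bsub>end_functors L\<^esub> P" if "P \<in> Obj L" for P
    using that by (simp add: fob_cf im_idm L.end_functors_one)
  show "fmor (cf (idm L T)) P Q \<phi> = fmor \<one>\<^bsub>end_functors L\<^esub> P Q \<phi>" if \<phi>: "\<phi> \<in> Mor L P Q" for P Q \<phi>
  proof -
    have "fmor (cf (idm L T)) P Q \<phi> = \<phi>"
      using \<phi> L.Mor_Obj[OF \<phi>] by (intro fmor_cf_unique[OF one \<phi>]) (simp_all add: im_idm r_idm)
    then show ?thesis using \<phi> by (simp add: L.end_functors_one)
  qed
qed

lemma cf_Units:
  assumes \<gamma>: "\<gamma> \<in> carrier (Gam S L)"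
  shows "cf \<gamma> \<in> Units (end_functors L)"
proof -
  have i: "inv\<^bsub>Gam S L\<^esub> \<gamma> \<in> carrier (Gam S L)" using \<gamma> by simp
  have "cf (inv\<^bsub>Gam S L\<^esub> \<gamma>) \<otimes>\<^bsub>end_functors L\<^esub> cf \<gamma> = \<one>\<^bsub>end_functors L\<^esub>"
    "cf \<gamma> \<otimes>\<^bsub>end_functors L\<^esub> cf (inv\<^bsub>Gam S L\<^esub> \<gamma>) = \<one>\<^bsub>end_functors L\<^esub>"
    using cf_mult[OF \<gamma> i] cf_mult[OF i \<gamma>] Gam.l_inv[OF \<gamma>] Gam.r_inv[OF \<gamma>]
    by (simp_all add: cf_one)
  then show ?thesis
    unfolding Units_def using cf_end_functors[OF \<gamma>] cf_end_functors[OF i] by blast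
qed

text \<open>Followed by the inclusion into S, both sides of the required square become \<gamma>
  precomposed with the inclusion of P, and inclusions are monic.\<close>

lemma cf_incl:
  assumes \<gamma>: "\<gamma> \<in> carrier (Gam S L)" and ob: "P \<in> Obj L" "Q \<in> Obj L" and sub: "P \<subseteq> Q"
  shows "im \<gamma> P \<subseteq> im \<gamma> Q" "fmor (cf \<gamma>) P Q (\<iota> P Q) = \<iota> (im \<gamma> P) (im \<gamma> Q)"
proof -
  note mor = Gam_Mor[OF \<gamma>]
  show sub': "im \<gamma> P \<subseteq> im \<gamma> Q" using sub by (auto simp: im_def)
  note ob' = im_closed(1)[OF mor ob(1)] im_closed(1)[OF mor ob(2)]
  note r = r_closed[OF mor ob(1)] r_closed[OF mor ob(2)]
  note subT = Obj_L_subset[OF ob(1)] Obj_L_subset[OF ob(2)] im_subset[OF mor ob(1)] im_subset[OF mor ob(2)]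
  have i: "\<iota> P Q \<in> Mor L P Q" "\<iota> (im \<gamma> P) (im \<gamma> Q) \<in> Mor L (im \<gamma> P) (im \<gamma> Q)"
    "\<iota> P T \<in> Mor L P T" "\<iota> Q T \<in> Mor L Q T" "\<iota> (im \<gamma> Q) T \<in> Mor L (im \<gamma> Q) T"
    using ob ob' sub sub' subT S_Obj by simp_all
  have "cmp L P (im \<gamma> P) (im \<gamma> Q) (\<iota> (im \<gamma> P) (im \<gamma> Q)) (r \<gamma> P) = cmp L P Q (im \<gamma> Q) (r \<gamma> Q) (\<iota> P Q)"
  proof (rule incl_monic[OF _ _ S_Obj subT(4)])
    show "cmp L P (im \<gamma> P) (im \<gamma> Q) (\<iota> (im \<gamma> P) (im \<gamma> Q)) (r \<gamma> P) \<in> Mor L P (im \<gamma> Q)"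
      "cmp L P Q (im \<gamma> Q) (r \<gamma> Q) (\<iota> P Q) \<in> Mor L P (im \<gamma> Q)"
      using L.cmp_closed[OF r(1) i(2)] L.cmp_closed[OF i(1) r(2)] by blast+
    have "cmp L P (im \<gamma> Q) T (\<iota> (im \<gamma> Q) T) (cmp L P (im \<gamma> P) (im \<gamma> Q) (\<iota> (im \<gamma> P) (im \<gamma> Q)) (r \<gamma> P)) =
        cmp L P T T \<gamma> (\<iota> P T)"
      unfolding L.cmp_assoc[OF r(1) i(2,5), symmetric] incl_cmp[OF ob' S_Obj sub' subT(4)]
      by (rule r_incl[OF mor ob(1)])
    also have "\<dots> = cmp L P T T \<gamma> (cmp L P Q T (\<iota> Q T) (\<iota> P Q))"
      unfolding incl_cmp[OF ob S_Obj sub subT(2)] ..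
    also have "\<dots> = cmp L P Q T (cmp L Q (im \<gamma> Q) T (\<iota> (im \<gamma> Q) T) (r \<gamma> Q)) (\<iota> P Q)"
      unfolding L.cmp_assoc[OF i(1,4) mor, symmetric] r_incl[OF mor ob(2)] ..
    also have "\<dots> = cmp L P (im \<gamma> Q) T (\<iota> (im \<gamma> Q) T) (cmp L P Q (im \<gamma> Q) (r \<gamma> Q) (\<iota> P Q))"
      by (rule L.cmp_assoc[OF i(1) r(2) i(5)])
    finally show "cmp L P (im \<gamma> Q) T (\<iota> (im \<gamma> Q) T) (cmp L P (im \<gamma> P) (im \<gamma> Q) (\<iota> (im \<gamma> P) (im \<gamma> Q)) (r \<gamma> P)) =
      cmp L P (im \<gamma> Q) T (\<iota> (im \<gamma> Q) T) (cmp L P Q (im \<gamma> Q) (r \<gamma> Q) (\<iota> P Q))" .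
  qed
  then show "fmor (cf \<gamma>) P Q (\<iota> P Q) = \<iota> (im \<gamma> P) (im \<gamma> Q)"
    by (rule fmor_cf_unique[OF \<gamma> i(1,2)])
qed

text \<open>Axiom (C) for the restriction of \<gamma> to P is precisely the square that determines
  the left-hand side.\<close>

lemma cf_dlt:
  assumes \<gamma>: "\<gamma> \<in> carrier (Gam S L)" and P: "P \<in> Obj L" and g: "g \<in> P"
  shows "fmor (cf \<gamma>) P P (dlt L P P g) = dlt L (im \<gamma> P) (im \<gamma> P) (prj L T T \<gamma> g)"
proof (rule fmor_cf_unique[OF \<gamma>])
  note mor = Gam_Mor[OF \<gamma>]
  show "dlt L P P g \<in> Mor L P P" by (rule dlt_closed[OF P P self_transporter[OF P g]])
  have "prj L T T \<gamma> g \<in> im \<gamma> P" using g by (simp add: im_def)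
  then show "dlt L (im \<gamma> P) (im \<gamma> P) (prj L T T \<gamma> g) \<in> Mor L (im \<gamma> P) (im \<gamma> P)"
    using im_closed(1)[OF mor P] by (blast intro: dlt_closed self_transporter)
  show "cmp L P (im \<gamma> P) (im \<gamma> P) (dlt L (im \<gamma> P) (im \<gamma> P) (prj L T T \<gamma> g)) (r \<gamma> P) =
      cmp L P P (im \<gamma> P) (r \<gamma> P) (dlt L P P g)"
    using dlt_commute[OF r_closed[OF mor P] g] prj_r[OF mor P g] by simp
qed

lemma cf_Aut_typ:
  assumes \<gamma>: "\<gamma> \<in> carrier (Gam S L)"
  shows "cf \<gamma> \<in> carrier (Aut_typ_I S L)"
proof -
  have "fmor (cf \<gamma>) P P ` dlt L P P ` P = dlt L (im \<gamma> P) (im \<gamma> P) ` im \<gamma> P" if "P \<in> Obj L" for P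
    using cf_dlt[OF \<gamma> that] by (simp add: im_def image_image)
  then show ?thesis
    using cf_Units[OF \<gamma>] cf_incl[OF \<gamma>] by (simp add: Aut_typ_I_def fob_cf)
qed

end

section \<open>The group \<open>Aut_typ_I\<close> and its action on \<Gamma>\<close>

context linking_setting begin

lemma Aut_typ_simps [simp]:
  "\<alpha> \<otimes>\<^bsub>Aut_typ_I S L\<^esub> \<beta> = \<alpha> \<otimes>\<^bsub>end_functors L\<^esub> \<beta>" "\<one>\<^bsub>Aut_typ_I S L\<^esub> = \<one>\<^bsub>end_functors L\<^esub>"
  by (simp_all add: Aut_typ_I_def)

lemma Aut_typD:
  assumes "\<alpha> \<in> carrier (Aut_typ_I S L)"
  shows "\<alpha> \<in> Units (end_functors L)" "\<alpha> \<in> carrier (end_functors L)"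
    "\<lbrakk>P \<in> Obj L; Q \<in> Obj L; P \<subseteq> Q\<rbrakk> \<Longrightarrow> fob \<alpha> P \<subseteq> fob \<alpha> Q"
    "\<lbrakk>P \<in> Obj L; Q \<in> Obj L; P \<subseteq> Q\<rbrakk> \<Longrightarrow> fmor \<alpha> P Q (\<iota> P Q) = \<iota> (fob \<alpha> P) (fob \<alpha> Q)"
    "P \<in> Obj L \<Longrightarrow> fmor \<alpha> P P ` dlt L P P ` P = dlt L (fob \<alpha> P) (fob \<alpha> P) ` fob \<alpha> P"
  using assms by (auto simp: Aut_typ_I_def Units_def)

lemma Aut_typI:
  assumes "\<alpha> \<in> Units (end_functors L)"
    and "\<And>P Q. \<lbrakk>P \<in> Obj L; Q \<in> Obj L; P \<subseteq> Q\<rbrakk> \<Longrightarrow>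
      fob \<alpha> P \<subseteq> fob \<alpha> Q \<and> fmor \<alpha> P Q (\<iota> P Q) = \<iota> (fob \<alpha> P) (fob \<alpha> Q)"
    and "\<And>P. P \<in> Obj L \<Longrightarrow> fmor \<alpha> P P ` dlt L P P ` P = dlt L (fob \<alpha> P) (fob \<alpha> P) ` fob \<alpha> P"
  shows "\<alpha> \<in> carrier (Aut_typ_I S L)"
  using assms by (simp add: Aut_typ_I_def)

lemma dlt_self_closed: "\<lbrakk>P \<in> Obj L; g \<in> P\<rbrakk> \<Longrightarrow> dlt L P P g \<in> Mor L P P"
  by (rule dlt_closed[OF _ _ self_transporter])

text \<open>S is the largest object and \<alpha> preserves order: S is a value of \<alpha>, hence
  contained in the value at S.\<close>

lemma fob_top_if_right_inverse:
  assumes \<alpha>: "\<alpha> \<in> carrier (Aut_typ_I S L)" and \<beta>: "\<beta> \<in> carrier (end_functors L)"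
    and "\<alpha> \<otimes>\<^bsub>end_functors L\<^esub> \<beta> = \<one>\<^bsub>end_functors L\<^esub>"
  shows "fob \<alpha> T = T"
proof -
  have "fob \<alpha> (fob \<beta> T) = T"
    using L.end_functors_mult(1)[OF S_Obj, of \<alpha> \<beta>] L.end_functors_one(1)[OF S_Obj] assms(3) by simp
  moreover have "fob \<alpha> (fob \<beta> T) \<subseteq> fob \<alpha> T"
    using L.fob_closed[OF \<beta> S_Obj] Obj_L_subset S_Obj by (intro Aut_typD(3)[OF \<alpha>]) auto
  moreover have "fob \<alpha> T \<subseteq> T"
    using L.fob_closed[OF Aut_typD(2)[OF \<alpha>] S_Obj] Obj_L_subset by blast
  ultimately show ?thesis by blast
qed

text \<open>By the hypothesis the projection of \<psi> fixes every element of P, and its values lie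
  in Q.\<close>

lemma factor_incl_subset:
  assumes "\<psi> \<in> Mor L P Q" "cmp L P Q T (\<iota> Q T) \<psi> = \<iota> P T"
  shows "P \<subseteq> Q" 
proof
  note ob = L.Mor_Obj[OF assms(1)]
  note sub = Obj_L_subset[OF ob(1)] Obj_L_subset[OF ob(2)]
  fix x assume x: "x \<in> P"
  have "prj L P T (cmp L P Q T (\<iota> Q T) \<psi>) x = prj L P Q \<psi> x"
    using Mor_F(1)[OF prj_closed[OF assms(1)]] x assms(1) ob sub S_Obj
    by (auto simp: prj_cmp prj_incl compose_def)
  moreover have "prj L P T (\<iota> P T) x = x"
    using x ob sub S_Obj by (simp add: prj_incl)
  moreover have "prj L P Q \<psi> x \<in> Q"
    using Mor_F(1)[OF prj_closed[OF assms(1)]] x by auto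
  ultimately show "x \<in> Q" unfolding assms(2) by simp
qed

text \<open>The inverse of an order-preserving bijection need not preserve order. Here \<open>\<beta>(\<iota>\<^sub>P\<^sub>,\<^sub>Q)\<close> factors the
  inclusion of \<open>\<beta>(P)\<close> in \<open>S\<close> through that of \<open>\<beta>(Q)\<close>, which forces \<open>\<beta>(P) \<subseteq> \<beta>(Q)\<close>.\<close>

lemma Aut_typ_inverse:
  assumes \<alpha>: "\<alpha> \<in> carrier (Aut_typ_I S L)" and \<beta>: "\<beta> \<in> carrier (end_functors L)"
    and \<alpha>\<beta>: "\<alpha> \<otimes>\<^bsub>end_functors L\<^esub> \<beta> = \<one>\<^bsub>end_functors L\<^esub>"
    and \<beta>\<alpha>: "\<beta> \<otimes>\<^bsub>end_functors L\<^esub> \<alpha> = \<one>\<^bsub>end_functors L\<^esub>"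
  shows "\<beta> \<in> carrier (Aut_typ_I S L)"
proof (rule Aut_typI)
  note \<alpha>' = Aut_typD(2)[OF \<alpha>]
  show "\<beta> \<in> Units (end_functors L)"
    unfolding Units_def using \<alpha>' \<beta> \<alpha>\<beta> \<beta>\<alpha> by blast
  have ab: "fob \<alpha> (fob \<beta> P) = P" if "P \<in> Obj L" for P
    using L.end_functors_mult(1)[OF that, of \<alpha> \<beta>] L.end_functors_one(1)[OF that] \<alpha>\<beta> by simp
  have ba: "fob \<beta> (fob \<alpha> P) = P" if "P \<in> Obj L" for P
    using L.end_functors_mult(1)[OF that, of \<beta> \<alpha>] L.end_functors_one(1)[OF that] \<beta>\<alpha> by simp
  have ab_mor: "fmor \<alpha> (fob \<beta> P) (fob \<beta> Q) (fmor \<beta> P Q f) = f" if "f \<in> Mor L P Q" for P Q f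
    using L.end_functors_mult(2)[OF that, of \<alpha> \<beta>] L.end_functors_one(2)[OF that] \<alpha>\<beta> by simp
  have ba_mor: "fmor \<beta> (fob \<alpha> P) (fob \<alpha> Q) (fmor \<alpha> P Q f) = f" if "f \<in> Mor L P Q" for P Q f
    using L.end_functors_mult(2)[OF that, of \<beta> \<alpha>] L.end_functors_one(2)[OF that] \<beta>\<alpha> by simp
  have \<alpha>T: "fob \<alpha> T = T" by (rule fob_top_if_right_inverse[OF \<alpha> \<beta> \<alpha>\<beta>])
  show "fob \<beta> P \<subseteq> fob \<beta> Q \<and> fmor \<beta> P Q (\<iota> P Q) = \<iota> (fob \<beta> P) (fob \<beta> Q)"
    if ob: "P \<in> Obj L" "Q \<in> Obj L" and sub: "P \<subseteq> Q" for P Q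
  proof
    define P1 where "P1 = fob \<beta> P"
    define Q1 where "Q1 = fob \<beta> Q"
    define \<psi> where "\<psi> = fmor \<beta> P Q (\<iota> P Q)"
    have ob1: "P1 \<in> Obj L" "Q1 \<in> Obj L" using L.fob_closed[OF \<beta>] ob by (simp_all add: P1_def Q1_def)
    note subT = Obj_L_subset[OF ob1(1)] Obj_L_subset[OF ob1(2)] Obj_L_subset[OF ob(1)] Obj_L_subset[OF ob(2)]
    have fP: "fob \<alpha> P1 = P" "fob \<alpha> Q1 = Q" using ab ob by (simp_all add: P1_def Q1_def)
    have i: "\<iota> P Q \<in> Mor L P Q" "\<iota> Q1 T \<in> Mor L Q1 T" "\<iota> P1 T \<in> Mor L P1 T"
      using ob ob1 sub subT S_Obj by simp_all
    have \<psi>: "\<psi> \<in> Mor L P1 Q1" "fmor \<alpha> P1 Q1 \<psi> = \<iota> P Q"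
      using L.fmor_closed[OF \<beta> i(1)] ab_mor[OF i(1)] by (simp_all add: \<psi>_def P1_def Q1_def)
    have "fmor \<alpha> P1 T (cmp L P1 Q1 T (\<iota> Q1 T) \<psi>) = cmp L P Q T (\<iota> Q T) (\<iota> P Q)"
      using L.fmor_cmp[OF \<alpha>' \<psi>(1) i(2)] Aut_typD(4)[OF \<alpha> ob1(2) S_Obj subT(2)]
      by (simp add: fP \<psi> \<alpha>T)
    also have "\<dots> = \<iota> P T" by (rule incl_cmp[OF ob S_Obj sub subT(4)])
    also have "\<dots> = fmor \<alpha> P1 T (\<iota> P1 T)"
      using Aut_typD(4)[OF \<alpha> ob1(1) S_Obj subT(1)] by (simp add: fP \<alpha>T)
    \<comment> \<open>Since \<beta> undoes \<alpha>, parallel morphisms with equal images under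
      \<alpha> are equal.\<close>
    finally have "cmp L P1 Q1 T (\<iota> Q1 T) \<psi> = \<iota> P1 T"
      using ba_mor[OF L.cmp_closed[OF \<psi>(1) i(2)]] ba_mor[OF i(3)] by metis
    then have sub1: "P1 \<subseteq> Q1" by (rule factor_incl_subset[OF \<psi>(1)])
    then show "fob \<beta> P \<subseteq> fob \<beta> Q" by (simp add: P1_def Q1_def)
    have i1: "\<iota> P1 Q1 \<in> Mor L P1 Q1" using ob1 sub1 by simp
    have "fmor \<alpha> P1 Q1 (\<iota> P1 Q1) = fmor \<alpha> P1 Q1 \<psi>"
      using Aut_typD(4)[OF \<alpha> ob1 sub1] by (simp add: fP \<psi>)
    then have "\<iota> P1 Q1 = \<psi>"
      using ba_mor[OF \<psi>(1)] ba_mor[OF i1] by metis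
    then show "fmor \<beta> P Q (\<iota> P Q) = \<iota> (fob \<beta> P) (fob \<beta> Q)"
      by (simp add: \<psi>_def P1_def Q1_def)
  qed
  show "fmor \<beta> P P ` dlt L P P ` P = dlt L (fob \<beta> P) (fob \<beta> P) ` fob \<beta> P" if P: "P \<in> Obj L" for P
  proof -
    define P1 where "P1 = fob \<beta> P"
    have P1: "P1 \<in> Obj L" "fob \<alpha> P1 = P" using L.fob_closed[OF \<beta> P] ab[OF P] by (simp_all add: P1_def)
    have "dlt L P P ` P = fmor \<alpha> P1 P1 ` dlt L P1 P1 ` P1"
      using Aut_typD(5)[OF \<alpha> P1(1)] by (simp add: P1)
    then have "fmor \<beta> P P ` dlt L P P ` P = (\<lambda>g. fmor \<beta> P P (fmor \<alpha> P1 P1 (dlt L P1 P1 g))) ` P1"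
      by (simp add: image_image)
    also have "\<dots> = dlt L P1 P1 ` P1"
    proof (rule image_cong[OF refl])
      fix g assume "g \<in> P1"
      then show "fmor \<beta> P P (fmor \<alpha> P1 P1 (dlt L P1 P1 g)) = dlt L P1 P1 g"
        using ba_mor[OF dlt_self_closed[OF P1(1)]] by (simp add: P1)
    qed
    finally show ?thesis by (simp add: P1_def)
  qed
qed

lemma group_Aut_typ: "group (Aut_typ_I S L)"
proof (rule groupI)
  interpret E: monoid "end_functors L" by (rule L.monoid_end_functors)
  show "\<one>\<^bsub>Aut_typ_I S L\<^esub> \<in> carrier (Aut_typ_I S L)"
  proof -
    have "fmor \<one>\<^bsub>end_functors L\<^esub> P P ` dlt L P P ` P = dlt L P P ` P" if "P \<in> Obj L" for P
      unfolding image_image using dlt_self_closed[OF that]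
      by (intro image_cong) (simp_all add: L.end_functors_one)
    then show ?thesis
      by (intro Aut_typI) (simp_all add: L.end_functors_one)
  qed
  show "\<alpha> \<otimes>\<^bsub>Aut_typ_I S L\<^esub> \<beta> \<in> carrier (Aut_typ_I S L)"
    if \<alpha>: "\<alpha> \<in> carrier (Aut_typ_I S L)" and \<beta>: "\<beta> \<in> carrier (Aut_typ_I S L)" for \<alpha> \<beta>
  proof -
    note ob = L.fob_closed[OF Aut_typD(2)[OF \<beta>]]
    have "\<alpha> \<otimes>\<^bsub>end_functors L\<^esub> \<beta> \<in> carrier (Aut_typ_I S L)"
    proof (rule Aut_typI)
      show "\<alpha> \<otimes>\<^bsub>end_functors L\<^esub> \<beta> \<in> Units (end_functors L)"
        using Aut_typD(1)[OF \<alpha>] Aut_typD(1)[OF \<beta>] by (rule E.Units_m_closed)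
      fix P Q assume PQ: "P \<in> Obj L" "Q \<in> Obj L" "P \<subseteq> Q"
      show "fob (\<alpha> \<otimes>\<^bsub>end_functors L\<^esub> \<beta>) P \<subseteq> fob (\<alpha> \<otimes>\<^bsub>end_functors L\<^esub> \<beta>) Q \<and>
        fmor (\<alpha> \<otimes>\<^bsub>end_functors L\<^esub> \<beta>) P Q (\<iota> P Q) =
        \<iota> (fob (\<alpha> \<otimes>\<^bsub>end_functors L\<^esub> \<beta>) P) (fob (\<alpha> \<otimes>\<^bsub>end_functors L\<^esub> \<beta>) Q)"
        using Aut_typD(3,4)[OF \<beta> PQ] Aut_typD(3,4)[OF \<alpha> ob[OF PQ(1)] ob[OF PQ(2)]] PQ
        by (simp add: L.end_functors_mult)
    next
      fix P assume P: "P \<in> Obj L"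
      have "fmor (\<alpha> \<otimes>\<^bsub>end_functors L\<^esub> \<beta>) P P ` dlt L P P ` P =
          fmor \<alpha> (fob \<beta> P) (fob \<beta> P) ` fmor \<beta> P P ` dlt L P P ` P"
        unfolding image_image using dlt_self_closed[OF P]
        by (intro image_cong) (simp_all add: L.end_functors_mult)
      also have "\<dots> = dlt L (fob \<alpha> (fob \<beta> P)) (fob \<alpha> (fob \<beta> P)) ` fob \<alpha> (fob \<beta> P)"
        unfolding Aut_typD(5)[OF \<beta> P] Aut_typD(5)[OF \<alpha> ob[OF P]] ..
      finally show "fmor (\<alpha> \<otimes>\<^bsub>end_functors L\<^esub> \<beta>) P P ` dlt L P P ` P =
          dlt L (fob (\<alpha> \<otimes>\<^bsub>end_functors L\<^esub> \<beta>) P) (fob (\<alpha> \<otimes>\<^bsub>end_functors L\<^esub> \<beta>) P) `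
          fob (\<alpha> \<otimes>\<^bsub>end_functors L\<^esub> \<beta>) P"
        using P by (simp add: L.end_functors_mult)
    qed
    then show ?thesis by simp
  qed
  show "\<exists>\<beta>\<in>carrier (Aut_typ_I S L). \<beta> \<otimes>\<^bsub>Aut_typ_I S L\<^esub> \<alpha> = \<one>\<^bsub>Aut_typ_I S L\<^esub>"
    if \<alpha>: "\<alpha> \<in> carrier (Aut_typ_I S L)" for \<alpha>
  proof -
    obtain \<beta> where "\<beta> \<in> carrier (end_functors L)" "\<alpha> \<otimes>\<^bsub>end_functors L\<^esub> \<beta> = \<one>\<^bsub>end_functors L\<^esub>"
      "\<beta> \<otimes>\<^bsub>end_functors L\<^esub> \<alpha> = \<one>\<^bsub>end_functors L\<^esub>"
      using Aut_typD(1)[OF \<alpha>] unfolding Units_def by blast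
    then show ?thesis using Aut_typ_inverse[OF \<alpha>] by (intro bexI[of _ \<beta>]) simp_all
  qed
qed (simp_all add: monoid.m_assoc[OF L.monoid_end_functors] monoid.l_one[OF L.monoid_end_functors] Aut_typD(2))

lemma Aut_typ_fob_top:
  assumes \<alpha>: "\<alpha> \<in> carrier (Aut_typ_I S L)"
  shows "fob \<alpha> T = T"
proof -
  obtain \<beta> where "\<beta> \<in> carrier (end_functors L)" "\<alpha> \<otimes>\<^bsub>end_functors L\<^esub> \<beta> = \<one>\<^bsub>end_functors L\<^esub>"
    using Aut_typD(1)[OF \<alpha>] unfolding Units_def by blast
  then show ?thesis by (rule fob_top_if_right_inverse[OF \<alpha>])
qed

lemma im_top: "\<gamma> \<in> carrier (Gam S L) \<Longrightarrow> im \<gamma> T = T"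
  using functor_inverse_mor[OF prj_functor S_Obj S_Obj Gam_Mor Gam_inverse_mor, of \<gamma>]
  by (simp add: im_def Iso_F_image[OF prj_closed[OF Gam_Mor]])

lemma r_top:
  assumes "\<gamma> \<in> carrier (Gam S L)"
  shows "r \<gamma> T = \<gamma>"
  using Gam_Mor[OF assms] S_Obj
  by (intro r_unique) (simp_all add: im_top[OF assms] incl_refl)

lemma fmor_Gam:
  assumes \<alpha>: "\<alpha> \<in> carrier (Aut_typ_I S L)" and x: "x \<in> carrier (Gam S L)"
  shows "fmor \<alpha> T T x \<in> carrier (Gam S L)"
proof (rule Gam_I)
  show "fmor \<alpha> T T x \<in> Mor L T T"
    using L.fmor_closed[OF Aut_typD(2)[OF \<alpha>] Gam_Mor[OF x]] Aut_typ_fob_top[OF \<alpha>] by simp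
  show "inverse_mor L T T (fmor \<alpha> T T x) (fmor \<alpha> T T (inv\<^bsub>Gam S L\<^esub> x))"
    using functor_inverse_mor[OF L.end_functorsD(1)[OF Aut_typD(2)[OF \<alpha>]] S_Obj S_Obj
        Gam_Mor[OF x] Gam_inverse_mor[OF x]] Aut_typ_fob_top[OF \<alpha>] by simp
qed

text \<open>\<alpha> carries the restriction square of x to one for its image, because inclusions go
  to inclusions. Having no values on elements, \<alpha> does not show the image of
  \<open>fob \<alpha> P\<close> directly; but the restriction of x is an isomorphism, so \<alpha>
  makes it an isomorphism again, and its projection is onto its target.\<close>

lemma restr_Aut_typ:
  assumes \<alpha>: "\<alpha> \<in> carrier (Aut_typ_I S L)" and x: "x \<in> carrier (Gam S L)" and P: "P \<in> Obj L"
  shows im_Aut_typ: "im (fmor \<alpha> T T x) (fob \<alpha> P) = fob \<alpha> (im x P)"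
    and r_Aut_typ: "r (fmor \<alpha> T T x) (fob \<alpha> P) = fmor \<alpha> P (im x P) (r x P)"
proof -
  note \<alpha>' = Aut_typD(2)[OF \<alpha>] and \<alpha>T = Aut_typ_fob_top[OF \<alpha>]
  define x' where "x' = fmor \<alpha> T T x"
  define Q where "Q = im x P"
  define P1 where "P1 = fob \<alpha> P"
  define Q1 where "Q1 = fob \<alpha> Q"
  define s where "s = fmor \<alpha> P Q (r x P)"
  note mor = Gam_Mor[OF x]
  have x': "x' \<in> Mor L T T" using Gam_Mor[OF fmor_Gam[OF \<alpha> x]] by (simp add: x'_def)
  have Q: "Q \<in> Obj L" using im_closed(1)[OF mor P] by (simp add: Q_def)
  have ob1: "P1 \<in> Obj L" "Q1 \<in> Obj L" using L.fob_closed[OF \<alpha>'] P Q by (simp_all add: P1_def Q1_def)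
  note subT = Obj_L_subset[OF P] Obj_L_subset[OF Q] Obj_L_subset[OF ob1(1)] Obj_L_subset[OF ob1(2)]
  have i: "\<iota> P T \<in> Mor L P T" "\<iota> Q T \<in> Mor L Q T" "\<iota> P1 T \<in> Mor L P1 T" "\<iota> Q1 T \<in> Mor L Q1 T"
    using P Q ob1 subT S_Obj by simp_all
  have r: "r x P \<in> Mor L P Q" "cmp L P Q T (\<iota> Q T) (r x P) = cmp L P T T x (\<iota> P T)"
    using r_closed[OF mor P] r_incl[OF mor P] by (simp_all add: Q_def)
  have s: "s \<in> Mor L P1 Q1"
    using L.fmor_closed[OF \<alpha>' r(1)] by (simp add: s_def P1_def Q1_def)
  have "cmp L P1 Q1 T (\<iota> Q1 T) s = fmor \<alpha> P T (cmp L P Q T (\<iota> Q T) (r x P))"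
    using L.fmor_cmp[OF \<alpha>' r(1) i(2)] Aut_typD(4)[OF \<alpha> Q S_Obj subT(2)]
    by (simp add: s_def P1_def Q1_def \<alpha>T)
  also have "\<dots> = cmp L P1 T T x' (\<iota> P1 T)"
    unfolding r(2) using L.fmor_cmp[OF \<alpha>' i(1) mor] Aut_typD(4)[OF \<alpha> P S_Obj subT(1)]
    by (simp add: x'_def P1_def \<alpha>T)
  finally have eq: "cmp L P1 Q1 T (\<iota> Q1 T) s = cmp L P1 T T x' (\<iota> P1 T)" .
  have "inverse_mor L P Q (r x P) (r (inv\<^bsub>Gam S L\<^esub> x) Q)"
    using r_inverse[OF x P] by (simp add: Q_def)
  from functor_inverse_mor[OF L.end_functorsD(1)[OF \<alpha>'] P Q r(1) this]
  have "inverse_mor L P1 Q1 s (fmor \<alpha> Q P (r (inv\<^bsub>Gam S L\<^esub> x) Q))"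
    by (simp add: s_def P1_def Q1_def)
  from functor_inverse_mor[OF prj_functor ob1 s this]
  have "prj L P1 Q1 s ` P1 = Q1"
    using Iso_F_image[OF prj_closed[OF s]] by simp
  moreover have "prj L P1 Q1 s y = prj L T T x' y" if "y \<in> P1" for y
  proof -
    have "prj L P1 T (cmp L P1 Q1 T (\<iota> Q1 T) s) y = prj L P1 Q1 s y"
      using Mor_F(1)[OF prj_closed[OF s]] that s i ob1 subT S_Obj
      by (auto simp: prj_cmp prj_incl compose_def)
    then show ?thesis
      unfolding eq restrict_prj[OF x' ob1(1)] using that by simp
  qed
  ultimately have im: "im x' P1 = Q1" unfolding im_def by (metis image_cong)
  then show "im (fmor \<alpha> T T x) (fob \<alpha> P) = fob \<alpha> (im x P)"
    by (simp add: x'_def P1_def Q1_def Q_def)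
  have "r x' P1 = s"
    by (rule r_unique[OF x' ob1(1)]) (simp_all only: im s eq)
  then show "r (fmor \<alpha> T T x) (fob \<alpha> P) = fmor \<alpha> P (im x P) (r x P)"
    by (simp add: x'_def P1_def s_def Q_def)
qed

text \<open>By \<open>restr_Aut_typ\<close>, applying \<alpha> to the square that determines
  \<open>c\<^sub>x(\<phi>)\<close> gives the square that determines the conjugate of
  \<alpha>(\<phi>).\<close>

lemma cf_equivariant:
  assumes \<alpha>: "\<alpha> \<in> carrier (Aut_typ_I S L)" and x: "x \<in> carrier (Gam S L)"
  shows "cf (fmor \<alpha> T T x) \<otimes>\<^bsub>end_functors L\<^esub> \<alpha> = \<alpha> \<otimes>\<^bsub>end_functors L\<^esub> cf x"
proof (rule L.end_functors_eqI)
  note \<alpha>' = Aut_typD(2)[OF \<alpha>]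
  note x' = fmor_Gam[OF \<alpha> x]
  note mor = Gam_Mor[OF x]
  show "cf (fmor \<alpha> T T x) \<otimes>\<^bsub>end_functors L\<^esub> \<alpha> \<in> carrier (end_functors L)"
    "\<alpha> \<otimes>\<^bsub>end_functors L\<^esub> cf x \<in> carrier (end_functors L)"
    using L.end_functors_mult_closed cf_end_functors[OF x] cf_end_functors[OF x'] \<alpha>' by blast+
  show "fob (cf (fmor \<alpha> T T x) \<otimes>\<^bsub>end_functors L\<^esub> \<alpha>) P = fob (\<alpha> \<otimes>\<^bsub>end_functors L\<^esub> cf x) P"
    if P: "P \<in> Obj L" for P
    using im_Aut_typ[OF \<alpha> x P] L.fob_closed[OF \<alpha>' P] P by (simp add: L.end_functors_mult fob_cf)
  show "fmor (cf (fmor \<alpha> T T x) \<otimes>\<^bsub>end_functors L\<^esub> \<alpha>) P Q \<phi> = fmor (\<alpha> \<otimes>\<^bsub>end_functors L\<^esub> cf x) P Q \<phi>"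
    if \<phi>: "\<phi> \<in> Mor L P Q" for P Q \<phi>
  proof -
    note ob = L.Mor_Obj[OF \<phi>]
    note r = r_closed[OF mor ob(1)] r_closed[OF mor ob(2)]
    note X = fmor_cf_closed[OF x \<phi>]
    have "fmor (cf (fmor \<alpha> T T x)) (fob \<alpha> P) (fob \<alpha> Q) (fmor \<alpha> P Q \<phi>) =
        fmor \<alpha> (im x P) (im x Q) (fmor (cf x) P Q \<phi>)"
    proof (rule fmor_cf_unique[OF x' L.fmor_closed[OF \<alpha>' \<phi>]],
        unfold im_Aut_typ[OF \<alpha> x ob(1)] im_Aut_typ[OF \<alpha> x ob(2)] r_Aut_typ[OF \<alpha> x ob(1)] r_Aut_typ[OF \<alpha> x ob(2)])
      show "fmor \<alpha> (im x P) (im x Q) (fmor (cf x) P Q \<phi>) \<in> Mor L (fob \<alpha> (im x P)) (fob \<alpha> (im x Q))"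
        by (rule L.fmor_closed[OF \<alpha>' X])
      show "cmp L (fob \<alpha> P) (fob \<alpha> (im x P)) (fob \<alpha> (im x Q))
          (fmor \<alpha> (im x P) (im x Q) (fmor (cf x) P Q \<phi>)) (fmor \<alpha> P (im x P) (r x P)) =
        cmp L (fob \<alpha> P) (fob \<alpha> Q) (fob \<alpha> (im x Q)) (fmor \<alpha> Q (im x Q) (r x Q)) (fmor \<alpha> P Q \<phi>)"
        unfolding L.fmor_cmp[OF \<alpha>' r(1) X, symmetric] L.fmor_cmp[OF \<alpha>' \<phi> r(2), symmetric]
          fmor_cf_r[OF x \<phi>] ..
    qed
    then show ?thesis using \<phi> ob by (simp add: L.end_functors_mult fob_cf)
  qed
qed

text \<open>The restriction of x to S is x itself, so the square at S reads as conjugation. This is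
  the Peiffer identity.\<close>

lemma cf_top:
  assumes x: "x \<in> carrier (Gam S L)" and y: "y \<in> carrier (Gam S L)"
  shows "fmor (cf x) T T y = x \<otimes>\<^bsub>Gam S L\<^esub> y \<otimes>\<^bsub>Gam S L\<^esub> inv\<^bsub>Gam S L\<^esub> x"
proof (rule fmor_cf_unique[OF x Gam_Mor[OF y]], unfold im_top[OF x] r_top[OF x])
  have c: "x \<otimes>\<^bsub>Gam S L\<^esub> y \<otimes>\<^bsub>Gam S L\<^esub> inv\<^bsub>Gam S L\<^esub> x \<in> carrier (Gam S L)"
    using x y by (simp del: Gam_simps)
  then show "x \<otimes>\<^bsub>Gam S L\<^esub> y \<otimes>\<^bsub>Gam S L\<^esub> inv\<^bsub>Gam S L\<^esub> x \<in> Mor L T T" by (rule Gam_Mor)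
  have "x \<otimes>\<^bsub>Gam S L\<^esub> y \<otimes>\<^bsub>Gam S L\<^esub> inv\<^bsub>Gam S L\<^esub> x \<otimes>\<^bsub>Gam S L\<^esub> x = x \<otimes>\<^bsub>Gam S L\<^esub> y"
    using x y by (simp add: Gam.m_assoc del: Gam_simps)
  then show "cmp L T T T (x \<otimes>\<^bsub>Gam S L\<^esub> y \<otimes>\<^bsub>Gam S L\<^esub> inv\<^bsub>Gam S L\<^esub> x) x = cmp L T T T x y"
    by simp
qed

lemma crossed_module_Aut_typ:
  "crossed_module (Gam S L) (Aut_typ_I S L) cf (\<lambda>\<alpha>. fmor \<alpha> T T)"
proof -
  interpret A: group "Aut_typ_I S L" by (rule group_Aut_typ)
  show ?thesis
  proof unfold_locales
    show "cf \<in> hom (Gam S L) (Aut_typ_I S L)"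
      using cf_Aut_typ cf_mult by (simp add: hom_def del: Gam_simps)
    fix \<alpha> assume \<alpha>: "\<alpha> \<in> carrier (Aut_typ_I S L)"
    show "fmor \<alpha> T T \<in> hom (Gam S L) (Gam S L)"
      using fmor_Gam[OF \<alpha>] L.fmor_cmp[OF Aut_typD(2)[OF \<alpha>] Gam_Mor Gam_Mor] Aut_typ_fob_top[OF \<alpha>]
      by (simp add: hom_def)
    fix x assume x: "x \<in> carrier (Gam S L)"
    show "cf (fmor \<alpha> T T x) \<otimes>\<^bsub>Aut_typ_I S L\<^esub> \<alpha> = \<alpha> \<otimes>\<^bsub>Aut_typ_I S L\<^esub> cf x"
      using cf_equivariant[OF \<alpha> x] by simp
    fix \<beta> assume \<beta>: "\<beta> \<in> carrier (Aut_typ_I S L)"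
    show "fmor (\<alpha> \<otimes>\<^bsub>Aut_typ_I S L\<^esub> \<beta>) T T x = fmor \<alpha> T T (fmor \<beta> T T x)"
      using Gam_Mor[OF x] Aut_typ_fob_top[OF \<beta>] by (simp add: L.end_functors_mult)
  next
    show "fmor \<one>\<^bsub>Aut_typ_I S L\<^esub> T T x = x" if "x \<in> carrier (Gam S L)" for x
      using Gam_Mor[OF that] by (simp add: L.end_functors_one)
  qed (fact cf_top)
qed

end

section \<open>Extension pairs and twisting functions\<close>

lemma (in crossed_module_extension) exists_unique_twisting:
  "\<exists>!\<phi>. twisting_function (group_cat G) M \<phi> \<and>
    (\<forall>g\<in>carrier G. ([\<tau> (t g)], []) = \<phi> 1 (bar [g])) \<and>
    (\<forall>g\<in>carrier G. \<forall>h\<in>carrier G. t g \<otimes>\<^bsub>E\<^esub> t h = e (hd (snd (\<phi> 2 (bar [g, h])))) \<otimes>\<^bsub>E\<^esub> t (g \<otimes>\<^bsub>G\<^esub> h))"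
proof (rule ex1I[of _ twist])
  show "twisting_function (group_cat G) M twist \<and>
    (\<forall>g\<in>carrier G. ([\<tau> (t g)], []) = twist 1 (bar [g])) \<and>
    (\<forall>g\<in>carrier G. \<forall>h\<in>carrier G. t g \<otimes>\<^bsub>E\<^esub> t h = e (hd (snd (twist 2 (bar [g, h])))) \<otimes>\<^bsub>E\<^esub> t (g \<otimes>\<^bsub>G\<^esub> h))"
    using twisting_function_twist twist_1 e_twist_2 by simp
  fix \<phi>
  assume \<phi>: "twisting_function (group_cat G) M \<phi> \<and>
    (\<forall>g\<in>carrier G. ([\<tau> (t g)], []) = \<phi> 1 (bar [g])) \<and>
    (\<forall>g\<in>carrier G. \<forall>h\<in>carrier G. t g \<otimes>\<^bsub>E\<^esub> t h = e (hd (snd (\<phi> 2 (bar [g, h])))) \<otimes>\<^bsub>E\<^esub> t (g \<otimes>\<^bsub>G\<^esub> h))"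
  \<comment> \<open>Both functions are read as cocycles, so that their edges in degree 2 are known
    to lie in \<Gamma>, where \<open>e\<close> is injective.\<close>
  then interpret c: twisting_cocycle \<Gamma> A c act G \<phi>
    by unfold_locales blast
  interpret d: twisting_cocycle \<Gamma> A c act G twist
    by unfold_locales (rule twisting_function_twist)
  show "\<phi> = twist"
  proof (rule twisting_function_unique[OF G.is_group c.twisting twisting_function_twist])
    show "\<phi> 1 (bar [g]) = twist 1 (bar [g])" if "g \<in> carrier G" for g
      using \<phi> twist_1[OF that] that by simp
    show "hd (snd (\<phi> 2 (bar [g, h]))) = hd (snd (twist 2 (bar [g, h])))"
      if g: "g \<in> carrier G" and h: "h \<in> carrier G" for g h
    proof -
      have "e (c.\<chi> g h) \<otimes>\<^bsub>E\<^esub> t (g \<otimes>\<^bsub>G\<^esub> h) = e (d.\<chi> g h) \<otimes>\<^bsub>E\<^esub> t (g \<otimes>\<^bsub>G\<^esub> h)"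
        using \<phi> e_twist_2[OF g h] g h unfolding c.\<chi>_def d.\<chi>_def by simp
      then have "c.\<chi> g h = d.\<chi> g h"
        using g h by (simp add: t_closed e_eq_iff)
      then show ?thesis unfolding c.\<chi>_def d.\<chi>_def .
    qed
  qed
qed

lemma (in linking_setting) Aut_typ_cat_eq:
  "Aut_typ_cat S L = crossed_module.M (Gam S L) (Aut_typ_I S L) cf (\<lambda>\<alpha>. fmor \<alpha> T T)"
  by (simp add: crossed_module.M_def[OF crossed_module_Aut_typ] Aut_typ_cat_def)

lemma Gam_Obj: "x \<in> carrier (Gam S L) \<Longrightarrow> category L \<Longrightarrow> carrier S \<in> Obj L"
  unfolding category_def by (auto simp: Gam_def aut_group_def Iso_def)

lemma linking_triple_category:
  assumes "linking_triple p S F L"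
  shows "category L"
proof -
  obtain H where "linking_system p S F H L"
    using assms unfolding linking_triple_def by (elim conjE exE) blast
  then show ?thesis unfolding linking_system_def by (elim conjE)
qed

text \<open>The set of objects of \<open>L\<close> may a priori be empty, but then \<open>\<Gamma>\<close> is empty and there is neither an
  extension pair nor a twisting function.\<close>

lemma linking_settingI:
  assumes "linking_triple p S F L" "x \<in> carrier (Gam S L)"
  shows "linking_setting p S F L"
  using assms Gam_Obj[OF assms(2) linking_triple_category[OF assms(1)]] by unfold_locales

lemma twisting_for_ex1:
  assumes triple: "linking_triple p S F L" and G: "group G"
    and U: "extension_pair S L G U" and t: "regular_section G U t"
  shows "\<exists>!\<phi>. twisting_for S L G U t \<phi>"
proof -
  note U' = U[unfolded extension_pair_def]
  \<comment> \<open>The kernel contains the identity and is the image of \<Gamma>, so \<Gamma> is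
    inhabited and S is an object.\<close>
  have "\<one>\<^bsub>ehat U\<^esub> \<in> kernel (ehat U) G (erho U)"
  proof -
    have "group (ehat U)" "erho U \<in> hom (ehat U) G" using U' by (auto simp: epi_def)
    then show ?thesis using G by (simp add: kernel_def hom_one group.is_monoid[THEN monoid.one_closed])
  qed
  then obtain x where x: "x \<in> carrier (Gam S L)" using U' by auto
  interpret linking_setting p S F L by (rule linking_settingI[OF triple x])
  interpret X: crossed_module "Gam S L" "Aut_typ_I S L" cf "\<lambda>\<alpha>. fmor \<alpha> T T"
    by (rule crossed_module_Aut_typ)
  interpret G: group G by (rule G)
  interpret E: group "ehat U" using U' by blast
  interpret crossed_module_extension "Gam S L" "Aut_typ_I S L" cf "\<lambda>\<alpha>. fmor \<alpha> T T" "ehat U" G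
    "einc U" "erho U" "etau U" t
    using U' t by unfold_locales (auto simp: epi_def regular_section_def)
  show ?thesis
    unfolding twisting_for_def Aut_typ_cat_eq by (rule exists_unique_twisting)
qed

lemma twisting_function_extension_pair:
  fixes L :: "('a, 'm) linking" and G :: "('g, 'y) monoid_scheme"
  assumes triple: "linking_triple p S F L" and G: "group G"
    and \<phi>: "twisting_function (group_cat G) (Aut_typ_cat S L) \<phi>"
  shows "\<exists>(U :: ('a, 'm, 'g, 'm \<times> 'g) ext_pair) t.
    extension_pair S L G U \<and> regular_section G U t \<and> phi_U S L G U t = \<phi>"
proof -
  interpret G: group G by (rule G)
  \<comment> \<open>The edge of this 1-simplex is an element of \<Gamma>, which shows that S is an
    object.\<close>
  have "\<phi> 2 (bar [\<one>\<^bsub>G\<^esub>, \<one>\<^bsub>G\<^esub>]) \<in> nerve (Aut_typ_cat S L) 1"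
    using twisting_function_nerve[OF \<phi>, of "bar [\<one>\<^bsub>G\<^esub>, \<one>\<^bsub>G\<^esub>]" 2] by (simp add: nerve_group_cat)
  then obtain x where x: "x \<in> carrier (Gam S L)"
    by (auto simp: nerve_def Aut_typ_cat_def)
  interpret linking_setting p S F L by (rule linking_settingI[OF triple x])
  interpret X: crossed_module "Gam S L" "Aut_typ_I S L" cf "\<lambda>\<alpha>. fmor \<alpha> T T"
    by (rule crossed_module_Aut_typ)
  interpret C: twisting_cocycle "Gam S L" "Aut_typ_I S L" cf "\<lambda>\<alpha>. fmor \<alpha> T T" G \<phi>
    using \<phi> by unfold_locales (simp add: Aut_typ_cat_eq)
  interpret X: crossed_module_extension "Gam S L" "Aut_typ_I S L" cf "\<lambda>\<alpha>. fmor \<alpha> T T" C.E G C.e snd C.\<tau> C.t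
    by (rule C.crossed_module_extension)
  define U :: "('a, 'm, 'g, 'm \<times> 'g) ext_pair"
    where "U = \<lparr>ehat = C.E, einc = C.e, erho = snd, etau = C.\<tau>\<rparr>"
  have U: "ehat U = C.E" "einc U = C.e" "erho U = snd" "etau U = C.\<tau>"
    by (simp_all add: U_def)
  have "snd ` carrier C.E = carrier G" by force
  then have "snd \<in> epi C.E G" using X.\<rho>_hom by (simp add: epi_def)
  moreover have "C.e ` carrier (Gam S L) \<lhd> C.E"
  proof -
    interpret \<rho>: group_hom C.E G snd using X.\<rho>_hom by unfold_locales
    show ?thesis using \<rho>.normal_kernel by (simp only: X.kernel_\<rho>)
  qed
  ultimately have ext: "extension_pair S L G U"
    unfolding extension_pair_def U
    using X.E.is_group X.e_mon X.kernel_\<rho> X.\<tau>_hom X.\<tau>_e X.e_act by blast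
  have sec: "regular_section G U C.t"
    unfolding regular_section_def U using X.t_closed X.\<rho>_t X.t_one by auto
  have tw: "twisting_for S L G U C.t \<phi>"
    unfolding twisting_for_def Aut_typ_cat_eq U
    using X.twisting_function_twist X.twist_1 X.e_twist_2 unfolding C.twist_eq by simp
  \<comment> \<open>Uniqueness for this pair and section identifies the function described by
    \<open>THE\<close> with \<phi>.\<close>
  have "phi_U S L G U C.t = \<phi>"
    unfolding phi_U_def by (rule the1_equality[OF twisting_for_ex1[OF triple G ext sec], OF tw])
  with ext sec show ?thesis by blast
qed

theorem proposition6p2:
  fixes p :: nat
    and S :: "'a monoid"
    and F :: "('a set, 'a \<Rightarrow> 'a) cat"
    and L :: "('a, 'm) linking"
    and G :: "'g monoid"
  assumes "prime p"
    and "linking_triple p S F L"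
    and "group G" and "finite (carrier G)"
  shows "(\<forall>(U :: ('a, 'm, 'g, 'h) ext_pair) t.
            extension_pair S L G U \<and> regular_section G U t \<longrightarrow>
            (\<exists>!\<phi>. twisting_for S L G U t \<phi>))
       \<and> (\<forall>\<phi>. twisting_function (group_cat G) (Aut_typ_cat S L) \<phi> \<longrightarrow>
            (\<exists>(U :: ('a, 'm, 'g, 'm \<times> 'g) ext_pair) t.
               extension_pair S L G U \<and> regular_section G U t \<and> phi_U S L G U t = \<phi>))"
proof (intro conjI allI impI)
  fix U :: "('a, 'm, 'g, 'h) ext_pair" and t
  assume "extension_pair S L G U \<and> regular_section G U t"
  then show "\<exists>!\<phi>. twisting_for S L G U t \<phi>"
    using twisting_for_ex1[OF assms(2,3)] by blast
qed (rule twisting_function_extension_pair[OF assms(2,3)])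

end
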